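(* Let $\Gamma$ be a tropical curve with a fixed model $(G,|\cdot|)$ and let $d\ge0$. The functor $\Sigma_{(G,d)}\colon\Xi_d(G)^{op}\to\mathbf{cPoly}$, $(G',D)\mapsto\Delta(G',D)=\prod_{e\in E(G)}\Delta(n_e,|e|)$, on the category $\Xi_d(G)$ of stable pairs of degree $d$ over $G$, defines a colored polysimplicial complex without self-gluing whose geometric realization is in natural bijection with the set $\mathrm{Div}_d^+(\Gamma)$ of effective divisors of degree $d$ on $\Gamma$.
   Context: **Tropical curves.** A metric graph is an equivalence class of pairs $(G,|\cdot|)$ of a graph $G=(V,E)$ and a length function $|\cdot|\colon E\to\mathbb R_{>0}$, two pairs being equivalent if they have a common length-preserving refinement; it is identified with its geometric realization. A tropical curve is a metric graph $\Gamma$ with a finitely supported weight function $h\colon\Gamma\to\mathbb Z_{\ge0}$. A model of $\Gamma$ is a pair $(G,|\cdot|)$ representing $\Gamma$ such that the support of $h$ is contained in $V(G)$. Divisors on $\Gamma$ are finite formal sums of points with integer coefficients; the degree is the sum of the coefficients, and a divisor is effective if the coefficient of every point is $\ge0$. **Colored polysimplices.** For $\vec n=(n_1,\dots,n_r)\in\mathbb N^r$ and $\vec a\in\mathbb R_{>0}^r$ put $|\vec n|=\sum_i(n_i+1)$. The standard colored polysimplex is $\Delta(\vec n,\vec a)=\prod_i\Delta(n_i,a_i)$ with $\Delta(n,a)=\{x\in\mathbb R_{\ge0}^{n+1}:\sum_{j=0}^nx_j=a\}$; the $a_i$ are its colors. A colored polysimplex is a topological space $\Delta$ with an injective homomorphism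 $\mathbb N^{|\vec n|}\hookrightarrow C^0(\Delta,\mathbb R)$ such that the induced map $\Delta\to\mathrm{Hom}(\mathbb N^{|\vec n|},\mathbb R_{\ge0})=\mathbb R_{\ge0}^{|\vec n|}$ is a homeomorphism onto some $\Delta(\vec n,\vec a)$. A morphism $\Delta\to\Delta'$ is a continuous map whose pullback of functions restricts to a homomorphism of monoids $\mathbb N^{|\vec n'|}\to\mathbb N^{|\vec n|}$. A face is the zero set of a function in the monoid, with the induced structure. A face morphism is a morphism inducing an isomorphism onto a face. $\mathbf{cPoly}$ is the category of standard colored polysimplices with face morphisms. **Colored polysimplicial complexes.** A colored polysimplicial complex is a functor $\Sigma\colon\Xi\to\mathbf{cPoly}$ from a small category $\Xi$ such that: (i) for all $F\in\Xi$ and all $i\colon\Delta\to\Sigma(F)$ there are $F'\in\Xi$ and $\iota\colon F'\to F$ with $\Sigma(F')=\Delta$ and $\Sigma(\iota)=i$; (ii) for all $\alpha\colon F_1\to F$, $\beta\colon F_2\to F$ and $c\colon\Sigma(F_1)\to\Sigma(F_2)$ with $\Sigma(\beta)\circ c=\Sigma(\alpha)$ there is a unique $\gamma\colon F_1\to F_2$ with $\Sigma(\gamma)=c$; (iii) $\Sigma$ is faithful. It is without self-gluing if, instead of (iii), the stronger condition holds that (iii)' all objects of $\Xi$ have no automorphisms but the trivial one. The geometric realization is the colimit of the polysimplices $\Sigma(F)$ along the face morphisms. **Stable pairs.** $G$ carries the vertex weight $h$. A weighted edge contraction $\phi\colon(G',h')\to(G,h)$ is an edge contraction $G'\to G$ with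 $h'(\phi^{-1}(v))=h(v)$ for all $v\in V(G)$. It is a chain contraction if it is given by contracting chains of edges that contain only vertices $v$ with $h'(v)=0$; the inner vertices of these chains are called exceptional. A chain contraction induces $\phi_*\colon\sum_{v'\in V(G')}n_{v'}v'\mapsto\sum_{v\in V(G)}\big(\sum_{v'\in\phi^{-1}(v)}n_{v'}\big)v$ on effective divisors supported on vertices. A stable pair of degree $d$ over $G$ is a tuple $(\phi\colon G'\to G,D)$, abbreviated $(G',D)$, consisting of a chain contraction $\phi$ and an effective divisor $D$ of degree $d$ on $G'$ (supported on $V(G')$) such that $D(v)>0$ for all exceptional vertices $v$ of $G'$. Morphisms $(G_1',D_1)\to(G_2',D_2)$ in $\Xi_d(G)$ are chain contractions $\phi_{12}\colon G_1'\to G_2'$ such that $\phi_2\circ\phi_{12}=\phi_1$ and $\phi_{12,*}D_1=D_2$. **The functor.** In $\Delta(G',D)=\prod_{e\in E(G)}\Delta(n_e,|e|)$, $n_e$ is the number of exceptional vertices of $G'$ that are contracted to the endpoints of $e$. Points of $\Delta(G',D)$ are thought of as tuples $(x_{e'})_{e'\in E(G')}$ of non-negative numbers such that, for each edge $e$ of $G$, the sum of $x_{e'}$ over all edges $e'$ with $\phi(e')$ equal to $e$ or an endpoint of $e$ is $|e|$. $\Sigma_{(G,d)}$ sends the morphism given by $\phi_{12}$ to the face morphism $\Delta(G_2',D_2)\hookrightarrow\Delta(G_1',D_1)$ whose image is given by setting $x_{e'}=0$ for the edges $e'$ of $G_1'$ contracted by $\phi_{12}$. Under the natural bijection, a point $(x_{e'})$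 with all $x_{e'}>0$ in the relative interior of $\Delta(G',D)$ corresponds to the divisor on $\Gamma$ defined by $D$, where $\Gamma$ is the geometric realization of $G'$ with edge lengths $x_{e'}$.
   Formalization: φ₂∘φ₁₂=φ₁ is read as: φ₁₂ takes the chain of G' over each edge of G to the chain over it (read literally, (i) fails for one edge, d=1); n_e counts inner vertices of the chain over e; polysimplex morphisms carry their monoid map, as ℕ^|n|→C⁰(Δ) is not injective for equal colors. *)

theory Defs
  imports
    "HOL-Analysis.Function_Topology"
    "HOL-Library.FuncSet"
    "HOL-Library.Multiset"
    "HOL-Library.Poly_Mapping"
    "Graph_Theory.Digraph"
begin

section \<open>Categories\<close>

record ('o, 'm) cat =
  Ob :: "'o set"
  Hom :: "'o \<Rightarrow> 'o \<Rightarrow> 'm set"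
  Id :: "'o \<Rightarrow> 'm"
  Comp :: "'o \<Rightarrow> 'o \<Rightarrow> 'o \<Rightarrow> 'm \<Rightarrow> 'm \<Rightarrow> 'm"

text \<open>\<^term>\<open>Comp C X Y Z g f\<close> is the composite of \<open>f : X \<rightarrow> Y\<close> and \<open>g : Y \<rightarrow> Z\<close>. Hom-sets of
  different pairs of objects need not be disjoint.\<close>

definition category :: "('o, 'm) cat \<Rightarrow> bool" where
  "category C \<longleftrightarrow>
     (\<forall>X\<in>Ob C. Id C X \<in> Hom C X X) \<and>
     (\<forall>X\<in>Ob C. \<forall>Y\<in>Ob C. \<forall>Z\<in>Ob C. \<forall>f\<in>Hom C X Y. \<forall>g\<in>Hom C Y Z.
        Comp C X Y Z g f \<in> Hom C X Z) \<and>
     (\<forall>X\<in>Ob C. \<forall>Y\<in>Ob C. \<forall>f\<in>Hom C X Y.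
        Comp C X X Y f (Id C X) = f \<and> Comp C X Y Y (Id C Y) f = f) \<and>
     (\<forall>W\<in>Ob C. \<forall>X\<in>Ob C. \<forall>Y\<in>Ob C. \<forall>Z\<in>Ob C.
        \<forall>f\<in>Hom C W X. \<forall>g\<in>Hom C X Y. \<forall>k\<in>Hom C Y Z.
        Comp C W Y Z k (Comp C W X Y g f) = Comp C W X Z (Comp C X Y Z k g) f)"

definition iso_in :: "('o, 'm) cat \<Rightarrow> 'o \<Rightarrow> 'o \<Rightarrow> 'm \<Rightarrow> bool" where
  "iso_in C X Y f \<longleftrightarrow> f \<in> Hom C X Y \<and>
     (\<exists>g\<in>Hom C Y X. Comp C X Y X g f = Id C X \<and> Comp C Y X Y f g = Id C Y)"

definition op_cat :: "('o, 'm) cat \<Rightarrow> ('o, 'm) cat" where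
  "op_cat C = \<lparr>Ob = Ob C, Hom = (\<lambda>X Y. Hom C Y X), Id = Id C,
               Comp = (\<lambda>X Y Z g f. Comp C Z Y X f g)\<rparr>"

definition is_functor ::
  "('o, 'm) cat \<Rightarrow> ('p, 'n) cat \<Rightarrow> ('o \<Rightarrow> 'p) \<Rightarrow> ('o \<Rightarrow> 'o \<Rightarrow> 'm \<Rightarrow> 'n) \<Rightarrow> bool" where
  "is_functor C D So Sm \<longleftrightarrow>
     category C \<and> category D \<and>
     (\<forall>X\<in>Ob C. So X \<in> Ob D) \<and>
     (\<forall>X\<in>Ob C. \<forall>Y\<in>Ob C. \<forall>f\<in>Hom C X Y. Sm X Y f \<in> Hom D (So X) (So Y)) \<and>
     (\<forall>X\<in>Ob C. Sm X X (Id C X) = Id D (So X)) \<and>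
     (\<forall>X\<in>Ob C. \<forall>Y\<in>Ob C. \<forall>Z\<in>Ob C. \<forall>f\<in>Hom C X Y. \<forall>g\<in>Hom C Y Z.
        Sm X Z (Comp C X Y Z g f) = Comp D (So X) (So Y) (So Z) (Sm Y Z g) (Sm X Y f))"


section \<open>Standard colored polysimplices\<close>

text \<open>
  A standard colored polysimplex \<open>\<Prod>\<^sub>i \<Delta>(n\<^sub>i, a\<^sub>i)\<close> is given by the finite set of its factors.
  The factor \<open>\<Delta>(n, a)\<close> is the pair \<open>(I, a)\<close>, where \<open>I\<close> is the set of labels of its \<open>n + 1\<close>
  coordinates; different factors have disjoint sets of labels. Labels are used instead of an
  enumeration of the factors and coordinates because \<open>\<Delta>(G', D)\<close> is a product over the set of
  edges of \<open>G\<close> with coordinates indexed by the set of edges of \<open>G'\<close>.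
\<close>

type_synonym 'c pdata = "('c set \<times> real) set"

definition coords :: "'c pdata \<Rightarrow> 'c set" where
  "coords P = \<Union>(fst ` P)"

definition is_pdata :: "'c pdata \<Rightarrow> bool" where
  "is_pdata P \<longleftrightarrow> finite P \<and> (\<forall>(I, a)\<in>P. finite I \<and> I \<noteq> {} \<and> a > 0) \<and> disjoint_family_on fst P"

text \<open>\<open>\<real>\<^bsup>C\<^esup>\<close> is realized as the set of functions vanishing off \<open>C\<close>, so that the inclusion of a
  coordinate subspace is an inclusion of sets.\<close>

definition polysimplex :: "'c pdata \<Rightarrow> ('c \<Rightarrow> real) set" where
  "polysimplex P = {x. (\<forall>c. 0 \<le> x c) \<and> (\<forall>c. c \<notin> coords P \<longrightarrow> x c = 0) \<and>
                       (\<forall>(I, a)\<in>P. (\<Sum>c\<in>I. x c) = a)}"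

text \<open>The free commutative monoid \<open>\<nat>\<^bsup>C\<^esup>\<close> on the coordinates, as finite multisets, and its
  evaluation as functions on the polysimplex.\<close>

definition mon :: "'c pdata \<Rightarrow> 'c multiset set" where
  "mon P = {M. set_mset M \<subseteq> coords P}"

definition pairing :: "'c multiset \<Rightarrow> ('c \<Rightarrow> real) \<Rightarrow> real" where
  "pairing M x = (\<Sum>c\<in>#M. x c)"

text \<open>
  A morphism is a continuous map \<open>f\<close> together with the homomorphism \<open>\<eta>\<close> of monoids given by
  pullback along \<open>f\<close>. The latter is recorded since \<open>\<nat>\<^bsup>C\<^esup> \<rightarrow> C\<^sup>0(\<Delta>)\<close> is not injective if several
  colors are commensurable: the sum of the coordinates of a factor is constant.
\<close>

type_synonym 'c pmor = "(('c \<Rightarrow> real) \<Rightarrow> ('c \<Rightarrow> real)) \<times> ('c multiset \<Rightarrow> 'c multiset)"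

definition poly_mor :: "'c pdata \<Rightarrow> 'c pdata \<Rightarrow> 'c pmor set" where
  "poly_mor P Q = {(f, \<eta>).
     f \<in> polysimplex P \<rightarrow>\<^sub>E polysimplex Q \<and> continuous_on (polysimplex P) f \<and>
     \<eta> \<in> mon Q \<rightarrow>\<^sub>E mon P \<and> \<eta> {#} = {#} \<and> (\<forall>M\<in>mon Q. \<forall>N\<in>mon Q. \<eta> (M + N) = \<eta> M + \<eta> N) \<and>
     (\<forall>M\<in>mon Q. \<forall>x\<in>polysimplex P. pairing M (f x) = pairing (\<eta> M) x)}"

definition all_poly :: "('c pdata, 'c pmor) cat" where
  "all_poly = \<lparr>Ob = {P. is_pdata P}, Hom = poly_mor,
     Id = (\<lambda>P. (\<lambda>x\<in>polysimplex P. x, \<lambda>M\<in>mon P. M)),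
     Comp = (\<lambda>P Q R (g, \<theta>) (f, \<eta>). (compose (polysimplex P) g f, compose (mon R) \<eta> \<theta>))\<rparr>"

text \<open>The zero set of the function \<open>M\<close> with its induced structure. It is a polysimplex iff no
  factor loses all of its coordinates, that is, iff the zero set is nonempty.\<close>

definition face :: "'c pdata \<Rightarrow> 'c multiset \<Rightarrow> 'c pdata" where
  "face Q M = (\<lambda>(I, a). (I - set_mset M, a)) ` Q"

lemma polysimplex_face:
  assumes "is_pdata Q" "M \<in> mon Q"
  shows "polysimplex (face Q M) = {x \<in> polysimplex Q. pairing M x = 0}"
proof -
  have fin: "finite I" if "(I, a) \<in> Q" for I a
    using assms(1) that by (auto simp: is_pdata_def)
  have co: "coords (face Q M) = coords Q - set_mset M"
    by (auto simp: coords_def face_def)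
  have pz: "pairing M x = 0 \<longleftrightarrow> (\<forall>c\<in>#M. x c = 0)" if "\<forall>c. 0 \<le> x c" for x :: "'a \<Rightarrow> real"
  proof -
    have "0 \<le> pairing N x \<and> (pairing N x = 0 \<longleftrightarrow> (\<forall>c\<in>#N. x c = 0))" for N
      using that
      by (induction N) (auto simp: pairing_def add_nonneg_eq_0_iff)
    then show ?thesis by blast
  qed
  have sm: "(\<Sum>c\<in>I - set_mset M. x c) = (\<Sum>c\<in>I. x c)"
    if "(I, a) \<in> Q" "\<forall>c\<in>#M. x c = 0" for I a and x :: "'a \<Rightarrow> real"
    using fin[OF that(1)] that(2) by (intro sum.mono_neutral_left) auto
  have Mc: "set_mset M \<subseteq> coords Q" using assms(2) by (simp add: mon_def)
  show ?thesis
  proof (intro set_eqI iffI)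
    fix x assume x: "x \<in> polysimplex (face Q M)"
    then have nn: "\<forall>c. 0 \<le> x c" and off: "\<And>c. c \<notin> coords Q - set_mset M \<Longrightarrow> x c = 0"
      and s: "\<And>I a. (I, a) \<in> Q \<Longrightarrow> (\<Sum>c\<in>I - set_mset M. x c) = a"
      unfolding polysimplex_def co by (auto simp: face_def)
    have "\<forall>c\<in>#M. x c = 0" using off by auto
    then show "x \<in> {x \<in> polysimplex Q. pairing M x = 0}"
      using nn off s sm pz[OF nn] by (auto simp: polysimplex_def)
  next
    fix x assume "x \<in> {x \<in> polysimplex Q. pairing M x = 0}"
    then have nn: "\<forall>c. 0 \<le> x c" and off: "\<And>c. c \<notin> coords Q \<Longrightarrow> x c = 0"
      and s: "\<And>I a. (I, a) \<in> Q \<Longrightarrow> (\<Sum>c\<in>I. x c) = a" and z: "\<forall>c\<in>#M. x c = 0"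
      using pz by (auto simp: polysimplex_def)
    show "x \<in> polysimplex (face Q M)"
      unfolding polysimplex_def co using nn off s z sm by (auto simp: face_def)
  qed
qed

definition face_incl :: "'c pdata \<Rightarrow> 'c multiset \<Rightarrow> 'c pmor" where
  "face_incl Q M = (\<lambda>x\<in>polysimplex (face Q M). x, \<lambda>N\<in>mon Q. filter_mset (\<lambda>c. c \<notin># M) N)"

definition face_mor :: "'c pdata \<Rightarrow> 'c pdata \<Rightarrow> 'c pmor set" where
  "face_mor P Q = {k \<in> poly_mor P Q. \<exists>M\<in>mon Q. is_pdata (face Q M) \<and>
     (\<exists>g. iso_in all_poly P (face Q M) g \<and> k = Comp all_poly P (face Q M) Q (face_incl Q M) g)}"

definition cPoly :: "('c pdata, 'c pmor) cat" where
  "cPoly = all_poly\<lparr>Hom := face_mor\<rparr>"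


section \<open>Colored polysimplicial complexes\<close>

definition polysimplicial_complex ::
  "('o, 'm) cat \<Rightarrow> ('o \<Rightarrow> 'c pdata) \<Rightarrow> ('o \<Rightarrow> 'o \<Rightarrow> 'm \<Rightarrow> 'c pmor) \<Rightarrow> bool" where
  "polysimplicial_complex \<Xi> So Sm \<longleftrightarrow>
     is_functor \<Xi> cPoly So Sm \<and>
     (\<forall>F\<in>Ob \<Xi>. \<forall>P\<in>Ob cPoly. \<forall>i\<in>Hom cPoly P (So F).
        \<exists>F'\<in>Ob \<Xi>. \<exists>\<iota>\<in>Hom \<Xi> F' F. So F' = P \<and> Sm F' F \<iota> = i) \<and>
     (\<forall>F\<in>Ob \<Xi>. \<forall>F1\<in>Ob \<Xi>. \<forall>F2\<in>Ob \<Xi>. \<forall>\<alpha>\<in>Hom \<Xi> F1 F. \<forall>\<beta>\<in>Hom \<Xi> F2 F.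
        \<forall>c\<in>Hom cPoly (So F1) (So F2).
        Comp cPoly (So F1) (So F2) (So F) (Sm F2 F \<beta>) c = Sm F1 F \<alpha> \<longrightarrow>
        (\<exists>!\<gamma>. \<gamma> \<in> Hom \<Xi> F1 F2 \<and> Sm F1 F2 \<gamma> = c)) \<and>
     (\<forall>F1\<in>Ob \<Xi>. \<forall>F2\<in>Ob \<Xi>. inj_on (Sm F1 F2) (Hom \<Xi> F1 F2))"

definition polysimplicial_complex_without_self_gluing ::
  "('o, 'm) cat \<Rightarrow> ('o \<Rightarrow> 'c pdata) \<Rightarrow> ('o \<Rightarrow> 'o \<Rightarrow> 'm \<Rightarrow> 'c pmor) \<Rightarrow> bool" where
  "polysimplicial_complex_without_self_gluing \<Xi> So Sm \<longleftrightarrow>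
     polysimplicial_complex \<Xi> So Sm \<and> (\<forall>F\<in>Ob \<Xi>. \<forall>f. iso_in \<Xi> F F f \<longrightarrow> f = Id \<Xi> F)"

text \<open>The underlying set of the geometric realization: the colimit, that is, the quotient of the
  disjoint union of the polysimplices by the equivalence relation that the face morphisms
  generate.\<close>

definition points_over :: "('o, 'm) cat \<Rightarrow> ('o \<Rightarrow> 'c pdata) \<Rightarrow> ('o \<times> ('c \<Rightarrow> real)) set" where
  "points_over \<Xi> So = (SIGMA F:Ob \<Xi>. polysimplex (So F))"

definition glue_step ::
  "('o, 'm) cat \<Rightarrow> ('o \<Rightarrow> 'c pdata) \<Rightarrow> ('o \<Rightarrow> 'o \<Rightarrow> 'm \<Rightarrow> 'c pmor) \<Rightarrow> ('o \<times> ('c \<Rightarrow> real)) rel" where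
  "glue_step \<Xi> So Sm = {((F1, x), (F2, fst (Sm F1 F2 f) x)) | F1 F2 f x.
     F1 \<in> Ob \<Xi> \<and> F2 \<in> Ob \<Xi> \<and> f \<in> Hom \<Xi> F1 F2 \<and> x \<in> polysimplex (So F1)}"

definition glue ::
  "('o, 'm) cat \<Rightarrow> ('o \<Rightarrow> 'c pdata) \<Rightarrow> ('o \<Rightarrow> 'o \<Rightarrow> 'm \<Rightarrow> 'c pmor) \<Rightarrow> ('o \<times> ('c \<Rightarrow> real)) rel" where
  "glue \<Xi> So Sm = (glue_step \<Xi> So Sm \<union> (glue_step \<Xi> So Sm)\<inverse>)\<^sup>*"

definition realization ::
  "('o, 'm) cat \<Rightarrow> ('o \<Rightarrow> 'c pdata) \<Rightarrow> ('o \<Rightarrow> 'o \<Rightarrow> 'm \<Rightarrow> 'c pmor) \<Rightarrow> ('o \<times> ('c \<Rightarrow> real)) set set" where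
  "realization \<Xi> So Sm = points_over \<Xi> So // glue \<Xi> So Sm"


section \<open>Tropical curves and divisors\<close>

text \<open>
  Graphs are undirected, with loops and multiple edges allowed. They are given by finite digraphs
  whose arcs are the edges with an arbitrary reference orientation. A dart \<open>(e, b)\<close> is the edge
  \<open>e\<close> traversed from \<open>tail\<close> to \<open>head\<close> (\<open>b = True\<close>) or backwards (\<open>b = False\<close>). Maps of graphs are
  maps of darts and may change the reference orientations.
\<close>

type_synonym 'e dart = "'e \<times> bool"

definition dart_source :: "('v, 'e) pre_digraph \<Rightarrow> 'e dart \<Rightarrow> 'v" where
  "dart_source G x = (if snd x then tail G (fst x) else head G (fst x))"

definition dart_target :: "('v, 'e) pre_digraph \<Rightarrow> 'e dart \<Rightarrow> 'v" where
  "dart_target G x = (if snd x then head G (fst x) else tail G (fst x))"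

record ('v, 'e) wgraph =
  gr :: "('v, 'e) pre_digraph"
  wt :: "'v \<Rightarrow> nat"

text \<open>Points of the geometric realization of a metric graph: \<open>On e t\<close> is the inner point of the
  edge \<open>e\<close> at distance \<open>t\<close> from the tail of \<open>e\<close>.\<close>

datatype ('v, 'e) gpoint = At 'v | On 'e real

definition metric_graph :: "('v, 'e) pre_digraph \<Rightarrow> ('e \<Rightarrow> real) \<Rightarrow> ('v, 'e) gpoint set" where
  "metric_graph G len = At ` verts G \<union> {On e t | e t. e \<in> arcs G \<and> 0 < t \<and> t < len e}"

text \<open>\<open>(G, len)\<close> is a model of the tropical curve \<open>\<Gamma>\<close> with weight function \<open>h\<close>, where \<open>\<Gamma>\<close> is
  identified with the geometric realization of \<open>(G, len)\<close>.\<close>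

definition tropical_curve_model ::
  "('v, 'e) pre_digraph \<Rightarrow> ('e \<Rightarrow> real) \<Rightarrow> (('v, 'e) gpoint \<Rightarrow> nat) \<Rightarrow> bool" where
  "tropical_curve_model G len h \<longleftrightarrow>
     fin_digraph G \<and> (\<forall>e\<in>arcs G. len e > 0) \<and>
     finite {p \<in> metric_graph G len. h p \<noteq> 0} \<and>
     {p \<in> metric_graph G len. h p \<noteq> 0} \<subseteq> At ` verts G"

definition model_wgraph ::
  "('v, 'e) pre_digraph \<Rightarrow> (('v, 'e) gpoint \<Rightarrow> nat) \<Rightarrow> ('v, 'e) wgraph" where
  "model_wgraph G h = \<lparr>gr = G, wt = (\<lambda>v. h (At v))\<rparr>"

definition div_degree :: "('p \<Rightarrow>\<^sub>0 int) \<Rightarrow> int" where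
  "div_degree D = (\<Sum>p\<in>Poly_Mapping.keys D. Poly_Mapping.lookup D p)"

definition effective_divisors :: "'p set \<Rightarrow> nat \<Rightarrow> ('p \<Rightarrow>\<^sub>0 int) set" where
  "effective_divisors X d = {D. Poly_Mapping.keys D \<subseteq> X \<and>
     (\<forall>p. 0 \<le> Poly_Mapping.lookup D p) \<and> div_degree D = int d}"

definition push_div :: "('p \<Rightarrow> 'q) \<Rightarrow> ('p \<Rightarrow>\<^sub>0 int) \<Rightarrow> ('q \<Rightarrow>\<^sub>0 int)" where
  "push_div f D = frag_extend (\<lambda>p. frag_of (f p)) D"


section \<open>Contractions\<close>

text \<open>\<open>emap f a = Inl v\<close> means that the edge \<open>a\<close> is contracted to \<open>v\<close>, and \<open>emap f a = Inr x\<close> that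
  \<open>a\<close> in its reference orientation is sent to the dart \<open>x\<close>.\<close>

record ('w, 'f, 'v, 'e) gmap =
  vmap :: "'w \<Rightarrow> 'v"
  emap :: "'f \<Rightarrow> 'v + 'e dart"

definition contracted :: "('w, 'f, 'v, 'e) gmap \<Rightarrow> 'f \<Rightarrow> bool" where
  "contracted f a \<longleftrightarrow> isl (emap f a)"

definition edge_image :: "('w, 'f, 'v, 'e) gmap \<Rightarrow> 'f \<Rightarrow> 'e" where
  "edge_image f a = fst (projr (emap f a))"

definition dart_image :: "('w, 'f, 'v, 'e) gmap \<Rightarrow> 'f dart \<Rightarrow> 'e dart option" where
  "dart_image f x = (case emap f (fst x) of Inl v \<Rightarrow> None | Inr (e, b) \<Rightarrow> Some (e, snd x = b))"

definition gmap_id :: "('v, 'e) pre_digraph \<Rightarrow> ('v, 'e, 'v, 'e) gmap" where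
  "gmap_id G = \<lparr>vmap = (\<lambda>v\<in>verts G. v), emap = (\<lambda>a\<in>arcs G. Inr (a, True))\<rparr>"

definition gmap_comp :: "('u, 'd) pre_digraph \<Rightarrow> ('w, 'f, 'v, 'e) gmap \<Rightarrow> ('u, 'd, 'w, 'f) gmap \<Rightarrow>
    ('u, 'd, 'v, 'e) gmap" where
  "gmap_comp H g f =
    \<lparr>vmap = compose (verts H) (vmap g) (vmap f),
     emap = (\<lambda>a\<in>arcs H. case emap f a of
               Inl w \<Rightarrow> Inl (vmap g w)
             | Inr (e, b) \<Rightarrow> (case emap g e of Inl v \<Rightarrow> Inl v | Inr (e', b') \<Rightarrow> Inr (e', b = b')))\<rparr>"

definition edge_contraction ::
  "('w, 'f) pre_digraph \<Rightarrow> ('v, 'e) pre_digraph \<Rightarrow> ('w, 'f, 'v, 'e) gmap \<Rightarrow> bool" where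
  "edge_contraction H G f \<longleftrightarrow>
     vmap f \<in> extensional (verts H) \<and> vmap f ` verts H = verts G \<and>
     emap f \<in> extensional (arcs H) \<and>
     (\<forall>a\<in>arcs H. case emap f a of
        Inl v \<Rightarrow> vmap f (tail H a) = v \<and> vmap f (head H a) = v
      | Inr x \<Rightarrow> fst x \<in> arcs G \<and> vmap f (tail H a) = dart_source G x \<and>
                 vmap f (head H a) = dart_target G x) \<and>
     (\<forall>e\<in>arcs G. \<exists>!a. a \<in> arcs H \<and> \<not> contracted f a \<and> edge_image f a = e) \<and>
     (\<forall>u\<in>verts H. \<forall>v\<in>verts H. vmap f u = vmap f v \<longrightarrow>
        (u, v) \<in> {(dart_source H x, dart_target H x) | x.
           fst x \<in> arcs H \<and> contracted f (fst x)}\<^sup>*)"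

definition weighted_edge_contraction ::
  "('w, 'f) wgraph \<Rightarrow> ('v, 'e) wgraph \<Rightarrow> ('w, 'f, 'v, 'e) gmap \<Rightarrow> bool" where
  "weighted_edge_contraction H G f \<longleftrightarrow> edge_contraction (gr H) (gr G) f \<and>
     (\<forall>v\<in>verts (gr G). (\<Sum>w | w \<in> verts (gr H) \<and> vmap f w = v. wt H w) = wt G v)"

text \<open>
  A system of chains in \<open>H\<close> which, when each chain is contracted to a single edge, gives \<open>G\<close>:
  \<open>cchain K e\<close> is the chain that becomes \<open>e\<close>, listed from the tail to the head of \<open>e\<close>, and
  \<open>cvert K v\<close> is the vertex of \<open>H\<close> that becomes \<open>v\<close>. The remaining vertices of \<open>H\<close> are the inner
  vertices of the chains; these are the exceptional vertices.
\<close>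

record ('w, 'f, 'v, 'e) chains =
  cvert :: "'v \<Rightarrow> 'w"
  cchain :: "'e \<Rightarrow> 'f dart list"

definition exceptional ::
  "('w, 'f) wgraph \<Rightarrow> ('v, 'e) wgraph \<Rightarrow> ('w, 'f, 'v, 'e) chains \<Rightarrow> 'w set" where
  "exceptional H G K = verts (gr H) - cvert K ` verts (gr G)"

definition is_chain :: "('w, 'f) pre_digraph \<Rightarrow> 'w \<Rightarrow> 'f dart list \<Rightarrow> 'w \<Rightarrow> bool" where
  "is_chain H u xs v \<longleftrightarrow> xs \<noteq> [] \<and> fst ` set xs \<subseteq> arcs H \<and>
     dart_source H (hd xs) = u \<and> dart_target H (last xs) = v \<and>
     successively (\<lambda>x y. dart_target H x = dart_source H y) xs"

definition inner_vertex_at :: "('w, 'f) wgraph \<Rightarrow> ('v, 'e) wgraph \<Rightarrow> ('w, 'f, 'v, 'e) chains \<Rightarrow>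
    'w \<Rightarrow> 'e \<times> nat \<Rightarrow> bool" where
  "inner_vertex_at H G K w p \<longleftrightarrow> fst p \<in> arcs (gr G) \<and> Suc (snd p) < length (cchain K (fst p)) \<and>
     dart_target (gr H) (cchain K (fst p) ! snd p) = w"

definition chain_system ::
  "('w, 'f) wgraph \<Rightarrow> ('v, 'e) wgraph \<Rightarrow> ('w, 'f, 'v, 'e) chains \<Rightarrow> bool" where
  "chain_system H G K \<longleftrightarrow>
     cvert K ` verts (gr G) \<subseteq> verts (gr H) \<and> inj_on (cvert K) (verts (gr G)) \<and>
     (\<forall>e\<in>arcs (gr G). is_chain (gr H) (cvert K (tail (gr G) e)) (cchain K e) (cvert K (head (gr G) e))) \<and>
     (\<forall>a\<in>arcs (gr H). \<exists>!p. fst p \<in> arcs (gr G) \<and> snd p < length (cchain K (fst p)) \<and>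
        fst (cchain K (fst p) ! snd p) = a) \<and>
     (\<forall>w p. inner_vertex_at H G K w p \<longrightarrow> w \<in> exceptional H G K) \<and>
     (\<forall>w\<in>exceptional H G K. \<exists>!p. inner_vertex_at H G K w p) \<and>
     (\<forall>w\<in>exceptional H G K. wt H w = 0)"

text \<open>\<open>f\<close> is the chain contraction given by contracting each chain of \<open>K\<close> to an edge: in the chain
  over \<open>e\<close>, all edges are contracted except for one, which is mapped to \<open>e\<close>.\<close>

definition chain_contraction :: "('w, 'f) wgraph \<Rightarrow> ('v, 'e) wgraph \<Rightarrow>
    ('w, 'f, 'v, 'e) chains \<Rightarrow> ('w, 'f, 'v, 'e) gmap \<Rightarrow> bool" where
  "chain_contraction H G K f \<longleftrightarrow>
     weighted_edge_contraction H G f \<and> chain_system H G K \<and>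
     (\<forall>v\<in>verts (gr G). vmap f (cvert K v) = v) \<and>
     (\<forall>e\<in>arcs (gr G). List.map_filter (dart_image f) (cchain K e) = [(e, True)])"


section \<open>Stable pairs\<close>

text \<open>The graphs \<open>G'\<close> have natural numbers as vertices and edges, so that there is a set of them;
  up to isomorphism these are all finite graphs.\<close>

record ('v, 'e) stable_pair =
  sp_graph :: "(nat, nat) wgraph"
  sp_map :: "(nat, nat, 'v, 'e) gmap"
  sp_chains :: "(nat, nat, 'v, 'e) chains"
  sp_div :: "nat \<Rightarrow>\<^sub>0 int"

definition stable_pairs :: "('v, 'e) wgraph \<Rightarrow> nat \<Rightarrow> ('v, 'e) stable_pair set" where
  "stable_pairs G d = {F.
     fin_digraph (gr (sp_graph F)) \<and>
     chain_contraction (sp_graph F) G (sp_chains F) (sp_map F) \<and>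
     sp_div F \<in> effective_divisors (verts (gr (sp_graph F))) d \<and>
     (\<forall>w\<in>exceptional (sp_graph F) G (sp_chains F). 0 < Poly_Mapping.lookup (sp_div F) w)}"

text \<open>
  The identity \<open>\<phi>\<^sub>2 \<circ> \<phi>\<^sub>1\<^sub>2 = \<phi>\<^sub>1\<close> of chain contractions to \<open>G\<close> says that both contract the same
  chains to the same edges: \<open>\<phi>\<^sub>1\<^sub>2\<close> takes the vertex over \<open>v\<close> to the vertex over \<open>v\<close>, and the chain
  over \<open>e\<close> to the chain over \<open>e\<close>. It does not depend on which edge of a chain is left uncontracted
  by \<open>\<phi>\<^sub>1\<close> and \<open>\<phi>\<^sub>2\<close>: otherwise the first edge of a chain and the last one could not both be
  contracted by morphisms from the same pair, and \<open>\<Delta>(G', D)\<close> would lack faces.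
\<close>

definition over_base :: "('v, 'e) wgraph \<Rightarrow> ('v, 'e) stable_pair \<Rightarrow> ('v, 'e) stable_pair \<Rightarrow>
    (nat, nat, nat, nat) gmap \<Rightarrow> bool" where
  "over_base G F1 F2 f \<longleftrightarrow>
     (\<forall>v\<in>verts (gr G). vmap f (cvert (sp_chains F1) v) = cvert (sp_chains F2) v) \<and>
     (\<forall>e\<in>arcs (gr G).
        List.map_filter (dart_image f) (cchain (sp_chains F1) e) = cchain (sp_chains F2) e)"

definition stable_pair_mor :: "('v, 'e) wgraph \<Rightarrow> ('v, 'e) stable_pair \<Rightarrow> ('v, 'e) stable_pair \<Rightarrow>
    (nat, nat, nat, nat) gmap set" where
  "stable_pair_mor G F1 F2 = {f.
     (\<exists>K. chain_contraction (sp_graph F1) (sp_graph F2) K f) \<and> over_base G F1 F2 f \<and>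
     push_div (vmap f) (sp_div F1) = sp_div F2}"

definition stable_pair_cat ::
  "('v, 'e) wgraph \<Rightarrow> nat \<Rightarrow> (('v, 'e) stable_pair, (nat, nat, nat, nat) gmap) cat" where
  "stable_pair_cat G d = \<lparr>Ob = stable_pairs G d, Hom = stable_pair_mor G,
     Id = (\<lambda>F. gmap_id (gr (sp_graph F))),
     Comp = (\<lambda>F1 F2 F3 g f. gmap_comp (gr (sp_graph F1)) g f)\<rparr>"


section \<open>The functor\<close>

text \<open>\<open>\<Delta>(G', D) = \<Prod>\<^sub>e \<Delta>(n\<^sub>e, |e|)\<close>: the coordinates of the factor of \<open>e\<close> are the edges of the chain
  over \<open>e\<close>. Their number is \<open>n\<^sub>e + 1\<close>, as the following lemma shows.\<close>

definition sigma_ob ::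
  "('v, 'e) pre_digraph \<Rightarrow> ('e \<Rightarrow> real) \<Rightarrow> ('v, 'e) stable_pair \<Rightarrow> nat pdata" where
  "sigma_ob G len F = (\<lambda>e. (fst ` set (cchain (sp_chains F) e), len e)) ` arcs G"

definition exceptional_over ::
  "('w, 'f) wgraph \<Rightarrow> ('v, 'e) wgraph \<Rightarrow> ('w, 'f, 'v, 'e) chains \<Rightarrow> 'e \<Rightarrow> 'w set" where
  "exceptional_over H G K e = {w \<in> exceptional H G K. \<exists>i. inner_vertex_at H G K w (e, i)}"

lemma card_chain_edges:
  assumes K: "chain_system H G K" and e: "e \<in> arcs (gr G)"
  shows "card (fst ` set (cchain K e)) = card (exceptional_over H G K e) + 1"
proof -
  let ?c = "cchain K e"
  have ch: "is_chain (gr H) (cvert K (tail (gr G) e)) ?c (cvert K (head (gr G) e))"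
    using K e by (simp add: chain_system_def)
  then have ne: "?c \<noteq> []" and sub: "fst ` set ?c \<subseteq> arcs (gr H)"
    by (auto simp: is_chain_def)
  have "inj_on (\<lambda>i. fst (?c ! i)) {..<length ?c}"
  proof (rule inj_onI)
    fix i j assume ij: "i \<in> {..<length ?c}" "j \<in> {..<length ?c}" "fst (?c ! i) = fst (?c ! j)"
    then have "fst (?c ! i) \<in> arcs (gr H)" using sub by (auto simp: image_subset_iff)
    then have "\<exists>!p. fst p \<in> arcs (gr G) \<and> snd p < length (cchain K (fst p)) \<and>
        fst (cchain K (fst p) ! snd p) = fst (?c ! i)"
      using K by (simp add: chain_system_def)
    then obtain q where q: "\<And>p. fst p \<in> arcs (gr G) \<Longrightarrow> snd p < length (cchain K (fst p)) \<Longrightarrow>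
        fst (cchain K (fst p) ! snd p) = fst (?c ! i) \<Longrightarrow> p = q"
      by auto
    have "(e, i) = (e, j)" using q[of "(e, i)"] q[of "(e, j)"] e ij by simp
    then show "i = j" by simp
  qed
  moreover have "fst ` set ?c = (\<lambda>i. fst (?c ! i)) ` {..<length ?c}"
    by (force simp: in_set_conv_nth)
  ultimately have 1: "card (fst ` set ?c) = length ?c"
    by (simp add: card_image)
  let ?t = "\<lambda>i. dart_target (gr H) (?c ! i)"
  have exc: "w \<in> exceptional H G K" if "inner_vertex_at H G K w p" for w p
  proof -
    have "\<forall>w p. inner_vertex_at H G K w p \<longrightarrow> w \<in> exceptional H G K"
      using K by (simp add: chain_system_def)
    then show ?thesis using that by blast
  qed
  have uni: "p = q" if "inner_vertex_at H G K w p" "inner_vertex_at H G K w q" for w p q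
  proof -
    have "\<exists>!p. inner_vertex_at H G K w p"
      using K exc[OF that(1)] by (simp add: chain_system_def)
    then show ?thesis using that by (elim ex1E) metis
  qed
  have eq: "exceptional_over H G K e = ?t ` {..<length ?c - 1}"
  proof -
    have "inner_vertex_at H G K w (e, i) \<longleftrightarrow> i < length ?c - 1 \<and> ?t i = w" for w i
      using e by (auto simp: inner_vertex_at_def)
    then have "exceptional_over H G K e =
        {w. w \<in> exceptional H G K \<and> (\<exists>i<length ?c - 1. ?t i = w)}"
      unfolding exceptional_over_def by simp
    also have "\<dots> = {w. \<exists>i<length ?c - 1. ?t i = w}"
      using exc[of _ "(e, _)"] e by (auto simp: inner_vertex_at_def)
    also have "\<dots> = ?t ` {..<length ?c - 1}" by auto
    finally show ?thesis .
  qed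
  have "inj_on ?t {..<length ?c - 1}"
  proof (rule inj_onI)
    fix i j assume "i \<in> {..<length ?c - 1}" "j \<in> {..<length ?c - 1}" "?t i = ?t j"
    then have "inner_vertex_at H G K (?t i) (e, i)" "inner_vertex_at H G K (?t i) (e, j)"
      using e by (auto simp: inner_vertex_at_def)
    then show "i = j" using uni by blast
  qed
  then have "card (exceptional_over H G K e) = length ?c - 1"
    by (simp add: eq card_image)
  with 1 ne show ?thesis by (cases ?c) auto
qed

text \<open>A morphism \<open>F\<^sub>2 \<rightarrow> F\<^sub>1\<close> of the opposite category is a contraction \<open>f : G\<^sub>1' \<rightarrow> G\<^sub>2'\<close>. It induces
  the inclusion of \<open>\<Delta>(G\<^sub>2', D\<^sub>2)\<close> as the face of \<open>\<Delta>(G\<^sub>1', D\<^sub>1)\<close> on which the coordinates of the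
  contracted edges vanish.\<close>

definition sigma_mor :: "('v, 'e) pre_digraph \<Rightarrow> ('e \<Rightarrow> real) \<Rightarrow>
    ('v, 'e) stable_pair \<Rightarrow> ('v, 'e) stable_pair \<Rightarrow> (nat, nat, nat, nat) gmap \<Rightarrow> nat pmor" where
  "sigma_mor G len F2 F1 f =
    (\<lambda>x\<in>polysimplex (sigma_ob G len F2). \<lambda>a.
       if a \<in> arcs (gr (sp_graph F1)) \<and> \<not> contracted f a then x (edge_image f a) else 0,
     \<lambda>M\<in>mon (sigma_ob G len F1). image_mset (edge_image f) (filter_mset (\<lambda>a. \<not> contracted f a) M))"

text \<open>The position in the realization of \<open>(G, len)\<close> of a vertex of \<open>G'\<close>, when \<open>G'\<close> has the edge
  lengths \<open>x\<close>: an inner vertex of the chain over \<open>e\<close> lies on \<open>e\<close> at a distance from the tail which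
  is the total length of the preceding edges of the chain.\<close>

definition vertex_point ::
  "('v, 'e) wgraph \<Rightarrow> ('v, 'e) stable_pair \<Rightarrow> (nat \<Rightarrow> real) \<Rightarrow> nat \<Rightarrow> ('v, 'e) gpoint" where
  "vertex_point G F x w =
    (if w \<in> exceptional (sp_graph F) G (sp_chains F)
     then (let p = (THE p. inner_vertex_at (sp_graph F) G (sp_chains F) w p)
           in On (fst p) (\<Sum>j\<le>snd p. x (fst (cchain (sp_chains F) (fst p) ! j))))
     else At (inv_into (verts (gr G)) (cvert (sp_chains F)) w))"

definition point_divisor ::
  "('v, 'e) wgraph \<Rightarrow> ('v, 'e) stable_pair \<Rightarrow> (nat \<Rightarrow> real) \<Rightarrow> (('v, 'e) gpoint \<Rightarrow>\<^sub>0 int)" where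
  "point_divisor G F x = push_div (vertex_point G F x) (sp_div F)"

end

theory Submission
  imports Defs
begin

text \<open>
  A subdivision of \<open>G\<close> by chains is described by the lengths \<open>n\<^sub>e\<close> of its chains, and a contraction between
  two subdivisions by weakly increasing functions \<open>{0..n\<^sub>e} \<rightarrow> {0..m\<^sub>e}\<close> with steps 0 and 1. Composition,
  faithfulness, the absence of automorphisms and the factorization axiom then reduce to statements about
  such functions. Face morphisms of polysimplices are likewise given by a set of surviving coordinates and
  an injective relabelling of it; every such choice of surviving edges is realized by a contraction.

  A point of \<open>\<Delta>(G', D)\<close> moves the inner vertices of the chains along the edges of \<open>G\<close>, and the image of \<open>D\<close>
  is a divisor on the curve that does not change under gluing. Every point is glued to one with positive
  coordinates. From there the subdivision, the lengths and \<open>D\<close> can be read off the divisor, because the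
  exceptional vertices are part of its support.
\<close>

section \<open>Coordinates on chain systems\<close>

text \<open>Three features of the definitions shape the work. A morphism of stable pairs must come
  with a system of chains over its target, of which the definition says only that it exists; it has
  to be built (\<open>collapse\<close>), with chains reversed where reference orientations disagree.
  The face axiom asks for an object whose image is literally the given \<open>P\<close>; so edge
  labels are prescribed when a stable pair is constructed, and the factors of \<open>P\<close> have
  to be recovered from an isomorphism that speaks only of points and monoids. Finally,
  \<open>vertex_point\<close> places exceptional vertices at inner points of edges, which is right
  only for positive lengths; the divisor is therefore extended to the boundary by clamping
  (\<open>edge_pt\<close>) before gluing is considered. Stable pairs occur with all possible names
  of vertices and edges, so two interior points with the same divisor may belong to different
  objects; they are glued along an isomorphism rather than identified.\<close>

lemma bij_betw_ex1:
  assumes "bij_betw f A B" "b \<in> B"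
  shows "\<exists>!a. a \<in> A \<and> f a = b"
proof -
  obtain a where a: "a \<in> A" "f a = b"
    using assms by (auto simp: bij_betw_def)
  then show ?thesis
    using assms(1) by (intro ex1I[of _ a]) (auto simp: bij_betw_def dest: inj_onD)
qed

abbreviation (input) vertices :: "('v, 'e) wgraph \<Rightarrow> 'v set" where
  "vertices G \<equiv> verts (gr G)"

abbreviation (input) edges :: "('v, 'e) wgraph \<Rightarrow> 'e set" where
  "edges G \<equiv> arcs (gr G)"

abbreviation (input) clen :: "('w, 'f, 'v, 'e) chains \<Rightarrow> 'e \<Rightarrow> nat" where
  "clen K e \<equiv> length (cchain K e)"

text \<open>Vertices of \<open>H\<close> are encoded by positions: \<open>Inl v\<close> stands for the vertex over \<open>v\<close>, and \<open>Inr (e, i)\<close> with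
  \<open>0 < i < clen K e\<close> for the vertex after the first \<open>i\<close> edges of the chain over \<open>e\<close>. Slots \<open>(e, i)\<close> with
  \<open>i < clen K e\<close> encode the edges.\<close>

definition chain_pos :: "('v, 'e) wgraph \<Rightarrow> ('w, 'f, 'v, 'e) chains \<Rightarrow> 'e \<Rightarrow> nat \<Rightarrow> 'v + 'e \<times> nat" where
  "chain_pos G K e i = (if i = 0 then Inl (tail (gr G) e)
     else if i < clen K e then Inr (e, i) else Inl (head (gr G) e))"

definition positions :: "('v, 'e) wgraph \<Rightarrow> ('w, 'f, 'v, 'e) chains \<Rightarrow> ('v + 'e \<times> nat) set" where
  "positions G K = Inl ` vertices G \<union>
     Inr ` {(e, i). e \<in> edges G \<and> 0 < i \<and> i < clen K e}"

text \<open>The vertex after \<open>i\<close> edges is the end of dart number \<open>i - 1\<close>.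
  The case \<open>i = 0\<close> does not arise in \<open>positions\<close>, where the start of a
  chain is coded by \<open>Inl\<close>.\<close>

definition pos_vertex :: "('w, 'f) wgraph \<Rightarrow> ('w, 'f, 'v, 'e) chains \<Rightarrow> 'v + 'e \<times> nat \<Rightarrow> 'w" where
  "pos_vertex H K p = (case p of Inl v \<Rightarrow> cvert K v
     | Inr (e, i) \<Rightarrow> dart_target (gr H) (cchain K e ! (i - 1)))"

definition slots :: "('v, 'e) wgraph \<Rightarrow> ('w, 'f, 'v, 'e) chains \<Rightarrow> ('e \<times> nat) set" where
  "slots G K = (SIGMA e:edges G. {..<clen K e})"

definition slot_arc :: "('w, 'f, 'v, 'e) chains \<Rightarrow> 'e \<times> nat \<Rightarrow> 'f" where
  "slot_arc K s = fst (cchain K (fst s) ! snd s)"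

lemma Inl_positions_iff [simp]: "Inl v \<in> positions G K \<longleftrightarrow> v \<in> vertices G"
  by (auto simp: positions_def)

lemma Inr_positions_iff [simp]:
  "Inr (e, i) \<in> positions G K \<longleftrightarrow> e \<in> edges G \<and> 0 < i \<and> i < clen K e"
  by (auto simp: positions_def)

lemma mem_slots: "s \<in> slots G K \<longleftrightarrow> fst s \<in> edges G \<and> snd s < length (cchain K (fst s))"
  by (cases s) (simp add: slots_def)

lemma slots_iff [simp]: "(e, i) \<in> slots G K \<longleftrightarrow> e \<in> edges G \<and> i < clen K e"
  by (auto simp: slots_def)

lemma slot_arc_pair [simp]: "slot_arc K (e, i) = fst (cchain K e ! i)"
  by (simp add: slot_arc_def)

lemma pos_vertex_Inl [simp]: "pos_vertex H K (Inl v) = cvert K v"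
  by (simp add: pos_vertex_def)

lemma pos_vertex_Inr: "pos_vertex H K (Inr (e, i)) = dart_target (gr H) (cchain K e ! (i - 1))"
  by (simp add: pos_vertex_def)

lemma chain_pos_0 [simp]: "chain_pos G K e 0 = Inl (tail (gr G) e)"
  by (simp add: chain_pos_def)

lemma chain_pos_inner [simp]: "0 < i \<Longrightarrow> i < clen K e \<Longrightarrow> chain_pos G K e i = Inr (e, i)"
  by (simp add: chain_pos_def)

lemma chain_pos_last [simp]:
  "cchain K e \<noteq> [] \<Longrightarrow> chain_pos G K e (clen K e) = Inl (head (gr G) e)"
  by (simp add: chain_pos_def)

lemma chain_pos_in_positions:
  assumes "wf_digraph (gr G)" "e \<in> edges G"
  shows "chain_pos G K e i \<in> positions G K"
  using assms by (auto simp: chain_pos_def wf_digraph_def)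

lemma finite_positions: "fin_digraph (gr G) \<Longrightarrow> finite (positions G K)"
proof -
  assume "fin_digraph (gr G)"
  then interpret fin_digraph "gr G" .
  have "positions G K \<subseteq> Inl ` vertices G \<union> Inr ` (SIGMA e:edges G. {..<clen K e})"
    by (auto simp: positions_def)
  moreover have "finite \<dots>" by auto
  ultimately show ?thesis by (rule finite_subset)
qed

text \<open>The shift by one reconciles two conventions: \<open>inner_vertex_at\<close> records the
  dart that ends at the vertex, a position counts the darts before the vertex.\<close>

lemma inner_vertex_at_iff:
  "inner_vertex_at H G K w (e, i) \<longleftrightarrow> Inr (e, Suc i) \<in> positions G K \<and> pos_vertex H K (Inr (e, Suc i)) = w"
  by (auto simp: inner_vertex_at_def pos_vertex_def)

locale chained =
  fixes H :: "('w, 'f) wgraph" and G :: "('v, 'e) wgraph" and K :: "('w, 'f, 'v, 'e) chains"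
  assumes wf_base: "wf_digraph (gr G)" and wf_total: "wf_digraph (gr H)"
    and chains: "chain_system H G K"
begin

lemma chain_nonempty: "e \<in> edges G \<Longrightarrow> cchain K e \<noteq> []"
  using chains by (auto simp: chain_system_def is_chain_def)

lemma slot_arc_in_arcs: "e \<in> edges G \<Longrightarrow> i < clen K e \<Longrightarrow> fst (cchain K e ! i) \<in> edges H"
  using chains by (auto simp: chain_system_def is_chain_def image_subset_iff)

lemma bij_slots: "bij_betw (slot_arc K) (slots G K) (edges H)"
proof -
  have ex1: "\<exists>!p. p \<in> slots G K \<and> slot_arc K p = a" if "a \<in> edges H" for a
    using chains that by (auto simp: chain_system_def mem_slots slot_arc_def)
  have "slot_arc K ` slots G K \<subseteq> edges H"
    using slot_arc_in_arcs by auto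
  with ex1 show ?thesis
    unfolding bij_betw_def inj_on_def by (safe; (blast | (metis image_eqI)))
qed

lemma dart_source_slot:
  assumes "e \<in> edges G" "i < clen K e"
  shows "dart_source (gr H) (cchain K e ! i) = pos_vertex H K (chain_pos G K e i)"
proof (cases i)
  case 0
  then show ?thesis using chains assms chain_nonempty[OF assms(1)]
    by (auto simp: chain_system_def is_chain_def hd_conv_nth)
next
  case (Suc j)
  have "successively (\<lambda>x y. dart_target (gr H) x = dart_source (gr H) y) (cchain K e)"
    using chains assms(1) by (auto simp: chain_system_def is_chain_def)
  then have "dart_target (gr H) (cchain K e ! j) = dart_source (gr H) (cchain K e ! Suc j)"
    using assms(2) Suc by (auto simp: successively_conv_nth)
  then show ?thesis using assms Suc by (simp add: pos_vertex_Inr)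
qed

lemma dart_target_slot:
  assumes "e \<in> edges G" "i < clen K e"
  shows "dart_target (gr H) (cchain K e ! i) = pos_vertex H K (chain_pos G K e (Suc i))"
proof (cases "Suc i < clen K e")
  case True
  then show ?thesis by (simp add: pos_vertex_Inr)
next
  case False
  then have "Suc i = clen K e" using assms by auto
  then have "cchain K e ! i = last (cchain K e)"
    using chain_nonempty[OF assms(1)] by (simp add: last_conv_nth flip: \<open>Suc i = _\<close>)
  then show ?thesis using chains assms \<open>Suc i = clen K e\<close>
    by (auto simp: chain_system_def is_chain_def)
qed

lemma exceptional_eq: "exceptional H G K = pos_vertex H K ` {p \<in> positions G K. \<not> isl p}"
proof -
  have "w \<in> exceptional H G K \<longleftrightarrow> (\<exists>e i. inner_vertex_at H G K w (e, i))" for w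
  proof -
    have "\<forall>w p. inner_vertex_at H G K w p \<longrightarrow> w \<in> exceptional H G K"
      "\<forall>w\<in>exceptional H G K. \<exists>!p. inner_vertex_at H G K w p"
      using chains by (simp_all add: chain_system_def)
    then show ?thesis by (metis surj_pair)
  qed
  moreover have "(\<exists>e i. inner_vertex_at H G K w (e, i)) \<longleftrightarrow> w \<in> pos_vertex H K ` {p \<in> positions G K. \<not> isl p}" for w
  proof
    assume "\<exists>e i. inner_vertex_at H G K w (e, i)"
    then show "w \<in> pos_vertex H K ` {p \<in> positions G K. \<not> isl p}"
      unfolding inner_vertex_at_iff by (metis (mono_tags, lifting) image_eqI isl_def mem_Collect_eq Inl_Inr_False)
  next
    assume "w \<in> pos_vertex H K ` {p \<in> positions G K. \<not> isl p}"
    then obtain e i where "Inr (e, i) \<in> positions G K" "w = pos_vertex H K (Inr (e, i))"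
      by (auto simp: positions_def)
    then have "inner_vertex_at H G K w (e, i - 1)"
      by (auto simp: inner_vertex_at_iff)
    then show "\<exists>e i. inner_vertex_at H G K w (e, i)" by blast
  qed
  ultimately show ?thesis by blast
qed

text \<open>Base vertices are told apart by injectivity of \<open>cvert\<close>, inner ones by the
  uniqueness of \<open>inner_vertex_at\<close>; the two kinds never meet because inner vertices are
  exceptional.\<close>

lemma bij_positions: "bij_betw (pos_vertex H K) (positions G K) (vertices H)"
proof -
  have exc: "pos_vertex H K (Inr p) \<in> exceptional H G K" if "Inr p \<in> positions G K" for p
    using that unfolding exceptional_eq by auto
  have uni: "p = q" if pq: "Inr p \<in> positions G K" "Inr q \<in> positions G K"
    "pos_vertex H K (Inr p) = pos_vertex H K (Inr q)" for p q
  proof -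
    obtain e i f j where p: "p = (e, Suc i)" and q: "q = (f, Suc j)"
      using pq(1,2) by (metis Inr_positions_iff gr0_conv_Suc surj_pair)
    have "\<exists>!r. inner_vertex_at H G K (pos_vertex H K (Inr p)) r"
      using exc[OF pq(1)] chains by (simp add: chain_system_def)
    moreover have "inner_vertex_at H G K (pos_vertex H K (Inr p)) (e, i)"
      "inner_vertex_at H G K (pos_vertex H K (Inr p)) (f, j)"
      using pq by (auto simp: inner_vertex_at_iff p q)
    ultimately show ?thesis using p q by (metis prod.inject)
  qed
  have injv: "inj_on (cvert K) (vertices G)" and sub: "cvert K ` vertices G \<subseteq> vertices H"
    using chains by (auto simp: chain_system_def)
  show ?thesis unfolding bij_betw_def
  proof
    show "inj_on (pos_vertex H K) (positions G K)"
    proof (rule inj_onI)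
      fix p q assume pq: "p \<in> positions G K" "q \<in> positions G K" "pos_vertex H K p = pos_vertex H K q"
      have no: "cvert K v \<noteq> pos_vertex H K (Inr r)" if "v \<in> vertices G" "Inr r \<in> positions G K" for v r
        using exc[OF that(2)] that(1) unfolding exceptional_def by (metis DiffD2 imageI)
      show "p = q"
      proof (cases p; cases q)
        fix u v assume "p = Inl u" "q = Inl v"
        then show "p = q" using pq injv by (auto dest: inj_onD)
      next
        fix u r assume "p = Inl u" "q = Inr r"
        then show "p = q" using pq no[of u r] by simp
      next
        fix u r assume "p = Inr r" "q = Inl u"
        then show "p = q" using pq no[of u r] by simp
      next
        fix r s assume "p = Inr r" "q = Inr s"
        then show "p = q" using pq uni[of r s] by simp
      qed
    qed
    have "pos_vertex H K p \<in> vertices H" if "p \<in> positions G K" for p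
      using that exc[of "projr p"] sub by (cases p) (auto simp: exceptional_def)
    moreover have "w \<in> pos_vertex H K ` positions G K" if w: "w \<in> vertices H" for w
    proof (cases "w \<in> exceptional H G K")
      case True
      then show ?thesis by (auto simp: exceptional_eq)
    next
      case False
      then obtain v where "v \<in> vertices G" "w = cvert K v"
        using w by (auto simp: exceptional_def)
      then show ?thesis by (intro image_eqI[of _ _ "Inl v"]) auto
    qed
    ultimately show "pos_vertex H K ` positions G K = vertices H" by blast
  qed
qed

lemma wt_inner: "Inr p \<in> positions G K \<Longrightarrow> wt H (pos_vertex H K (Inr p)) = 0"
  using chains exceptional_eq by (force simp: chain_system_def)

lemma pos_vertex_inj:
  "p \<in> positions G K \<Longrightarrow> q \<in> positions G K \<Longrightarrow> pos_vertex H K p = pos_vertex H K q \<longleftrightarrow> p = q"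
  using bij_positions by (meson bij_betw_imp_inj_on inj_on_eq_iff)

lemma pos_vertex_in_verts: "p \<in> positions G K \<Longrightarrow> pos_vertex H K p \<in> vertices H"
  using bij_positions by (auto dest: bij_betwE)

lemma obtain_position:
  assumes "w \<in> vertices H"
  obtains p where "p \<in> positions G K" "w = pos_vertex H K p"
  using bij_positions assms by (metis bij_betw_imp_surj_on imageE)

lemma obtain_slot:
  assumes "a \<in> edges H"
  obtains e i where "e \<in> edges G" "i < clen K e" "a = fst (cchain K e ! i)"
proof -
  obtain s where "s \<in> slots G K" "slot_arc K s = a"
    using bij_slots assms by (metis bij_betw_imp_surj_on imageE)
  then show thesis using that by (cases s) auto
qed

lemma slot_unique:
  assumes "e \<in> edges G" "i < clen K e" "e' \<in> edges G" "i' < clen K e'"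
    and "fst (cchain K e ! i) = fst (cchain K e' ! i')"
  shows "e = e' \<and> i = i'"
  using bij_slots assms inj_onD[of "slot_arc K" "slots G K" "(e, i)" "(e', i')"]
  by (auto simp: bij_betw_def)

lemma chain_pos_in: "e \<in> edges G \<Longrightarrow> chain_pos G K e i \<in> positions G K"
  using chain_pos_in_positions[OF wf_base] .

end

text \<open>Converse to the facts derived in \<open>chained\<close>: two bijections of codes, the
  incidences, and zero weight of inner vertices are the whole content of
  \<open>chain_system\<close>. All chain systems constructed below are verified by this
  rule.\<close>

lemma chain_systemI:
  assumes ne: "\<And>e. e \<in> edges G \<Longrightarrow> cchain K e \<noteq> []"
    and pos: "bij_betw (pos_vertex H K) (positions G K) (vertices H)"
    and slot: "bij_betw (slot_arc K) (slots G K) (edges H)"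
    and src: "\<And>e i. e \<in> edges G \<Longrightarrow> i < clen K e \<Longrightarrow>
      dart_source (gr H) (cchain K e ! i) = pos_vertex H K (chain_pos G K e i)"
    and tgt: "\<And>e i. e \<in> edges G \<Longrightarrow> i < clen K e \<Longrightarrow>
      dart_target (gr H) (cchain K e ! i) = pos_vertex H K (chain_pos G K e (Suc i))"
    and wt0: "\<And>e i. Inr (e, i) \<in> positions G K \<Longrightarrow> wt H (pos_vertex H K (Inr (e, i))) = 0"
  shows "chain_system H G K"
proof -
  have inj: "inj_on (pos_vertex H K) (positions G K)"
    and im: "pos_vertex H K ` positions G K = vertices H"
    using pos by (auto simp: bij_betw_def)
  have exc: "w \<in> exceptional H G K \<longleftrightarrow> (\<exists>e i. Inr (e, i) \<in> positions G K \<and> w = pos_vertex H K (Inr (e, i)))" for w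
  proof -
    have "w \<in> exceptional H G K \<longleftrightarrow> (\<exists>p\<in>positions G K. w = pos_vertex H K p) \<and>
        \<not> (\<exists>v. Inl v \<in> positions G K \<and> w = pos_vertex H K (Inl v))"
      unfolding exceptional_def im[symmetric] by auto
    also have "\<dots> \<longleftrightarrow> (\<exists>e i. Inr (e, i) \<in> positions G K \<and> w = pos_vertex H K (Inr (e, i)))"
      using inj by (metis Inl_Inr_False inj_onD obj_sumE surj_pair)
    finally show ?thesis .
  qed
  have iv: "inner_vertex_at H G K w p \<longleftrightarrow> Inr (fst p, Suc (snd p)) \<in> positions G K \<and>
      w = pos_vertex H K (Inr (fst p, Suc (snd p)))" for w p
    using inner_vertex_at_iff[of H G K w "fst p" "snd p"] by auto
  have slots: "fst (cchain K e ! i) \<in> edges H" if "e \<in> edges G" "i < clen K e" for e i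
    using slot that by (metis bij_betwE slot_arc_pair slots_iff)
  have "is_chain (gr H) (cvert K (tail (gr G) e)) (cchain K e) (cvert K (head (gr G) e))"
    if e: "e \<in> edges G" for e
  proof -
    let ?n = "clen K e"
    have n: "0 < ?n" using ne[OF e] by simp
    have "dart_source (gr H) (hd (cchain K e)) = cvert K (tail (gr G) e)"
      using src[OF e n] ne[OF e] by (simp add: hd_conv_nth)
    moreover have "dart_target (gr H) (last (cchain K e)) = cvert K (head (gr G) e)"
      using tgt[OF e, of "?n - 1"] n ne[OF e] by (simp add: last_conv_nth)
    moreover have "successively (\<lambda>x y. dart_target (gr H) x = dart_source (gr H) y) (cchain K e)"
      using src[OF e] tgt[OF e] by (auto simp: successively_conv_nth)
    ultimately show ?thesis
      using ne[OF e] slots[OF e] by (fastforce simp: is_chain_def in_set_conv_nth)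
  qed
  moreover have "\<exists>!p. fst p \<in> edges G \<and> snd p < length (cchain K (fst p)) \<and>
        fst (cchain K (fst p) ! snd p) = a" if a: "a \<in> edges H" for a
  proof -
    have "\<exists>!p. p \<in> slots G K \<and> slot_arc K p = a"
      using bij_betw_ex1[OF slot a] .
    then show ?thesis by (simp add: mem_slots slot_arc_def conj_assoc)
  qed
  moreover have "\<exists>!p. inner_vertex_at H G K w p" if "w \<in> exceptional H G K" for w
  proof -
    obtain e i where ei: "Inr (e, i) \<in> positions G K" "w = pos_vertex H K (Inr (e, i))"
      using \<open>w \<in> _\<close> unfolding exc by auto
    show ?thesis
    proof (rule ex1I[of _ "(e, i - 1)"])
      show "inner_vertex_at H G K w (e, i - 1)" using ei by (auto simp: iv)
      fix p assume "inner_vertex_at H G K w p"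
      then have p: "Inr (fst p, Suc (snd p)) \<in> positions G K"
        "pos_vertex H K (Inr (fst p, Suc (snd p))) = pos_vertex H K (Inr (e, i))"
        using ei(2) by (simp_all add: iv)
      from inj_onD[OF inj p(2,1) ei(1)] show "p = (e, i - 1)" by (cases p) auto
    qed
  qed
  moreover have "cvert K ` vertices G \<subseteq> vertices H"
  proof
    fix w assume "w \<in> cvert K ` vertices G"
    then obtain v where "v \<in> vertices G" "w = pos_vertex H K (Inl v)" by auto
    then show "w \<in> vertices H" using im by (metis Inl_positions_iff image_eqI)
  qed
  moreover have "inj_on (cvert K) (vertices G)"
  proof (rule inj_onI)
    fix u v assume "u \<in> vertices G" "v \<in> vertices G" "cvert K u = cvert K v"
    then show "u = v" using inj_onD[OF inj, of "Inl u" "Inl v"] by auto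
  qed
  moreover have "inner_vertex_at H G K w p \<Longrightarrow> w \<in> exceptional H G K" for w p
    unfolding exc iv by blast
  moreover have "wt H w = 0" if "w \<in> exceptional H G K" for w
    using that wt0 unfolding exc by (elim exE conjE) (simp only:)
  ultimately show ?thesis unfolding chain_system_def by simp
qed

section \<open>Contractions as step functions\<close>

lemma map_filter_append: "List.map_filter g (xs @ ys) = List.map_filter g xs @ List.map_filter g ys"
  by (simp add: List.map_filter_def)

text \<open>For a contraction, \<open>r e i\<close> will be the number of uncontracted edges among the first \<open>i\<close> edges of the
  chain over \<open>e\<close>; this family of functions determines the contraction.\<close>

definition steps :: "(nat \<Rightarrow> nat) \<Rightarrow> nat \<Rightarrow> nat \<Rightarrow> bool" where
  "steps r n m \<longleftrightarrow> r 0 = 0 \<and> r n = m \<and> (\<forall>i<n. r (Suc i) = r i \<or> r (Suc i) = Suc (r i))"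

lemma steps_mono:
  assumes "steps r n m" "i \<le> j" "j \<le> n"
  shows "r i \<le> r j"
  using assms(2,3)
proof (induction j rule: dec_induct)
  case (step j)
  then have "r (Suc j) = r j \<or> r (Suc j) = Suc (r j)" using assms(1) by (auto simp: steps_def)
  with step show ?case by auto
qed simp

lemma steps_le: "steps r n m \<Longrightarrow> i \<le> n \<Longrightarrow> r i \<le> m"
  using steps_mono[of r n m i n] by (auto simp: steps_def)

lemma steps_less:
  assumes "steps r n m" "i < n" "r (Suc i) \<noteq> r i"
  shows "r (Suc i) = Suc (r i)" "r i < m"
proof -
  show *: "r (Suc i) = Suc (r i)" using assms by (auto simp: steps_def)
  show "r i < m" using steps_le[OF assms(1), of "Suc i"] assms(2) * by simp
qed

lemma steps_id: "steps (\<lambda>i. i) n n"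
  by (simp add: steps_def)

lemma steps_comp:
  assumes "steps r n m" "steps q m l"
  shows "steps (\<lambda>i. q (r i)) n l"
  unfolding steps_def
proof (intro conjI allI impI)
  fix i assume i: "i < n"
  show "q (r (Suc i)) = q (r i) \<or> q (r (Suc i)) = Suc (q (r i))"
  proof (cases "r (Suc i) = r i")
    case False
    from steps_less[OF assms(1) i this] assms(2) show ?thesis by (simp add: steps_def)
  qed simp
qed (use assms in \<open>auto simp: steps_def\<close>)

definition first :: "(nat \<Rightarrow> nat) \<Rightarrow> nat \<Rightarrow> nat" where
  "first r k = (LEAST i. r i = k)"

lemma steps_surj:
  assumes "steps r n m" "k \<le> m"
  shows "\<exists>i\<le>n. r i = k"
proof -
  have "k \<le> r j \<Longrightarrow> j \<le> n \<Longrightarrow> \<exists>i\<le>j. r i = k" for j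
  proof (induction j)
    case 0
    then show ?case using assms by (auto simp: steps_def)
  next
    case (Suc j)
    then have "r (Suc j) = r j \<or> r (Suc j) = Suc (r j)" using assms(1) by (auto simp: steps_def)
    with Suc show ?case by (cases "k \<le> r j") (auto simp: le_Suc_eq)
  qed
  from this[of n] assms show ?thesis by (auto simp: steps_def)
qed

text \<open>The third claim is a Galois connection: \<open>first r k\<close> is the left end of the
  fibre of \<open>r\<close> over \<open>k\<close>, and \<open>r\<close> is monotone.\<close>

lemma first:
  assumes "steps r n m" "k \<le> m"
  shows "r (first r k) = k" "first r k \<le> n" "\<And>i. i \<le> n \<Longrightarrow> first r k \<le> i \<longleftrightarrow> k \<le> r i"
proof -
  obtain i where i: "i \<le> n" "r i = k" using steps_surj[OF assms] by auto
  show 1: "r (first r k) = k" unfolding first_def using i by (rule_tac LeastI)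
  show 2: "first r k \<le> n" unfolding first_def
    using i Least_le[of "\<lambda>i. r i = k" i] by simp
  show "first r k \<le> i \<longleftrightarrow> k \<le> r i" if "i \<le> n" for i
  proof
    assume "first r k \<le> i"
    then show "k \<le> r i" using steps_mono[OF assms(1) _ that] 1 by metis
  next
    assume k: "k \<le> r i"
    show "first r k \<le> i"
    proof (rule ccontr)
      assume "\<not> first r k \<le> i"
      then have "r i \<le> k" using steps_mono[OF assms(1), of i "first r k"] 1 2 by auto
      then have "r i = k" using k by simp
      then have "first r k \<le> i" unfolding first_def by (rule Least_le)
      then show False using \<open>\<not> first r k \<le> i\<close> by simp
    qed
  qed
qed

text \<open>An inner vertex may be pushed to an end of the coarser chain; \<open>chain_pos\<close>
  then replaces its code by that of the base vertex.\<close>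

definition pos_step :: "('v, 'e) wgraph \<Rightarrow> ('w, 'f, 'v, 'e) chains \<Rightarrow> ('e \<Rightarrow> nat \<Rightarrow> nat) \<Rightarrow>
    'v + 'e \<times> nat \<Rightarrow> 'v + 'e \<times> nat" where
  "pos_step G K r p = (case p of Inl v \<Rightarrow> Inl v | Inr (e, i) \<Rightarrow> chain_pos G K e (r e i))"

lemma pos_step_Inl [simp]: "pos_step G K r (Inl v) = Inl v"
  by (simp add: pos_step_def)

lemma pos_step_Inr [simp]: "pos_step G K r (Inr (e, i)) = chain_pos G K e (r e i)"
  by (simp add: pos_step_def)

text \<open>\<open>emap\<close> describes the image of an edge in its reference orientation. Since
  both chains run from the tail to the head of \<open>e\<close>, the orientation is kept exactly if
  both chains run through their edges in the same sense, whence the comparison of the two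
  bits.\<close>

definition slot_image :: "('v, 'e) wgraph \<Rightarrow> ('w, 'f, 'v, 'e) chains \<Rightarrow> ('x, 'g) wgraph \<Rightarrow>
    ('x, 'g, 'v, 'e) chains \<Rightarrow> ('e \<Rightarrow> nat \<Rightarrow> nat) \<Rightarrow> 'e \<Rightarrow> nat \<Rightarrow> 'x + 'g dart" where
  "slot_image G K H' K' r e i =
     (if r e (Suc i) = r e i then Inl (pos_vertex H' K' (chain_pos G K' e (r e i)))
      else Inr (fst (cchain K' e ! r e i), snd (cchain K e ! i) = snd (cchain K' e ! r e i)))"

text \<open>Both components of \<open>f\<close> are extensional, so \<open>r\<close> on the chains
  determines \<open>f\<close> outright, and equality of contractions reduces to equality of step
  functions.\<close>

definition realizes :: "('v, 'e) wgraph \<Rightarrow> ('w, 'f) wgraph \<Rightarrow> ('w, 'f, 'v, 'e) chains \<Rightarrow>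
    ('x, 'g) wgraph \<Rightarrow> ('x, 'g, 'v, 'e) chains \<Rightarrow> ('e \<Rightarrow> nat \<Rightarrow> nat) \<Rightarrow> ('w, 'f, 'x, 'g) gmap \<Rightarrow> bool" where
  "realizes G H K H' K' r f \<longleftrightarrow>
     vmap f \<in> extensional (vertices H) \<and> emap f \<in> extensional (edges H) \<and>
     (\<forall>p\<in>positions G K. vmap f (pos_vertex H K p) = pos_vertex H' K' (pos_step G K' r p)) \<and>
     (\<forall>e\<in>edges G. \<forall>i<clen K e. emap f (fst (cchain K e ! i)) = slot_image G K H' K' r e i)"

locale chained_pair = src: chained H G K + dst: chained H' G K'
  for H :: "('w, 'f) wgraph" and H' :: "('x, 'g) wgraph" and G :: "('v, 'e) wgraph" and K K'

text \<open>The orientation bits of \<open>slot_image\<close> cancel: a surviving dart of the fine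
  chain goes to the dart of the coarse chain itself, not merely to its edge.\<close>

lemma dart_image_slot:
  assumes "realizes G H K H' K' r f" "e \<in> edges G" "i < clen K e"
  shows "dart_image f (cchain K e ! i) = (if r e (Suc i) = r e i then None else Some (cchain K' e ! r e i))"
proof -
  have "emap f (fst (cchain K e ! i)) = slot_image G K H' K' r e i"
    using assms unfolding realizes_def by blast
  then show ?thesis
    by (auto simp: dart_image_def slot_image_def prod_eq_iff)
qed

lemma contracted_slot:
  assumes "realizes G H K H' K' r f" "e \<in> edges G" "i < clen K e"
  shows "contracted f (fst (cchain K e ! i)) \<longleftrightarrow> r e (Suc i) = r e i"
    and "r e (Suc i) \<noteq> r e i \<Longrightarrow> edge_image f (fst (cchain K e ! i)) = fst (cchain K' e ! r e i)"
proof -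
  have "emap f (fst (cchain K e ! i)) = slot_image G K H' K' r e i"
    using assms unfolding realizes_def by blast
  then show "contracted f (fst (cchain K e ! i)) \<longleftrightarrow> r e (Suc i) = r e i"
    "r e (Suc i) \<noteq> r e i \<Longrightarrow> edge_image f (fst (cchain K e ! i)) = fst (cchain K' e ! r e i)"
    by (auto simp: contracted_def edge_image_def slot_image_def)
qed

context chained_pair
begin

definition step_family :: "('e \<Rightarrow> nat \<Rightarrow> nat) \<Rightarrow> bool" where
  "step_family r \<longleftrightarrow> (\<forall>e\<in>edges G. steps (r e) (clen K e) (clen K' e))"

lemma step_familyD: "step_family r \<Longrightarrow> e \<in> edges G \<Longrightarrow> steps (r e) (clen K e) (clen K' e)"
  by (simp add: step_family_def)

lemma pos_step_chain_pos:
  assumes "step_family r" "e \<in> edges G" "i \<le> clen K e"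
  shows "pos_step G K' r (chain_pos G K e i) = chain_pos G K' e (r e i)"
  using step_familyD[OF assms(1,2)] src.chain_nonempty[OF assms(2)] dst.chain_nonempty[OF assms(2)] assms(3)
  by (auto simp: chain_pos_def steps_def)

lemma pos_step_in:
  assumes "p \<in> positions G K"
  shows "pos_step G K' r p \<in> positions G K'"
proof (cases p)
  case (Inl v)
  then show ?thesis using assms by simp
next
  case (Inr s)
  then show ?thesis using assms dst.chain_pos_in by (cases s) simp
qed

text \<open>Positions and slots parametrize vertices and edges bijectively, so values may be
  prescribed on codes.\<close>

lemma realizes_exists: "\<exists>f. realizes G H K H' K' r f"
proof -
  define vm where "vm = (\<lambda>w\<in>vertices H.
    pos_vertex H' K' (pos_step G K' r (inv_into (positions G K) (pos_vertex H K) w)))"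
  define em where "em = (\<lambda>a\<in>edges H. case inv_into (slots G K) (slot_arc K) a of (e, i) \<Rightarrow>
      if r e (Suc i) = r e i then Inl (pos_vertex H' K' (chain_pos G K' e (r e i)))
      else Inr (fst (cchain K' e ! r e i), snd (cchain K e ! i) = snd (cchain K' e ! r e i)))"
  have "vm (pos_vertex H K p) = pos_vertex H' K' (pos_step G K' r p)" if "p \<in> positions G K" for p
    using that src.pos_vertex_in_verts[OF that] bij_betw_imp_inj_on[OF src.bij_positions]
    by (simp add: vm_def)
  moreover have "em (fst (cchain K e ! i)) = slot_image G K H' K' r e i"
    if "e \<in> edges G" "i < clen K e" for e i
  proof -
    have "inv_into (slots G K) (slot_arc K) (slot_arc K (e, i)) = (e, i)"
      using that bij_betw_imp_inj_on[OF src.bij_slots] by (intro inv_into_f_f) auto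
    then show ?thesis
      using src.slot_arc_in_arcs[OF that] by (simp add: em_def slot_image_def)
  qed
  ultimately have "realizes G H K H' K' r \<lparr>vmap = vm, emap = em\<rparr>"
    unfolding realizes_def by (simp add: vm_def em_def)
  then show ?thesis by blast
qed

lemma realizes_unique:
  assumes f: "realizes G H K H' K' r f" and g: "realizes G H K H' K' q g"
    and rq: "\<And>e i. e \<in> edges G \<Longrightarrow> i \<le> clen K e \<Longrightarrow> r e i = q e i"
  shows "f = g"
proof (rule gmap.equality)
  show "vmap f = vmap g"
  proof (rule extensionalityI[of _ "vertices H"])
    fix w assume "w \<in> vertices H"
    then obtain p where p: "p \<in> positions G K" "w = pos_vertex H K p"
      by (rule src.obtain_position)
    have "pos_step G K' r p = pos_step G K' q p"
      using p(1) rq by (auto simp: positions_def)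
    then show "vmap f w = vmap g w" using f g p by (simp add: realizes_def)
  qed (use f g in \<open>auto simp: realizes_def\<close>)
  show "emap f = emap g"
  proof (rule extensionalityI[of _ "edges H"])
    fix a assume "a \<in> edges H"
    then obtain e i where e: "e \<in> edges G" and i: "i < clen K e"
      and a: "a = fst (cchain K e ! i)" by (rule src.obtain_slot)
    show "emap f a = emap g a"
      using f g e i rq[OF e, of i] rq[OF e, of "Suc i"] by (simp add: realizes_def slot_image_def a)
  qed (use f g in \<open>auto simp: realizes_def\<close>)
qed simp

lemma vmap_chain_pos:
  assumes "realizes G H K H' K' r f" "step_family r" "e \<in> edges G" "i \<le> clen K e"
  shows "vmap f (pos_vertex H K (chain_pos G K e i)) = pos_vertex H' K' (chain_pos G K' e (r e i))"
proof -
  have "vmap f (pos_vertex H K (chain_pos G K e i)) = pos_vertex H' K' (pos_step G K' r (chain_pos G K e i))"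
    using assms(1) src.chain_pos_in[OF assms(3)] unfolding realizes_def by blast
  then show ?thesis using pos_step_chain_pos[OF assms(2-4)] by simp
qed

lemma vmap_cvert:
  assumes "realizes G H K H' K' r f" "v \<in> vertices G"
  shows "vmap f (cvert K v) = cvert K' v"
proof -
  have "vmap f (pos_vertex H K (Inl v)) = pos_vertex H' K' (pos_step G K' r (Inl v))"
    using assms unfolding realizes_def by (metis Inl_positions_iff)
  then show ?thesis by simp
qed

text \<open>Formulated for segments because the chains of \<open>collapse\<close> are pieces of
  chains; a whole chain is the case from 0 to \<open>clen K e\<close>.\<close>

lemma map_filter_segment:
  assumes f: "realizes G H K H' K' r f" and r: "step_family r" and e: "e \<in> edges G"
    and ij: "i \<le> j" "j \<le> clen K e"
  shows "List.map_filter (dart_image f) (map ((!) (cchain K e)) [i..<j]) = map ((!) (cchain K' e)) [r e i..<r e j]"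
  using ij
proof (induction j rule: dec_induct)
  case base
  then show ?case by (simp add: map_filter_simps)
next
  case (step j)
  have st: "steps (r e) (clen K e) (clen K' e)" using step_familyD[OF r e] .
  have j: "j < clen K e" using step by simp
  have le: "r e i \<le> r e j" using steps_mono[OF st step(1)] j by simp
  have "r e (Suc j) = r e j \<or> r e (Suc j) = Suc (r e j)" using st j by (auto simp: steps_def)
  then show ?case
    using step.IH step.prems step.hyps dart_image_slot[OF f e j] le
    by (auto simp: map_filter_append map_filter_simps)
qed

lemma map_filter_chain:
  assumes f: "realizes G H K H' K' r f" and r: "step_family r" and e: "e \<in> edges G"
  shows "List.map_filter (dart_image f) (cchain K e) = cchain K' e"
  using map_filter_segment[OF f r e, of 0 "clen K e"] step_familyD[OF r e]
  by (simp add: steps_def map_nth)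

text \<open>The jump from \<open>k\<close> to \<open>Suc k\<close> takes place just before
  \<open>first (r e) (Suc k)\<close>, and monotonicity forbids a second one.\<close>

lemma slot_preimage:
  assumes r: "step_family r" and e: "e \<in> edges G" and k: "k < clen K' e"
  obtains i where "i < clen K e" "r e i = k" "r e (Suc i) \<noteq> r e i"
    "\<forall>i'<clen K e. r e i' = k \<longrightarrow> r e (Suc i') \<noteq> r e i' \<longrightarrow> i' = i"
proof -
  have st: "steps (r e) (clen K e) (clen K' e)" using step_familyD[OF r e] .
  let ?j = "first (r e) (Suc k)"
  have j: "r e ?j = Suc k" "?j \<le> clen K e"
    using first[OF st, of "Suc k"] k by auto
  have "?j \<noteq> 0"
  proof
    assume "?j = 0"
    then have "r e 0 = Suc k" using j(1) by simp
    then show False using st by (simp add: steps_def)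
  qed
  then obtain i where i: "?j = Suc i" by (cases ?j) auto
  have "\<not> Suc k \<le> r e i" using first(3)[OF st, of "Suc k" i] k j i by auto
  moreover have "r e (Suc i) = r e i \<or> r e (Suc i) = Suc (r e i)"
    using st i j(2) unfolding steps_def by (metis Suc_le_eq)
  ultimately have ri: "r e i = k" using j i by auto
  show thesis
  proof (rule that)
    show "i < clen K e" "r e i = k" "r e (Suc i) \<noteq> r e i"
      using i j ri by auto
  next
    show "\<forall>i'<clen K e. r e i' = k \<longrightarrow> r e (Suc i') \<noteq> r e i' \<longrightarrow> i' = i"
    proof (intro allI impI)
      fix i' assume i': "i' < clen K e" "r e i' = k" "r e (Suc i') \<noteq> r e i'"
      then have S: "r e (Suc i') = Suc k" using steps_less[OF st, of i'] by simp
      show "i' = i"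
      proof (rule ccontr)
        assume "i' \<noteq> i"
        then consider "Suc i' \<le> i" | "Suc i \<le> i'" by linarith
        then show False
        proof cases
          case 1
          then show False using steps_mono[OF st 1] S ri i j(2) by simp
        next
          case 2
          then show False using steps_mono[OF st 2] i' j(1) i by simp
        qed
      qed
    qed
  qed
qed

text \<open>By monotonicity all steps between \<open>i\<close> and \<open>j\<close> are flat, so the
  edges between the two vertices are all contracted.\<close>

lemma fiber_connected:
  assumes f: "realizes G H K H' K' r f" and r: "step_family r" and e: "e \<in> edges G"
    and ij: "i \<le> j" "j \<le> clen K e" and eq: "r e i = r e j"
  defines "R \<equiv> {(dart_source (gr H) x, dart_target (gr H) x) | x. fst x \<in> edges H \<and> contracted f (fst x)}"
  shows "(pos_vertex H K (chain_pos G K e i), pos_vertex H K (chain_pos G K e j)) \<in> R\<^sup>*"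
  using ij eq
proof (induction j rule: dec_induct)
  case (step j)
  have st: "steps (r e) (clen K e) (clen K' e)" using step_familyD[OF r e] .
  have j: "j < clen K e" using step by simp
  have "r e i \<le> r e j" "r e j \<le> r e (Suc j)"
    using steps_mono[OF st step(1)] steps_mono[OF st, of j "Suc j"] j by simp_all
  then have eq: "r e i = r e j" "r e (Suc j) = r e j" using step.prems by simp_all
  have "(dart_source (gr H) (cchain K e ! j), dart_target (gr H) (cchain K e ! j)) \<in> R"
    unfolding R_def using src.slot_arc_in_arcs[OF e j] contracted_slot(1)[OF f e j] eq by blast
  then have "(pos_vertex H K (chain_pos G K e j), pos_vertex H K (chain_pos G K e (Suc j))) \<in> R"
    using src.dart_source_slot[OF e j] src.dart_target_slot[OF e j] by simp
  moreover have "(pos_vertex H K (chain_pos G K e i), pos_vertex H K (chain_pos G K e j)) \<in> R\<^sup>*"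
    using step.IH eq j by simp
  ultimately show ?case by (rule rtrancl_into_rtrancl[rotated])
qed simp

lemma edge_contraction_realizes:
  assumes f: "realizes G H K H' K' r f" and r: "step_family r"
  shows "edge_contraction (gr H) (gr H') f"
proof -
  let ?R = "{(dart_source (gr H) x, dart_target (gr H) x) | x. fst x \<in> edges H \<and> contracted f (fst x)}"
  have vm: "vmap f (pos_vertex H K p) = pos_vertex H' K' (pos_step G K' r p)" if "p \<in> positions G K" for p
    using f that by (simp add: realizes_def)
  have im: "vmap f ` vertices H = vertices H'"
  proof
    show "vmap f ` vertices H \<subseteq> vertices H'"
    proof
      fix x assume "x \<in> vmap f ` vertices H"
      then obtain p where "p \<in> positions G K" "x = vmap f (pos_vertex H K p)"
        by (auto elim: src.obtain_position)
      then show "x \<in> vertices H'" using vm pos_step_in dst.pos_vertex_in_verts by simp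
    qed
    show "vertices H' \<subseteq> vmap f ` vertices H"
    proof
      fix x assume "x \<in> vertices H'"
      then obtain q where q: "q \<in> positions G K'" "x = pos_vertex H' K' q" by (rule dst.obtain_position)
      have "\<exists>p\<in>positions G K. pos_step G K' r p = q"
      proof (cases q)
        case (Inl v)
        then show ?thesis using q by (intro bexI[of _ "Inl v"]) auto
      next
        case (Inr s)
        then obtain e k where s: "q = Inr (e, k)" by (cases s) auto
        then have e: "e \<in> edges G" and k: "0 < k" "k < clen K' e" using q by auto
        have st: "steps (r e) (clen K e) (clen K' e)" using step_familyD[OF r e] .
        have i: "r e (first (r e) k) = k" "first (r e) k \<le> clen K e"
          using first[OF st, of k] k by auto
        show ?thesis
          using src.chain_pos_in[OF e] pos_step_chain_pos[OF r e i(2)] i(1) k s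
          by (intro bexI[of _ "chain_pos G K e (first (r e) k)"]) auto
      qed
      then obtain p where "p \<in> positions G K" "pos_step G K' r p = q" by blast
      then have "x = vmap f (pos_vertex H K p)" "pos_vertex H K p \<in> vertices H"
        using q vm src.pos_vertex_in_verts by auto
      then show "x \<in> vmap f ` vertices H" by blast
    qed
  qed
  have inc: "case emap f a of Inl v \<Rightarrow> vmap f (tail (gr H) a) = v \<and> vmap f (head (gr H) a) = v
      | Inr x \<Rightarrow> fst x \<in> edges H' \<and> vmap f (tail (gr H) a) = dart_source (gr H') x \<and>
                 vmap f (head (gr H) a) = dart_target (gr H') x" if a: "a \<in> edges H" for a
  proof -
    obtain e i where e: "e \<in> edges G" and i: "i < clen K e"
      and ai: "a = fst (cchain K e ! i)" using a by (rule src.obtain_slot)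
    have st: "steps (r e) (clen K e) (clen K' e)" using step_familyD[OF r e] .
    have em: "emap f a = slot_image G K H' K' r e i"
      using f e i unfolding realizes_def ai by blast
    have v: "vmap f (dart_source (gr H) (cchain K e ! i)) = pos_vertex H' K' (chain_pos G K' e (r e i))"
      "vmap f (dart_target (gr H) (cchain K e ! i)) = pos_vertex H' K' (chain_pos G K' e (r e (Suc i)))"
      using src.dart_source_slot[OF e i] src.dart_target_slot[OF e i] vmap_chain_pos[OF f r e] i by auto
    show ?thesis
    proof (cases "r e (Suc i) = r e i")
      case True
      then show ?thesis using em v by (auto simp: slot_image_def dart_source_def dart_target_def ai split: if_splits)
    next
      case False
      have lt: "r e i < clen K' e" and S: "r e (Suc i) = Suc (r e i)"
        using steps_less[OF st i False] by auto
      have "fst (cchain K' e ! r e i) \<in> edges H'" using dst.slot_arc_in_arcs[OF e lt] .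
      moreover have "dart_source (gr H') (cchain K' e ! r e i) = pos_vertex H' K' (chain_pos G K' e (r e i))"
        "dart_target (gr H') (cchain K' e ! r e i) = pos_vertex H' K' (chain_pos G K' e (Suc (r e i)))"
        using dst.dart_source_slot[OF e lt] dst.dart_target_slot[OF e lt] .
      ultimately show ?thesis using em v False S
        by (cases "snd (cchain K e ! i)"; cases "snd (cchain K' e ! r e i)")
          (auto simp: slot_image_def dart_source_def dart_target_def ai)
    qed
  qed
  have ex1: "\<exists>!a. a \<in> edges H \<and> \<not> contracted f a \<and> edge_image f a = b" if b: "b \<in> edges H'" for b
  proof -
    obtain e k where e: "e \<in> edges G" and k: "k < clen K' e"
      and bk: "b = fst (cchain K' e ! k)" using b by (rule dst.obtain_slot)
    obtain i where i: "i < clen K e" "r e i = k" "r e (Suc i) \<noteq> r e i"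
      and uni: "\<forall>i'<clen K e. r e i' = k \<longrightarrow> r e (Suc i') \<noteq> r e i' \<longrightarrow> i' = i"
      by (rule slot_preimage[OF r e k])
    show ?thesis
    proof (rule ex1I[of _ "fst (cchain K e ! i)"])
      show "fst (cchain K e ! i) \<in> edges H \<and> \<not> contracted f (fst (cchain K e ! i)) \<and>
          edge_image f (fst (cchain K e ! i)) = b"
        using contracted_slot[OF f e i(1)] src.slot_arc_in_arcs[OF e i(1)] i bk by simp
    next
      fix a assume a: "a \<in> edges H \<and> \<not> contracted f a \<and> edge_image f a = b"
      then obtain e' j where e': "e' \<in> edges G" and j: "j < clen K e'"
        and aj: "a = fst (cchain K e' ! j)" using src.obtain_slot by metis
      have nc: "r e' (Suc j) \<noteq> r e' j" using a contracted_slot(1)[OF f e' j] aj by simp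
      then have "fst (cchain K' e' ! r e' j) = fst (cchain K' e ! k)"
        using a contracted_slot(2)[OF f e' j] aj bk by simp
      then have "e' = e \<and> r e' j = k"
        by (rule dst.slot_unique[OF e' steps_less(2)[OF step_familyD[OF r e'] j nc] e k])
      then have "j = i" using uni j nc by auto
      then show "a = fst (cchain K e ! i)" using \<open>e' = e \<and> r e' j = k\<close> aj by simp
    qed
  qed
  \<comment> \<open>\<open>fiber_connected\<close> only walks forward along a chain; each contracted
    edge can be traversed backwards as well.\<close>
  have sym: "sym (?R\<^sup>*)"
  proof (rule sym_rtrancl, rule symI)
    fix a b assume "(a, b) \<in> ?R"
    then obtain x where x: "a = dart_source (gr H) x" "b = dart_target (gr H) x"
      "fst x \<in> edges H" "contracted f (fst x)" by blast
    then show "(b, a) \<in> ?R"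
      by (intro CollectI exI[of _ "(fst x, \<not> snd x)"]) (auto simp: dart_source_def dart_target_def)
  qed
  \<comment> \<open>Fibres are shown to be connected through a representative that depends only on
    the image: the base vertex itself over a base vertex, the leftmost preimage over an inner
    vertex.\<close>
  define can where "can q = (case q of Inl v \<Rightarrow> Inl v | Inr (e, k) \<Rightarrow> chain_pos G K e (first (r e) k))"
    for q :: "'v + 'e \<times> nat"
  have can: "(pos_vertex H K p, pos_vertex H K (can (pos_step G K' r p))) \<in> ?R\<^sup>*" if p: "p \<in> positions G K" for p
  proof (cases p)
    case (Inl v)
    then show ?thesis by (simp add: can_def)
  next
    case (Inr s)
    then obtain e i where s: "p = Inr (e, i)" by (cases s) auto
    then have e: "e \<in> edges G" and i: "0 < i" "i < clen K e" using p by auto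
    have st: "steps (r e) (clen K e) (clen K' e)" using step_familyD[OF r e] .
    have pi: "chain_pos G K e i = p" using i s by simp
    have le: "r e i \<le> clen K' e" using steps_le[OF st] i by simp
    \<comment> \<open>A vertex pushed to an end of the coarse chain is joined to the same end of the
      fine chain, position 0 or \<open>clen K e\<close>. This is where the fibres in different
      chains over one base vertex come together; \<open>first\<close> serves only for inner
      targets.\<close>
    have *: "\<exists>j\<le>clen K e. r e j = r e i \<and> can (chain_pos G K' e (r e i)) = chain_pos G K e j"
    proof -
      consider "r e i = 0" | "r e i = clen K' e" | "0 < r e i" "r e i < clen K' e"
        using le by linarith
      then show ?thesis
      proof cases
        case 1
        then show ?thesis using st by (intro exI[of _ 0]) (auto simp: can_def steps_def)
      next
        case 2
        then show ?thesis using st dst.chain_nonempty[OF e] src.chain_nonempty[OF e]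
          by (intro exI[of _ "clen K e"]) (auto simp: can_def steps_def)
      next
        case 3
        then show ?thesis using first(1,2)[OF st le]
          by (intro exI[of _ "first (r e) (r e i)"]) (auto simp: can_def)
      qed
    qed
    then obtain j where j: "j \<le> clen K e" "r e j = r e i"
      "can (chain_pos G K' e (r e i)) = chain_pos G K e j" by blast
    have "(pos_vertex H K (chain_pos G K e i), pos_vertex H K (chain_pos G K e j)) \<in> ?R\<^sup>*"
    proof (cases "i \<le> j")
      case True
      then show ?thesis using fiber_connected[OF f r e True j(1)] j(2) by simp
    next
      case False
      then have "(pos_vertex H K (chain_pos G K e j), pos_vertex H K (chain_pos G K e i)) \<in> ?R\<^sup>*"
        using fiber_connected[OF f r e, of j i] j(2) i by simp
      then show ?thesis using sym by (rule symD[rotated])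
    qed
    then show ?thesis using j(3) pi s by simp
  qed
  have conn: "(u, v) \<in> ?R\<^sup>*" if uv: "u \<in> vertices H" "v \<in> vertices H" "vmap f u = vmap f v" for u v
  proof -
    obtain p where p: "p \<in> positions G K" "u = pos_vertex H K p" using uv(1) by (rule src.obtain_position)
    obtain q where q: "q \<in> positions G K" "v = pos_vertex H K q" using uv(2) by (rule src.obtain_position)
    have "pos_step G K' r p = pos_step G K' r q"
      using uv(3) vm p q pos_step_in dst.pos_vertex_inj by simp
    then show ?thesis using can[OF p(1)] symD[OF sym can[OF q(1)]] p q by (metis (no_types, lifting) rtrancl_trans)
  qed
  show ?thesis
    unfolding edge_contraction_def using f im inc ex1 conn by (simp add: realizes_def)
qed

end

section \<open>Chains of a contraction between subdivisions\<close>

definition flip :: "'f dart \<Rightarrow> 'f dart" where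
  "flip x = (fst x, \<not> snd x)"

lemma fst_flip [simp]: "fst (flip x) = fst x"
  by (simp add: flip_def)

lemma dart_ends_flip [simp]:
  "dart_source H (flip x) = dart_target H x" "dart_target H (flip x) = dart_source H x"
  by (auto simp: flip_def dart_source_def dart_target_def)

lemma dart_image_flip: "dart_image f (flip x) = map_option flip (dart_image f x)"
  by (auto simp: dart_image_def flip_def split: sum.split)

lemma map_filter_flip: "List.map_filter (dart_image f) (map flip xs) = map flip (List.map_filter (dart_image f) xs)"
  by (induction xs) (auto simp: map_filter_simps dart_image_flip split: option.split)

lemma map_filter_rev: "List.map_filter g (rev xs) = rev (List.map_filter g xs)"
  by (simp add: List.map_filter_def rev_map rev_filter)

lemma dart_ends_True: "dart_source H (b, True) = tail H b" "dart_target H (b, True) = head H b"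
  by (auto simp: dart_source_def dart_target_def)

text \<open>The chain is cut into \<open>m\<close> segments, each with one surviving edge.
  Contracted edges are put into the segment of the next surviving edge; those after the last
  surviving edge have no next one and join the last segment, so the final cut is \<open>n\<close>
  and not \<open>first r m\<close>.\<close>

definition cut :: "(nat \<Rightarrow> nat) \<Rightarrow> nat \<Rightarrow> nat \<Rightarrow> nat \<Rightarrow> nat" where
  "cut r n m k = (if k < m then first r k else n)"

lemma cut:
  assumes "steps r n m" "0 < m"
  shows "cut r n m 0 = 0" "cut r n m m = n" "k \<le> m \<Longrightarrow> r (cut r n m k) = k" "cut r n m k \<le> n"
    and "k < m \<Longrightarrow> i \<le> n \<Longrightarrow> cut r n m k \<le> i \<longleftrightarrow> k \<le> r i"
proof -
  have "first r 0 \<le> 0" using first(3)[OF assms(1), of 0 0] by simp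
  then show "cut r n m 0 = 0" using assms(2) by (simp add: cut_def)
  show "cut r n m m = n" by (simp add: cut_def)
  show "r (cut r n m k) = k" if "k \<le> m"
    using first(1)[OF assms(1) that] that assms(1) by (auto simp: cut_def steps_def)
  show "cut r n m k \<le> n" using first(2)[OF assms(1), of k] by (auto simp: cut_def)
  show "cut r n m k \<le> i \<longleftrightarrow> k \<le> r i" if "k < m" "i \<le> n"
    using first(3)[OF assms(1), of k i] that by (auto simp: cut_def)
qed

lemma cut_less:
  assumes "steps r n m" "0 < m" "k < k'" "k' \<le> m"
  shows "cut r n m k < cut r n m k'"
proof (rule ccontr)
  assume "\<not> cut r n m k < cut r n m k'"
  then have "r (cut r n m k') \<le> r (cut r n m k)"
    using steps_mono[OF assms(1)] cut(4)[OF assms(1,2)] by simp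
  then show False using cut(3)[OF assms(1,2)] assms(3,4) by simp
qed

lemma cut_interval:
  assumes "steps r n m" "0 < m" "i < n"
  obtains k where "k < m" "cut r n m k \<le> i" "i < cut r n m (Suc k)"
proof
  \<comment> \<open>The contracted edges at the end of the chain have \<open>r i = m\<close>; the
    minimum puts them into the last segment.\<close>
  let ?k = "min (r i) (m - 1)"
  show k: "?k < m" using assms(2) by auto
  show "cut r n m ?k \<le> i" using cut(5)[OF assms(1,2) k] assms(3) by simp
  show "i < cut r n m (Suc ?k)"
  proof (cases "Suc ?k < m")
    case True
    then have "\<not> cut r n m (Suc ?k) \<le> i" using cut(5)[OF assms(1,2) True] assms(3) by auto
    then show ?thesis by simp
  next
    case False
    then have "Suc ?k = m" using k by simp
    then show ?thesis using assms(3) cut(2)[OF assms(1,2)] by simp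
  qed
qed

lemma cut_interval_unique:
  assumes "steps r n m" "0 < m" "k < m" "k' < m"
    and "cut r n m k \<le> i" "i < cut r n m (Suc k)" "cut r n m k' \<le> i" "i < cut r n m (Suc k')"
  shows "k = k'"
proof (rule ccontr)
  have le: "cut r n m (Suc a) \<le> cut r n m b" if "a < b" "b < m" for a b
    using cut_less[OF assms(1,2), of "Suc a" b] that by (cases "Suc a = b") auto
  assume "k \<noteq> k'"
  then have "k < k' \<or> k' < k" by auto
  then show False using le[of k k'] le[of k' k] assms by auto
qed

locale chain_collapse = chained_pair H H' G K K'
  for H :: "('w, 'f) wgraph" and H' :: "('x, 'g) wgraph" and G :: "('v, 'e) wgraph" and K K' +
  fixes r :: "'e \<Rightarrow> nat \<Rightarrow> nat"
  assumes r: "step_family r"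
begin

definition bound :: "'e \<Rightarrow> nat \<Rightarrow> nat" where
  "bound e k = cut (r e) (clen K e) (clen K' e) k"

text \<open>A section of \<open>pos_step\<close>: an inner vertex of the coarse chain lifts to the
  leftmost vertex of its fibre, where two consecutive segments meet.\<close>

definition lift_pos :: "'v + 'e \<times> nat \<Rightarrow> 'v + 'e \<times> nat" where
  "lift_pos q = (case q of Inl v \<Rightarrow> Inl v | Inr (e, k) \<Rightarrow> Inr (e, bound e k))"

definition slot_of :: "'g \<Rightarrow> 'e \<times> nat" where
  "slot_of b = inv_into (slots G K') (slot_arc K') b"

definition pos_of :: "'x \<Rightarrow> 'v + 'e \<times> nat" where
  "pos_of x = inv_into (positions G K') (pos_vertex H' K') x"

text \<open>The place in the chain over \<open>e\<close> that is reached after \<open>j\<close>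
  darts of the chain that becomes \<open>b\<close>; it is counted from the right end of the segment
  if \<open>H'\<close> runs through \<open>b\<close> backwards.\<close>

definition offset :: "'g \<Rightarrow> nat \<Rightarrow> nat" where
  "offset b j = (let (e, k) = slot_of b in
     if snd (cchain K' e ! k) then bound e k + j else bound e (Suc k) - j)"

text \<open>The chain that becomes \<open>b\<close> is the segment of the chain of \<open>H\<close> between two consecutive bounds. It is
  reversed if the chain of \<open>H'\<close> runs through \<open>b\<close> backwards.\<close>

definition collapse :: "('w, 'f, 'x, 'g) chains" where
  "collapse = \<lparr>cvert = (\<lambda>x. pos_vertex H K (lift_pos (pos_of x))),
     cchain = (\<lambda>b. let (e, k) = slot_of b; xs = map ((!) (cchain K e)) [bound e k..<bound e (Suc k)] in
       if snd (cchain K' e ! k) then xs else map flip (rev xs))\<rparr>"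

lemma slot_of [simp]:
  assumes "e \<in> edges G" "k < clen K' e"
  shows "slot_of (fst (cchain K' e ! k)) = (e, k)"
proof -
  have "inv_into (slots G K') (slot_arc K') (slot_arc K' (e, k)) = (e, k)"
    using assms bij_betw_imp_inj_on[OF dst.bij_slots] by (intro inv_into_f_f) auto
  then show ?thesis by (simp add: slot_of_def)
qed

lemma pos_of [simp]: "q \<in> positions G K' \<Longrightarrow> pos_of (pos_vertex H' K' q) = q"
  using bij_betw_imp_inj_on[OF dst.bij_positions] by (simp add: pos_of_def)

lemma slot_of_arc:
  assumes "b \<in> edges H'"
  obtains e k where "e \<in> edges G" "k < clen K' e" "b = fst (cchain K' e ! k)"
    "slot_of b = (e, k)"
  using dst.obtain_slot[OF assms] slot_of by metis

lemma st: "e \<in> edges G \<Longrightarrow> steps (r e) (clen K e) (clen K' e)"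
  using step_familyD[OF r] .

lemma m_pos: "e \<in> edges G \<Longrightarrow> 0 < clen K' e"
  using dst.chain_nonempty by simp

lemma bound:
  assumes "e \<in> edges G"
  shows "bound e 0 = 0" "bound e (clen K' e) = clen K e"
    "k \<le> clen K' e \<Longrightarrow> r e (bound e k) = k" "bound e k \<le> clen K e"
    "k < k' \<Longrightarrow> k' \<le> clen K' e \<Longrightarrow> bound e k < bound e k'"
  unfolding bound_def using cut[OF st m_pos] cut_less[OF st m_pos] assms by auto

lemma bound_interval:
  assumes "e \<in> edges G" "i < clen K e"
  obtains k where "k < clen K' e" "bound e k \<le> i" "i < bound e (Suc k)"
  using cut_interval[OF st[OF assms(1)] m_pos[OF assms(1)] assms(2)] unfolding bound_def by blast

lemma bound_interval_unique:
  assumes "e \<in> edges G" "k < clen K' e" "k' < clen K' e"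
    and "bound e k \<le> i" "i < bound e (Suc k)" "bound e k' \<le> i" "i < bound e (Suc k')"
  shows "k = k'"
  using cut_interval_unique[OF st[OF assms(1)] m_pos[OF assms(1)]] assms unfolding bound_def by blast

text \<open>The codes of the ends are respected because \<open>bound\<close> sends 0 to 0 and the
  length of the coarse chain to that of the fine one; strict growth keeps inner positions
  inner.\<close>

lemma lift_pos_chain_pos:
  assumes "e \<in> edges G" "k \<le> clen K' e"
  shows "lift_pos (chain_pos G K' e k) = chain_pos G K e (bound e k)"
proof -
  consider "k = 0" | "k = clen K' e" | "0 < k" "k < clen K' e"
    using assms(2) by linarith
  then show ?thesis
  proof cases
    case 3
    then have "0 < bound e k" "bound e k < clen K e"
      using bound(5)[OF assms(1), of 0 k] bound(5)[OF assms(1), of k "clen K' e"]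
        bound(1,2)[OF assms(1)] by auto
    then show ?thesis using 3 by (simp add: lift_pos_def)
  qed (use assms bound(1,2) src.chain_nonempty dst.chain_nonempty in \<open>simp_all add: lift_pos_def\<close>)
qed

lemma cvert_collapse:
  assumes "e \<in> edges G" "k \<le> clen K' e"
  shows "cvert collapse (pos_vertex H' K' (chain_pos G K' e k)) = pos_vertex H K (chain_pos G K e (bound e k))"
  using assms dst.chain_pos_in lift_pos_chain_pos by (simp add: collapse_def)

lemma length_collapse:
  assumes "e \<in> edges G" "k < clen K' e"
  shows "length (cchain collapse (fst (cchain K' e ! k))) = bound e (Suc k) - bound e k"
  using assms by (simp add: collapse_def Let_def)

lemma nth_collapse:
  assumes "e \<in> edges G" "k < clen K' e" "j < bound e (Suc k) - bound e k"
  shows "cchain collapse (fst (cchain K' e ! k)) ! j =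
    (if snd (cchain K' e ! k) then cchain K e ! (bound e k + j)
     else flip (cchain K e ! (bound e (Suc k) - Suc j)))"
proof -
  have "bound e (Suc k) - bound e k - Suc j + bound e k = bound e (Suc k) - Suc j"
    using assms(3) by simp
  then show ?thesis using assms by (simp add: collapse_def Let_def rev_nth add.commute)
qed

lemma dart_ends_collapse:
  assumes e: "e \<in> edges G" and k: "k < clen K' e" and j: "j < bound e (Suc k) - bound e k"
  defines "b \<equiv> fst (cchain K' e ! k)"
  shows "dart_source (gr H) (cchain collapse b ! j) = pos_vertex H K (chain_pos G K e (offset b j))"
    "dart_target (gr H) (cchain collapse b ! j) = pos_vertex H K (chain_pos G K e (offset b (Suc j)))"
proof -
  have n: "bound e (Suc k) \<le> clen K e" using bound(4)[OF e] .
  have i: "bound e k + j < clen K e" "bound e (Suc k) - Suc j < clen K e"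
    "Suc (bound e (Suc k) - Suc j) = bound e (Suc k) - j"
    using n j by simp_all
  show "dart_source (gr H) (cchain collapse b ! j) = pos_vertex H K (chain_pos G K e (offset b j))"
    using nth_collapse[OF e k j] src.dart_source_slot[OF e i(1)] src.dart_target_slot[OF e i(2)] i(3) e k
    by (simp add: offset_def b_def)
  show "dart_target (gr H) (cchain collapse b ! j) = pos_vertex H K (chain_pos G K e (offset b (Suc j)))"
    using nth_collapse[OF e k j] src.dart_target_slot[OF e i(1)] src.dart_source_slot[OF e i(2)] e k
    by (simp add: offset_def b_def)
qed

lemma pos_vertex_collapse:
  assumes e: "e \<in> edges G" and k: "k < clen K' e" and j: "j \<le> bound e (Suc k) - bound e k"
  defines "b \<equiv> fst (cchain K' e ! k)"
  shows "pos_vertex H collapse (chain_pos H' collapse b j) = pos_vertex H K (chain_pos G K e (offset b j))"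
proof -
  have lt: "bound e k < bound e (Suc k)" using bound(5)[OF e, of k "Suc k"] k by simp
  have len: "clen collapse b = bound e (Suc k) - bound e k"
    using length_collapse[OF e k] by (simp add: b_def)
  \<comment> \<open>\<open>chain_pos\<close> over \<open>b\<close> follows the reference orientation
    of \<open>b\<close>. If the chain of \<open>H'\<close> runs through \<open>b\<close> backwards,
    the tail of \<open>b\<close> lies at the right end of the segment.\<close>
  have ends: "(if snd (cchain K' e ! k) then tail (gr H') b else head (gr H') b) = pos_vertex H' K' (chain_pos G K' e k)"
    "(if snd (cchain K' e ! k) then head (gr H') b else tail (gr H') b) = pos_vertex H' K' (chain_pos G K' e (Suc k))"
    using dst.dart_source_slot[OF e k] dst.dart_target_slot[OF e k]
    unfolding dart_source_def dart_target_def b_def by auto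
  have cv: "cvert collapse (pos_vertex H' K' (chain_pos G K' e k)) = pos_vertex H K (chain_pos G K e (bound e k))"
    "cvert collapse (pos_vertex H' K' (chain_pos G K' e (Suc k))) = pos_vertex H K (chain_pos G K e (bound e (Suc k)))"
    using cvert_collapse[OF e] k by simp_all
  consider "j = 0" | "j = bound e (Suc k) - bound e k" | "0 < j" "j < bound e (Suc k) - bound e k"
    using j by linarith
  then show ?thesis
  proof cases
    case 1
    then show ?thesis using ends cv e k by (auto simp: offset_def b_def split: if_splits)
  next
    case 2
    have "chain_pos H' collapse b j = Inl (head (gr H') b)"
      using 2 lt len by (simp add: chain_pos_def)
    then show ?thesis using 2 ends cv e k lt by (auto simp: offset_def b_def split: if_splits)
  next
    case 3
    then have "pos_vertex H collapse (chain_pos H' collapse b j) = dart_target (gr H) (cchain collapse b ! (j - 1))"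
      using len by (simp add: pos_vertex_Inr)
    also have "\<dots> = pos_vertex H K (chain_pos G K e (offset b (Suc (j - 1))))"
      using dart_ends_collapse(2)[OF e k, of "j - 1"] 3 by (simp add: b_def)
    finally show ?thesis using 3 by simp
  qed
qed

text \<open>Translates codes over \<open>H'\<close> into codes over \<open>G\<close>. The
  parametrization of vertices of \<open>H\<close> by \<open>collapse\<close> factors through the one
  by \<open>K\<close> in this way, so bijectivity has to be shown on codes only.\<close>

definition join_pos :: "'x + 'g \<times> nat \<Rightarrow> 'v + 'e \<times> nat" where
  "join_pos p = (case p of Inl x \<Rightarrow> lift_pos (pos_of x) | Inr (b, j) \<Rightarrow> Inr (fst (slot_of b), offset b j))"

lemma offset_between:
  assumes e: "e \<in> edges G" and k: "k < clen K' e" and j: "0 < j" "j < bound e (Suc k) - bound e k"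
  shows "bound e k < offset (fst (cchain K' e ! k)) j" "offset (fst (cchain K' e ! k)) j < bound e (Suc k)"
  using assms by (auto simp: offset_def)

lemma inner_collapseE:
  assumes "Inr (b, j) \<in> positions H' collapse"
  obtains e k where "e \<in> edges G" "k < clen K' e" "b = fst (cchain K' e ! k)"
    "slot_of b = (e, k)" "0 < j" "j < bound e (Suc k) - bound e k"
proof -
  have b: "b \<in> edges H'" and j: "0 < j" "j < clen collapse b" using assms by auto
  show thesis using slot_of_arc[OF b] that j length_collapse by metis
qed

text \<open>An inner position of the fine chain either is a bound, and then comes from a vertex of
  \<open>H'\<close>, or lies strictly between two consecutive bounds, and then is inner to exactly
  one collapsed chain.\<close>

lemma bij_join_pos: "bij_betw join_pos (positions H' collapse) (positions G K)"
proof -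
  have lift: "lift_pos q \<in> positions G K" if "q \<in> positions G K'" for q
  proof (cases q)
    case (Inl v)
    then show ?thesis using that by (simp add: lift_pos_def)
  next
    case (Inr s)
    then obtain e k where s: "q = Inr (e, k)" by (cases s) auto
    then have e: "e \<in> edges G" and k: "0 < k" "k < clen K' e" using that by auto
    then show ?thesis using lift_pos_chain_pos[OF e, of k] src.chain_pos_in[OF e] s by simp
  qed
  have ins: "join_pos p \<in> positions G K" if p: "p \<in> positions H' collapse" for p
  proof (cases p)
    case (Inl x)
    then have "x \<in> vertices H'" using p by simp
    then obtain q where "q \<in> positions G K'" "x = pos_vertex H' K' q" by (rule dst.obtain_position)
    then show ?thesis using Inl lift by (simp add: join_pos_def)
  next
    case (Inr s)
    then obtain b j where s: "p = Inr (b, j)" by (cases s) auto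
    with p have "Inr (b, j) \<in> positions H' collapse" by simp
    then obtain e k where ek: "e \<in> edges G" "k < clen K' e" "b = fst (cchain K' e ! k)"
      "slot_of b = (e, k)" "0 < j" "j < bound e (Suc k) - bound e k" by (rule inner_collapseE)
    show ?thesis using offset_between[OF ek(1,2,5,6)] bound(4)[OF ek(1), of "Suc k"] ek s
      by (simp add: join_pos_def)
  qed
  have inj: "p = q" if p: "p \<in> positions H' collapse" and q: "q \<in> positions H' collapse"
    and eq: "join_pos p = join_pos q" for p q
  proof -
    have Inl_Inr: False if x: "Inl x \<in> positions H' collapse" and bj: "Inr (b, j) \<in> positions H' collapse"
      and eq: "join_pos (Inl x) = join_pos (Inr (b, j))" for x b j
    proof -
      obtain e k where ek: "e \<in> edges G" "k < clen K' e" "b = fst (cchain K' e ! k)"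
        "slot_of b = (e, k)" "0 < j" "j < bound e (Suc k) - bound e k" using bj by (rule inner_collapseE)
      have "x \<in> vertices H'" using x by simp
      then obtain p where p: "p \<in> positions G K'" "x = pos_vertex H' K' p" by (rule dst.obtain_position)
      have "lift_pos p = Inr (e, offset b j)" using eq p ek by (simp add: join_pos_def)
      then obtain k' where k': "p = Inr (e, k')" "bound e k' = offset b j"
        by (auto simp: lift_pos_def split: sum.splits)
      have lt: "k' < clen K' e" using p(1) k'(1) by simp
      note ob = offset_between[OF ek(1,2,5,6), folded ek(3)]
      have "k' = k"
      proof (rule bound_interval_unique[OF ek(1) lt ek(2), of "offset b j"])
        show "offset b j < bound e (Suc k')" using bound(5)[OF ek(1), of k' "Suc k'"] lt k'(2) by simp
      qed (use ob k'(2) in auto)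
      then show False using ob k'(2) by simp
    qed
    have Inr_Inr: "b = b' \<and> j = j'" if bj: "Inr (b, j) \<in> positions H' collapse"
      and bj': "Inr (b', j') \<in> positions H' collapse"
      and eq: "join_pos (Inr (b, j)) = join_pos (Inr (b', j'))" for b j b' j'
    proof -
      obtain e k where ek: "e \<in> edges G" "k < clen K' e" "b = fst (cchain K' e ! k)"
        "slot_of b = (e, k)" "0 < j" "j < bound e (Suc k) - bound e k" using bj by (rule inner_collapseE)
      obtain e' k' where ek': "e' \<in> edges G" "k' < clen K' e'" "b' = fst (cchain K' e' ! k')"
        "slot_of b' = (e', k')" "0 < j'" "j' < bound e' (Suc k') - bound e' k'" using bj' by (rule inner_collapseE)
      have ee: "e' = e" and oo: "offset b j = offset b' j'" using eq ek(4) ek'(4) by (auto simp: join_pos_def)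
      note ob = offset_between[OF ek(1,2,5,6), folded ek(3)]
      note ob' = offset_between[OF ek'(1,2,5,6), folded ek'(3), unfolded ee]
      have kk: "k' < clen K' e" using ek'(2) ee by simp
      have "k = k'"
        by (rule bound_interval_unique[OF ek(1,2) kk, of "offset b j"]) (use ob ob' oo in auto)
      then have "b = b'" using ek(3) ek'(3) ee by simp
      moreover have "j = j'" using oo \<open>b = b'\<close> ek ek'(5,6) ee \<open>k = k'\<close>
        by (auto simp: offset_def split: if_splits)
      ultimately show ?thesis by simp
    qed
    have Inl_Inl: "x = y" if x: "Inl x \<in> positions H' collapse" and y: "Inl y \<in> positions H' collapse"
      and eq: "join_pos (Inl x) = join_pos (Inl y)" for x y
    proof -
      have xy: "x \<in> vertices H'" "y \<in> vertices H'" using x y by auto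
      obtain p where p: "p \<in> positions G K'" "x = pos_vertex H' K' p" using xy(1) by (rule dst.obtain_position)
      obtain q where q: "q \<in> positions G K'" "y = pos_vertex H' K' q" using xy(2) by (rule dst.obtain_position)
      have pq: "lift_pos p = lift_pos q" using eq p q by (simp add: join_pos_def)
      have "p = q"
      proof (cases p; cases q)
        fix s t assume st: "p = Inr s" "q = Inr t"
        obtain e k e' k' where s: "s = (e, k)" "t = (e', k')" by (cases s; cases t) auto
        then have ee: "e' = e" "bound e k = bound e k'" using pq st by (auto simp: lift_pos_def)
        have e: "e \<in> edges G" "k \<le> clen K' e" "k' \<le> clen K' e"
          using p(1) q(1) st s ee by auto
        have "k = r e (bound e k)" using bound(3)[OF e(1,2)] by simp
        also have "\<dots> = r e (bound e k')" by (simp only: ee(2))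
        also have "\<dots> = k'" using bound(3)[OF e(1,3)] .
        finally show "p = q" using st s ee(1) by simp
      qed (use pq in \<open>auto simp: lift_pos_def split: prod.splits\<close>)
      then show ?thesis using p q by simp
    qed
    show ?thesis
    proof (cases p; cases q)
      fix x y assume "p = Inl x" "q = Inl y"
      then show ?thesis using Inl_Inl[of x y] p q eq by simp
    next
      fix x s assume "p = Inl x" "q = Inr s"
      then show ?thesis using Inl_Inr[of x "fst s" "snd s"] p q eq by simp
    next
      fix x s assume "p = Inr s" "q = Inl x"
      then show ?thesis using Inl_Inr[of x "fst s" "snd s"] p q eq by simp
    next
      fix s t assume "p = Inr s" "q = Inr t"
      then show ?thesis using Inr_Inr[of "fst s" "snd s" "fst t" "snd t"] p q eq by (simp add: prod_eq_iff)
    qed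
  qed
  have sur: "\<exists>q\<in>positions H' collapse. join_pos q = p" if p: "p \<in> positions G K" for p
  proof (cases p)
    case (Inl v)
    then have v: "Inl v \<in> positions G K'" using p by simp
    then show ?thesis using Inl dst.pos_vertex_in_verts[OF v] pos_of[OF v]
      by (intro bexI[of _ "Inl (pos_vertex H' K' (Inl v))"]) (simp_all add: join_pos_def lift_pos_def)
  next
    case (Inr s)
    then obtain e i where s: "p = Inr (e, i)" by (cases s) auto
    then have e: "e \<in> edges G" and i: "0 < i" "i < clen K e" using p by auto
    obtain k where k: "k < clen K' e" "bound e k \<le> i" "i < bound e (Suc k)"
      using bound_interval[OF e i(2)] .
    show ?thesis
    proof (cases "bound e k = i")
      case True
      then have "k \<noteq> 0" using bound(1)[OF e] i(1) by (metis less_irrefl)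
      then have q: "Inr (e, k) \<in> positions G K'" using e k by simp
      then show ?thesis using s True dst.pos_vertex_in_verts[OF q] pos_of[OF q]
        by (intro bexI[of _ "Inl (pos_vertex H' K' (Inr (e, k)))"]) (simp_all add: join_pos_def lift_pos_def)
    next
      case False
      define b where "b = fst (cchain K' e ! k)"
      define j where "j = (if snd (cchain K' e ! k) then i - bound e k else bound e (Suc k) - i)"
      have "Inr (b, j) \<in> positions H' collapse"
        using dst.slot_arc_in_arcs[OF e k(1)] length_collapse[OF e k(1)] k False by (auto simp: b_def j_def)
      moreover have "join_pos (Inr (b, j)) = p"
        using e k s by (auto simp: join_pos_def offset_def b_def j_def)
      ultimately show ?thesis by blast
    qed
  qed
  have "inj_on join_pos (positions H' collapse)" using inj by (rule inj_onI)
  moreover have "join_pos ` positions H' collapse = positions G K"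
    using ins sur by (blast intro: equalityI)
  ultimately show ?thesis by (simp add: bij_betw_def)
qed

lemma pos_vertex_join:
  assumes p: "p \<in> positions H' collapse"
  shows "pos_vertex H collapse p = pos_vertex H K (join_pos p)"
proof (cases p)
  case (Inl x)
  then show ?thesis by (simp add: join_pos_def collapse_def)
next
  case (Inr s)
  then obtain b j where s: "p = Inr (b, j)" by (cases s) auto
  with p have "Inr (b, j) \<in> positions H' collapse" by simp
  then obtain e k where ek: "e \<in> edges G" "k < clen K' e" "b = fst (cchain K' e ! k)"
    "slot_of b = (e, k)" "0 < j" "j < bound e (Suc k) - bound e k" by (rule inner_collapseE)
  have "chain_pos H' collapse b j = p" using s p by simp
  moreover have "chain_pos G K e (offset b j) = join_pos p"
    using offset_between[OF ek(1,2,5,6)] bound(4)[OF ek(1), of "Suc k"] ek s by (simp add: join_pos_def)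
  ultimately show ?thesis using pos_vertex_collapse[OF ek(1,2), of j] ek by simp
qed

lemma bij_collapse_slots: "bij_betw (slot_arc collapse) (slots H' collapse) (edges H)"
proof -
  \<comment> \<open>The analogue of \<open>join_pos\<close> for edges. In a reversed segment dart
    number \<open>j\<close> starts at position \<open>bound e (Suc k) - j\<close> and occupies the
    slot to the left of it, hence the \<open>Suc\<close>.\<close>
  define t where "t s = (let (e, k) = slot_of (fst s) in
    (e, if snd (cchain K' e ! k) then bound e k + snd s else bound e (Suc k) - Suc (snd s)))" for s
  have t: "t (fst (cchain K' e ! k), j) = (e, if snd (cchain K' e ! k) then bound e k + j else bound e (Suc k) - Suc j)"
    if "e \<in> edges G" "k < clen K' e" for e k j
    using that by (simp add: t_def)
  have slotE: "\<exists>e k. e \<in> edges G \<and> k < clen K' e \<and> b = fst (cchain K' e ! k) \<and> j < bound e (Suc k) - bound e k"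
    if bj: "(b, j) \<in> slots H' collapse" for b j
  proof -
    have b: "b \<in> edges H'" and j: "j < clen collapse b" using bj by auto
    obtain e k where "e \<in> edges G" "k < clen K' e" "b = fst (cchain K' e ! k)"
      using b by (rule dst.obtain_slot)
    then show ?thesis using j length_collapse by metis
  qed
  have range: "bound e k \<le> snd (t (fst (cchain K' e ! k), j))" "snd (t (fst (cchain K' e ! k), j)) < bound e (Suc k)"
    if "e \<in> edges G" "k < clen K' e" "j < bound e (Suc k) - bound e k" for e k j
    using that t by auto
  have ins: "t s \<in> slots G K \<and> slot_arc collapse s = slot_arc K (t s)" if s: "s \<in> slots H' collapse" for s
  proof -
    obtain b j where bj: "s = (b, j)" by (cases s)
    then obtain e k where ek: "e \<in> edges G" "k < clen K' e" "b = fst (cchain K' e ! k)"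
      "j < bound e (Suc k) - bound e k" using slotE s by blast
    show ?thesis
      using range[OF ek(1,2,4)] t[OF ek(1,2)] bound(4)[OF ek(1), of "Suc k"] nth_collapse[OF ek(1,2,4)] ek bj
      by simp
  qed
  have inj: "s = s'" if s: "s \<in> slots H' collapse" and s': "s' \<in> slots H' collapse" and eq: "t s = t s'" for s s'
  proof -
    obtain b j b' j' where bj: "s = (b, j)" "s' = (b', j')" by (cases s; cases s')
    obtain e k where ek: "e \<in> edges G" "k < clen K' e" "b = fst (cchain K' e ! k)"
      "j < bound e (Suc k) - bound e k" using slotE s bj by blast
    obtain e' k' where ek': "e' \<in> edges G" "k' < clen K' e'" "b' = fst (cchain K' e' ! k')"
      "j' < bound e' (Suc k') - bound e' k'" using slotE s' bj by blast
    have ee: "e' = e" using eq t ek ek' bj by simp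
    have kk: "k' < clen K' e" using ek'(2) ee by simp
    have "k = k'"
      by (rule bound_interval_unique[OF ek(1,2) kk, of "snd (t s)"])
        (use range[OF ek(1,2,4)] range[OF ek'(1,2,4)] eq ek(3) ek'(3) bj ee in auto)
    then show ?thesis using eq t ek ek' bj ee by (auto split: if_splits)
  qed
  have sur: "\<exists>s\<in>slots H' collapse. t s = u" if u: "u \<in> slots G K" for u
  proof -
    obtain e i where ei: "u = (e, i)" by (cases u)
    then have e: "e \<in> edges G" and i: "i < clen K e" using u by auto
    obtain k where k: "k < clen K' e" "bound e k \<le> i" "i < bound e (Suc k)"
      using bound_interval[OF e i] .
    define j where "j = (if snd (cchain K' e ! k) then i - bound e k else bound e (Suc k) - Suc i)"
    have "(fst (cchain K' e ! k), j) \<in> slots H' collapse"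
      using dst.slot_arc_in_arcs[OF e k(1)] length_collapse[OF e k(1)] k by (auto simp: j_def)
    moreover have "t (fst (cchain K' e ! k), j) = u"
      using t[OF e k(1)] k ei by (auto simp: j_def)
    ultimately show ?thesis by blast
  qed
  have "bij_betw t (slots H' collapse) (slots G K)"
    unfolding bij_betw_def
  proof
    show "inj_on t (slots H' collapse)" using inj by (rule inj_onI)
    show "t ` slots H' collapse = slots G K" using ins sur by (blast intro: equalityI)
  qed
  then have "bij_betw (slot_arc K \<circ> t) (slots H' collapse) (edges H)"
    using src.bij_slots by (rule bij_betw_trans)
  then show ?thesis
    using ins by (subst bij_betw_cong[of _ _ "slot_arc K \<circ> t"]) auto
qed

lemma chain_system_collapse: "chain_system H H' collapse"
proof (rule chain_systemI)
  fix b assume b: "b \<in> edges H'"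
  obtain e k where ek: "e \<in> edges G" "k < clen K' e" "b = fst (cchain K' e ! k)"
    using b by (rule dst.obtain_slot)
  have lt: "bound e k < bound e (Suc k)" using bound(5)[OF ek(1), of k "Suc k"] ek(2) by simp
  have len: "clen collapse b = bound e (Suc k) - bound e k"
    using length_collapse[OF ek(1,2)] ek(3) by simp
  then show "cchain collapse b \<noteq> []" using lt by auto
  fix j assume j: "j < clen collapse b"
  show "dart_source (gr H) (cchain collapse b ! j) = pos_vertex H collapse (chain_pos H' collapse b j)"
    using dart_ends_collapse(1)[OF ek(1,2)] pos_vertex_collapse[OF ek(1,2)] j len ek(3) by simp
  show "dart_target (gr H) (cchain collapse b ! j) = pos_vertex H collapse (chain_pos H' collapse b (Suc j))"
    using dart_ends_collapse(2)[OF ek(1,2)] pos_vertex_collapse[OF ek(1,2)] j len ek(3) by simp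
next
  have "bij_betw (pos_vertex H K \<circ> join_pos) (positions H' collapse) (vertices H)"
    using bij_join_pos src.bij_positions by (rule bij_betw_trans)
  then show "bij_betw (pos_vertex H collapse) (positions H' collapse) (vertices H)"
    by (subst bij_betw_cong[of _ _ "pos_vertex H K \<circ> join_pos"]) (auto simp: pos_vertex_join)
next
  show "bij_betw (slot_arc collapse) (slots H' collapse) (edges H)" by (rule bij_collapse_slots)
next
  fix b j assume bj: "Inr (b, j) \<in> positions H' collapse"
  have "join_pos (Inr (b, j)) \<in> positions G K" using bij_join_pos bj by (auto dest: bij_betwE)
  then show "wt H (pos_vertex H collapse (Inr (b, j))) = 0"
    using pos_vertex_join[OF bj] src.wt_inner by (simp add: join_pos_def del: Inr_positions_iff)
qed

text \<open>Inner vertices have weight zero, and \<open>cvert K v\<close> lies only in the fibre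
  over \<open>cvert K' v\<close>; so every fibre sum has at most one nonzero term.\<close>

lemma weighted_edge_contraction_realizes:
  assumes f: "realizes G H K H' K' r f" and fin: "finite (vertices H)"
    and wt: "\<And>v. v \<in> vertices G \<Longrightarrow> wt H (cvert K v) = wt H' (cvert K' v)"
  shows "weighted_edge_contraction H H' f"
  unfolding weighted_edge_contraction_def
proof (intro conjI ballI)
  show "edge_contraction (gr H) (gr H') f" using edge_contraction_realizes[OF f r] .
  fix x assume "x \<in> vertices H'"
  then obtain q where q: "q \<in> positions G K'" "x = pos_vertex H' K' q" by (rule dst.obtain_position)
  let ?S = "{w. w \<in> vertices H \<and> vmap f w = x}"
  have S: "wt H w = 0 \<or> (\<exists>v. q = Inl v \<and> w = cvert K v)" if w: "w \<in> ?S" for w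
  proof -
    obtain p where p: "p \<in> positions G K" "w = pos_vertex H K p" using w src.obtain_position by blast
    show ?thesis
    proof (cases p)
      case (Inl v)
      then have "pos_vertex H' K' (Inl v) = pos_vertex H' K' q" "Inl v \<in> positions G K'"
        using vmap_cvert[OF f, of v] p q w by auto
      then have "q = Inl v" using dst.pos_vertex_inj q(1) by metis
      then show ?thesis using p Inl by simp
    next
      case (Inr s)
      then show ?thesis using src.wt_inner p by simp
    qed
  qed
  have finS: "finite ?S" using fin by simp
  show "(\<Sum>w | w \<in> vertices H \<and> vmap f w = x. wt H w) = wt H' x"
  proof (cases q)
    case (Inl v)
    then have v: "v \<in> vertices G" using q by simp
    have vS: "cvert K v \<in> ?S"
      using vmap_cvert[OF f v] src.pos_vertex_in_verts[of "Inl v"] q Inl v by simp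
    have "sum (wt H) ?S = wt H (cvert K v) + sum (wt H) (?S - {cvert K v})"
      using finS vS by (rule sum.remove)
    also have "sum (wt H) (?S - {cvert K v}) = 0"
    proof (rule sum.neutral, rule ballI)
      fix w assume "w \<in> ?S - {cvert K v}"
      then show "wt H w = 0" using S[of w] Inl by auto
    qed
    finally show ?thesis using wt[OF v] q Inl by simp
  next
    case (Inr s)
    have "sum (wt H) ?S = 0"
    proof (rule sum.neutral, rule ballI)
      fix w assume "w \<in> ?S"
      then show "wt H w = 0" using S[of w] Inr by auto
    qed
    then show ?thesis using dst.wt_inner[of s] q Inr by simp
  qed
qed

text \<open>Between two consecutive bounds the step function rises by exactly one, so filtering a
  segment leaves a single dart over \<open>b\<close>; reversing the segment, where necessary, gives
  that dart the orientation of \<open>b\<close>.\<close>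

lemma chain_contraction_collapse:
  assumes f: "realizes G H K H' K' r f" and fin: "finite (vertices H)"
    and wt: "\<And>v. v \<in> vertices G \<Longrightarrow> wt H (cvert K v) = wt H' (cvert K' v)"
  shows "chain_contraction H H' collapse f"
  unfolding chain_contraction_def
proof (intro conjI ballI)
  show "weighted_edge_contraction H H' f" using weighted_edge_contraction_realizes[OF assms] .
  show "chain_system H H' collapse" by (rule chain_system_collapse)
  fix x assume "x \<in> vertices H'"
  then obtain q where q: "q \<in> positions G K'" "x = pos_vertex H' K' q" by (rule dst.obtain_position)
  have "lift_pos q \<in> positions G K \<and> pos_step G K' r (lift_pos q) = q"
  proof (cases q)
    case (Inl v)
    then show ?thesis using q by (simp add: lift_pos_def)
  next
    case (Inr s)
    then obtain e k where s: "q = Inr (e, k)" by (cases s) auto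
    then have e: "e \<in> edges G" and k: "0 < k" "k < clen K' e" using q by auto
    then show ?thesis
      using lift_pos_chain_pos[OF e, of k] src.chain_pos_in[OF e] pos_step_chain_pos[OF r e bound(4)[OF e]]
        bound(3)[OF e, of k] s by simp
  qed
  then have "vmap f (pos_vertex H K (lift_pos q)) = pos_vertex H' K' q"
    using f unfolding realizes_def by metis
  then show "vmap f (cvert collapse x) = x" using q by (simp add: collapse_def)
next
  fix b assume "b \<in> edges H'"
  then obtain e k where ek: "e \<in> edges G" "k < clen K' e" "b = fst (cchain K' e ! k)"
    by (rule dst.obtain_slot)
  let ?xs = "map ((!) (cchain K e)) [bound e k..<bound e (Suc k)]"
  have "List.map_filter (dart_image f) ?xs = map ((!) (cchain K' e)) [r e (bound e k)..<r e (bound e (Suc k))]"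
    using map_filter_segment[OF f r ek(1)] bound(5)[OF ek(1), of k "Suc k"] bound(4)[OF ek(1), of "Suc k"] ek(2)
    by simp
  also have "\<dots> = [cchain K' e ! k]"
    using bound(3)[OF ek(1)] ek(2) by simp
  finally have xs: "List.map_filter (dart_image f) ?xs = [cchain K' e ! k]" .
  have cc: "cchain collapse b = (if snd (cchain K' e ! k) then ?xs else map flip (rev ?xs))"
    using ek by (simp add: collapse_def Let_def)
  show "List.map_filter (dart_image f) (cchain collapse b) = [(b, True)]"
  proof (cases "snd (cchain K' e ! k)")
    case True
    then have "List.map_filter (dart_image f) (cchain collapse b) = [cchain K' e ! k]"
      unfolding cc using xs by simp
    then show ?thesis using True ek(3) by (simp add: prod_eq_iff)
  next
    case False
    have "List.map_filter (dart_image f) (map flip (rev ?xs)) = [flip (cchain K' e ! k)]"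
      unfolding map_filter_flip map_filter_rev xs by simp
    then have "List.map_filter (dart_image f) (cchain collapse b) = [flip (cchain K' e ! k)]"
      unfolding cc using False by simp
    then show ?thesis using False ek(3) by (simp add: flip_def prod_eq_iff)
  qed
qed

end

section \<open>Divisors and morphisms of stable pairs\<close>

abbreviation (input) coeff :: "('p \<Rightarrow>\<^sub>0 int) \<Rightarrow> 'p \<Rightarrow> int" where
  "coeff \<equiv> Poly_Mapping.lookup"

abbreviation (input) support :: "('p \<Rightarrow>\<^sub>0 int) \<Rightarrow> 'p set" where
  "support \<equiv> Poly_Mapping.keys"

lemma coeff_push_div: "coeff (push_div f D) q = (\<Sum>p | p \<in> support D \<and> f p = q. coeff D p)"
proof -
  have "coeff (push_div f D) q = (\<Sum>p\<in>support D. coeff D p * (if q = f p then 1 else 0))"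
    by (simp add: push_div_def frag_extend_def lookup_sum)
  also have "\<dots> = (\<Sum>p\<in>support D. if f p = q then coeff D p else 0)"
    by (intro sum.cong) auto
  also have "\<dots> = (\<Sum>p | p \<in> support D \<and> f p = q. coeff D p)"
    by (simp add: sum.inter_filter)
  finally show ?thesis .
qed

lemma push_div_cong: "(\<And>p. p \<in> support D \<Longrightarrow> f p = g p) \<Longrightarrow> push_div f D = push_div g D"
  unfolding push_div_def by (intro frag_extend_eq) simp

lemma push_div_push_div: "push_div g (push_div f D) = push_div (\<lambda>p. g (f p)) D"
  using frag_extend_compose[of "\<lambda>p. frag_of (g p)" f D] by (simp add: push_div_def comp_def)

lemma push_div_id: "(\<And>p. p \<in> support D \<Longrightarrow> f p = p) \<Longrightarrow> push_div f D = D"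
  using push_div_cong[of D f "\<lambda>p. p"] frag_expansion[of D] by (simp add: push_div_def comp_def)

text \<open>By functoriality the inverse of \<open>f\<close> on \<open>S\<close> yields a left
  inverse of the push-forward.\<close>

lemma push_div_inj:
  assumes "inj_on f S" "support A \<subseteq> S" "support B \<subseteq> S" "push_div f A = push_div f B"
  shows "A = B"
proof -
  have "push_div (inv_into S f) (push_div f C) = C" if "support C \<subseteq> S" for C
    unfolding push_div_push_div using that assms(1) by (intro push_div_id) (auto intro!: inv_into_f_f)
  with assms show ?thesis by metis
qed

text \<open>With the degree seen as push-forward to a point, its invariance becomes a case of
  functoriality.\<close>

lemma div_degree_conv_push_div: "div_degree D = coeff (push_div (\<lambda>_. ()) D) ()"
  by (simp add: coeff_push_div div_degree_def)

lemma div_degree_push_div: "div_degree (push_div f D) = div_degree D"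
  by (simp add: div_degree_conv_push_div push_div_push_div)

text \<open>Effective divisors admit no cancellation. This is what carries the positivity at
  exceptional vertices through contractions and into the divisor on the curve.\<close>

lemma coeff_push_div_pos:
  assumes nn: "\<And>p. 0 \<le> coeff D p" and p: "p \<in> support D"
  shows "0 < coeff (push_div f D) (f p)"
proof -
  have "0 < coeff D p" using nn[of p] p by (simp add: in_keys_iff less_le)
  moreover have "coeff D p \<le> coeff (push_div f D) (f p)"
    unfolding coeff_push_div using p nn by (intro member_le_sum) auto
  ultimately show ?thesis by simp
qed

lemma support_push_div:
  assumes "\<And>p. 0 \<le> coeff D p"
  shows "support (push_div f D) = f ` support D"
proof
  show "support (push_div f D) \<subseteq> f ` support D"
    unfolding push_div_def using keys_frag_extend[of "\<lambda>p. frag_of (f p)" D] by auto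
  show "f ` support D \<subseteq> support (push_div f D)"
  proof (rule image_subsetI)
    fix p assume "p \<in> support D"
    from coeff_push_div_pos[OF assms this, of f] show "f p \<in> support (push_div f D)"
      by (simp add: in_keys_iff)
  qed
qed

lemma effective_divisors_push_div:
  assumes "D \<in> effective_divisors X d" "f ` X \<subseteq> Y"
  shows "push_div f D \<in> effective_divisors Y d"
proof -
  have nn: "\<And>p. 0 \<le> coeff D p" and sub: "support D \<subseteq> X" and deg: "div_degree D = int d"
    using assms(1) by (auto simp: effective_divisors_def)
  have "0 \<le> coeff (push_div f D) q" for q
    unfolding coeff_push_div using nn by (intro sum_nonneg) auto
  then show ?thesis
    using support_push_div[OF nn, of f] sub assms(2) deg
    by (auto simp: effective_divisors_def div_degree_push_div image_subset_iff)
qed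

text \<open>\<open>G\<close> as the trivial subdivision of itself; the contraction of a subdivision
  to \<open>G\<close> thereby becomes a contraction between two subdivisions.\<close>

definition base_chains :: "('v, 'e, 'v, 'e) chains" where
  "base_chains = \<lparr>cvert = (\<lambda>v. v), cchain = (\<lambda>e. [(e, True)])\<rparr>"

lemma chained_base:
  assumes "wf_digraph (gr G)"
  shows "chained G G base_chains"
proof (rule chained.intro)
  show "chain_system G G base_chains"
  proof (rule chain_systemI)
    have "positions G base_chains = Inl ` vertices G"
      by (auto simp: positions_def base_chains_def)
    then show "bij_betw (pos_vertex G base_chains) (positions G base_chains) (vertices G)"
      by (auto simp: bij_betw_def inj_on_def base_chains_def image_iff)
    have "slots G base_chains = edges G \<times> {0}"
      by (auto simp: slots_def base_chains_def)
    then show "bij_betw (slot_arc base_chains) (slots G base_chains) (edges G)"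
      by (force simp: bij_betw_def inj_on_def base_chains_def image_iff)
  qed (auto simp: base_chains_def chain_pos_def dart_ends_True)
qed (use assms in simp_all)

lemma chained_stable_pair:
  assumes "wf_digraph (gr G)" "F \<in> stable_pairs G d"
  shows "chained (sp_graph F) G (sp_chains F)"
proof (rule chained.intro)
  show "wf_digraph (gr (sp_graph F))"
    using assms(2) by (auto simp: stable_pairs_def fin_digraph_def)
  show "chain_system (sp_graph F) G (sp_chains F)"
    using assms(2) by (auto simp: stable_pairs_def chain_contraction_def)
qed (use assms in simp_all)

text \<open>\<open>sp_map\<close> sends the other base vertices elsewhere, so besides
  \<open>cvert (sp_chains F) v\<close> the fibre over \<open>v\<close> holds only inner vertices, of
  weight zero.\<close>

lemma wt_cvert_stable_pair:
  assumes G: "wf_digraph (gr G)" and F: "F \<in> stable_pairs G d" and v: "v \<in> vertices G"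
  shows "wt (sp_graph F) (cvert (sp_chains F) v) = wt G v"
proof -
  let ?H = "sp_graph F" and ?K = "sp_chains F" and ?f = "sp_map F"
  interpret chained ?H G ?K using chained_stable_pair[OF G F] .
  have c: "chain_contraction ?H G ?K ?f" and fin: "fin_digraph (gr ?H)"
    using F by (auto simp: stable_pairs_def)
  have vm: "vmap ?f (cvert ?K u) = u" if "u \<in> vertices G" for u
    using c that by (simp add: chain_contraction_def)
  let ?S = "{w. w \<in> vertices ?H \<and> vmap ?f w = v}"
  have "sum (wt ?H) ?S = wt G v"
    using c v by (simp add: chain_contraction_def weighted_edge_contraction_def)
  moreover have "sum (wt ?H) ?S = wt ?H (cvert ?K v) + sum (wt ?H) (?S - {cvert ?K v})"
  proof (rule sum.remove)
    show "finite ?S" using fin by (simp add: fin_digraph_def fin_digraph_axioms_def)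
    show "cvert ?K v \<in> ?S" using vm[OF v] pos_vertex_in_verts[of "Inl v"] v by simp
  qed
  moreover have "sum (wt ?H) (?S - {cvert ?K v}) = 0"
  proof (rule sum.neutral, rule ballI)
    fix w assume w: "w \<in> ?S - {cvert ?K v}"
    then obtain p where p: "p \<in> positions G ?K" "w = pos_vertex ?H ?K p" using obtain_position by blast
    show "wt ?H w = 0"
    proof (cases p)
      case (Inl u)
      then show ?thesis using p w vm[of u] by auto
    next
      case (Inr s)
      then show ?thesis using p wt_inner by simp
    qed
  qed
  ultimately show ?thesis by simp
qed

text \<open>Only the contraction to \<open>G\<close> has to be found; it is realized as a
  contraction onto the trivial subdivision.\<close>

lemma stable_pairI:
  fixes G :: "('v, 'e) wgraph"
  assumes G: "wf_digraph (gr G)" and H: "fin_digraph (gr H)" and K: "chain_system H G K"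
    and wt: "\<And>v. v \<in> vertices G \<Longrightarrow> wt H (cvert K v) = wt G v"
    and D: "D \<in> effective_divisors (vertices H) d" "\<And>w. w \<in> exceptional H G K \<Longrightarrow> 0 < coeff D w"
  shows "\<exists>\<phi>. \<lparr>sp_graph = H, sp_map = \<phi>, sp_chains = K, sp_div = D\<rparr> \<in> stable_pairs G d"
proof -
  have wfH: "wf_digraph (gr H)" using H by (simp add: fin_digraph_def)
  interpret src: chained H G K using G wfH K by (rule chained.intro)
  interpret dst: chained G G base_chains using chained_base[OF G] .
  interpret chained_pair H G G K base_chains by unfold_locales
  \<comment> \<open>The first edge of each chain survives and the later ones are contracted. Another
    choice would lead to the same morphisms, since \<open>over_base\<close> compares chains and not
    the maps to \<open>G\<close>.\<close>
  define r :: "'e \<Rightarrow> nat \<Rightarrow> nat" where "r e i = min i 1" for e i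
  have r: "step_family r"
    unfolding step_family_def steps_def
  proof (intro ballI conjI allI impI)
    fix e assume "e \<in> edges G"
    from src.chain_nonempty[OF this] show "r e (clen K e) = clen base_chains e"
      by (cases "cchain K e") (auto simp: r_def base_chains_def)
  qed (auto simp: r_def)
  then interpret chain_collapse H G G K base_chains r by unfold_locales
  obtain f where f: "realizes G H K G base_chains r f" using realizes_exists by blast
  have "weighted_edge_contraction H G f"
  proof (rule weighted_edge_contraction_realizes[OF f])
    show "finite (vertices H)" using H by (simp add: fin_digraph_def fin_digraph_axioms_def)
  qed (simp add: wt base_chains_def)
  then have "chain_contraction H G K f"
    unfolding chain_contraction_def
    using K vmap_cvert[OF f] map_filter_chain[OF f r] by (simp add: base_chains_def)
  then show ?thesis using H D by (auto simp: stable_pairs_def)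
qed

text \<open>\<open>r\<close> counts the surviving darts in initial segments. The images of these
  darts are known from the hypothesis on the chains. Those of the vertices follow by walking along
  each chain from its tail: a contracted dart keeps the image, a surviving one moves it along its
  own image.\<close>

lemma realizes_of_over_base:
  assumes pair: "chained_pair H H' G K K'"
    and ec: "edge_contraction (gr H) (gr H') f"
    and cv: "\<And>v. v \<in> vertices G \<Longrightarrow> vmap f (cvert K v) = cvert K' v"
    and mf: "\<And>e. e \<in> edges G \<Longrightarrow> List.map_filter (dart_image f) (cchain K e) = cchain K' e"
  shows "\<exists>r. chained_pair.step_family G K K' r \<and> realizes G H K H' K' r f"
proof -
  interpret chained_pair H H' G K K' by (rule pair)
  define r where "r e j = length (List.map_filter (dart_image f) (take j (cchain K e)))" for e j
  have step: "if dart_image f (cchain K e ! i) = None then r e (Suc i) = r e i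
      else r e (Suc i) = Suc (r e i) \<and> r e i < clen K' e \<and>
        dart_image f (cchain K e ! i) = Some (cchain K' e ! r e i)"
    if e: "e \<in> edges G" and i: "i < clen K e" for e i
  proof (cases "dart_image f (cchain K e ! i)")
    case None
    then show ?thesis using i by (simp add: r_def take_Suc_conv_app_nth map_filter_append map_filter_simps)
  next
    case (Some y)
    \<comment> \<open>Splitting the chain at dart \<open>i\<close> exhibits the image of this dart
      as entry number \<open>r e i\<close> of the filtered chain.\<close>
    have "cchain K e = take i (cchain K e) @ cchain K e ! i # drop (Suc i) (cchain K e)"
      using i by (simp add: id_take_nth_drop)
    then have "cchain K' e = List.map_filter (dart_image f) (take i (cchain K e) @ cchain K e ! i # drop (Suc i) (cchain K e))"
      using mf[OF e] by simp
    also have "\<dots> = List.map_filter (dart_image f) (take i (cchain K e)) @ y #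
        List.map_filter (dart_image f) (drop (Suc i) (cchain K e))"
      using Some by (simp add: map_filter_append map_filter_simps)
    finally have "cchain K' e ! r e i = y" "r e i < clen K' e"
      by (simp_all add: r_def)
    then show ?thesis
      using Some i by (simp add: r_def take_Suc_conv_app_nth map_filter_append map_filter_simps)
  qed
  have r: "step_family r"
    unfolding step_family_def steps_def
  proof (intro ballI conjI allI impI)
    fix e i assume "e \<in> edges G" "i < clen K e"
    then show "r e (Suc i) = r e i \<or> r e (Suc i) = Suc (r e i)" using step[of e i] by (auto split: if_splits)
  qed (auto simp: r_def mf map_filter_simps)
  have inc: "case emap f a of Inl v \<Rightarrow> vmap f (tail (gr H) a) = v \<and> vmap f (head (gr H) a) = v
      | Inr x \<Rightarrow> fst x \<in> edges H' \<and> vmap f (tail (gr H) a) = dart_source (gr H') x \<and>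
                 vmap f (head (gr H) a) = dart_target (gr H') x" if a: "a \<in> edges H" for a
    using ec a by (simp add: edge_contraction_def)
  have dart: "case dart_image f x of
      None \<Rightarrow> emap f (fst x) = Inl (vmap f (dart_source (gr H) x)) \<and> vmap f (dart_target (gr H) x) = vmap f (dart_source (gr H) x)
    | Some y \<Rightarrow> emap f (fst x) = Inr (fst y, snd x = snd y) \<and>
        vmap f (dart_source (gr H) x) = dart_source (gr H') y \<and> vmap f (dart_target (gr H) x) = dart_target (gr H') y"
    if "fst x \<in> edges H" for x
    using inc[OF that] by (auto simp: dart_image_def dart_source_def dart_target_def split: sum.splits)
  have vtx: "vmap f (pos_vertex H K (chain_pos G K e j)) = pos_vertex H' K' (chain_pos G K' e (r e j))"
    if e: "e \<in> edges G" and j: "j \<le> clen K e" for e j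
    using j
  proof (induction j)
    case 0
    have "tail (gr G) e \<in> vertices G" using src.wf_base e by (simp add: wf_digraph_def)
    then show ?case using cv by (simp add: r_def map_filter_simps)
  next
    case (Suc j)
    then have j: "j < clen K e" by simp
    have IH: "vmap f (dart_source (gr H) (cchain K e ! j)) = pos_vertex H' K' (chain_pos G K' e (r e j))"
      using Suc src.dart_source_slot[OF e j] by simp
    have T: "vmap f (pos_vertex H K (chain_pos G K e (Suc j))) = vmap f (dart_target (gr H) (cchain K e ! j))"
      using src.dart_target_slot[OF e j] by simp
    show ?case
    proof (cases "dart_image f (cchain K e ! j)")
      case None
      then show ?thesis using dart[OF src.slot_arc_in_arcs[OF e j]] IH T step[OF e j] by simp
    next
      case (Some y)
      then have "r e (Suc j) = Suc (r e j)" "r e j < clen K' e" "y = cchain K' e ! r e j"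
        using step[OF e j] by auto
      then show ?thesis using dart[OF src.slot_arc_in_arcs[OF e j]] Some T dst.dart_target_slot[OF e, of "r e j"] by simp
    qed
  qed
  have "realizes G H K H' K' r f"
    unfolding realizes_def
  proof (intro conjI ballI allI impI)
    show "vmap f \<in> extensional (vertices H)" "emap f \<in> extensional (edges H)"
      using ec by (auto simp: edge_contraction_def)
  next
    fix p assume p: "p \<in> positions G K"
    show "vmap f (pos_vertex H K p) = pos_vertex H' K' (pos_step G K' r p)"
    proof (cases p)
      case (Inl v)
      then show ?thesis using p cv by simp
    next
      case (Inr s)
      then obtain e i where s: "p = Inr (e, i)" by (cases s) auto
      then show ?thesis using p vtx[of e i] by simp
    qed
  next
    fix e i assume e: "e \<in> edges G" and i: "i < clen K e"
    show "emap f (fst (cchain K e ! i)) = slot_image G K H' K' r e i"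
      using step[OF e i] dart[OF src.slot_arc_in_arcs[OF e i]] src.dart_source_slot[OF e i] vtx[OF e, of i] i
      by (cases "dart_image f (cchain K e ! i)") (auto simp: slot_image_def)
  qed
  with r show ?thesis by blast
qed

section \<open>Morphisms of stable pairs as families of step functions\<close>

locale tropical_model =
  fixes G :: "('v, 'e) wgraph" and d :: nat
  assumes fin_G: "fin_digraph (gr G)"
begin

lemma wf_G: "wf_digraph (gr G)"
  using fin_G by (simp add: fin_digraph_def)

lemma pair_locale:
  assumes "F1 \<in> stable_pairs G d" "F2 \<in> stable_pairs G d"
  shows "chained_pair (sp_graph F1) (sp_graph F2) G (sp_chains F1) (sp_chains F2)"
  using chained_stable_pair[OF wf_G assms(1)] chained_stable_pair[OF wf_G assms(2)]
  by (simp add: chained_pair_def)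

text \<open>\<open>step_family\<close> freed from the locale of one pair of subdivisions, for use
  with three or more stable pairs at once.\<close>

definition step_maps :: "('v, 'e) stable_pair \<Rightarrow> ('v, 'e) stable_pair \<Rightarrow> ('e \<Rightarrow> nat \<Rightarrow> nat) \<Rightarrow> bool" where
  "step_maps F1 F2 r \<longleftrightarrow> (\<forall>e\<in>edges G.
     steps (r e) (clen (sp_chains F1) e) (clen (sp_chains F2) e))"

abbreviation follows :: "('v, 'e) stable_pair \<Rightarrow> ('v, 'e) stable_pair \<Rightarrow> ('e \<Rightarrow> nat \<Rightarrow> nat) \<Rightarrow>
    (nat, nat, nat, nat) gmap \<Rightarrow> bool" where
  "follows F1 F2 \<equiv> realizes G (sp_graph F1) (sp_chains F1) (sp_graph F2) (sp_chains F2)"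

lemma step_maps_iff:
  assumes "F1 \<in> stable_pairs G d" "F2 \<in> stable_pairs G d"
  shows "step_maps F1 F2 r \<longleftrightarrow> chained_pair.step_family G (sp_chains F1) (sp_chains F2) r"
proof -
  interpret chained_pair "sp_graph F1" "sp_graph F2" G "sp_chains F1" "sp_chains F2"
    using pair_locale[OF assms] .
  show ?thesis by (simp add: step_maps_def step_family_def)
qed

text \<open>From left to right the system of chains of the morphism is forgotten. From right to left
  it is supplied by \<open>collapse\<close>; the weights of corresponding base vertices agree
  because both equal the weight in \<open>G\<close>.\<close>

lemma stable_pair_mor_iff:
  assumes F: "F1 \<in> stable_pairs G d" "F2 \<in> stable_pairs G d"
  shows "f \<in> stable_pair_mor G F1 F2 \<longleftrightarrow>
    (\<exists>r. step_maps F1 F2 r \<and> follows F1 F2 r f) \<and> push_div (vmap f) (sp_div F1) = sp_div F2"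
proof
  assume f: "f \<in> stable_pair_mor G F1 F2"
  then obtain L where "chain_contraction (sp_graph F1) (sp_graph F2) L f" and ob: "over_base G F1 F2 f"
    and pd: "push_div (vmap f) (sp_div F1) = sp_div F2"
    by (auto simp: stable_pair_mor_def)
  then have "edge_contraction (gr (sp_graph F1)) (gr (sp_graph F2)) f"
    by (simp add: chain_contraction_def weighted_edge_contraction_def)
  from realizes_of_over_base[OF pair_locale[OF F] this] ob pd
  show "(\<exists>r. step_maps F1 F2 r \<and> follows F1 F2 r f) \<and> push_div (vmap f) (sp_div F1) = sp_div F2"
    unfolding step_maps_iff[OF F] over_base_def by blast
next
  assume "(\<exists>r. step_maps F1 F2 r \<and> follows F1 F2 r f) \<and> push_div (vmap f) (sp_div F1) = sp_div F2"
  then obtain r where r: "step_maps F1 F2 r" and f: "follows F1 F2 r f"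
    and pd: "push_div (vmap f) (sp_div F1) = sp_div F2" by blast
  interpret chained_pair "sp_graph F1" "sp_graph F2" G "sp_chains F1" "sp_chains F2"
    using pair_locale[OF F] .
  have r': "step_family r" using r step_maps_iff[OF F] by simp
  interpret chain_collapse "sp_graph F1" "sp_graph F2" G "sp_chains F1" "sp_chains F2" r
    using r' by unfold_locales
  have "chain_contraction (sp_graph F1) (sp_graph F2) collapse f"
  proof (rule chain_contraction_collapse[OF f])
    show "finite (vertices (sp_graph F1))"
      using F(1) by (simp add: stable_pairs_def fin_digraph_def fin_digraph_axioms_def)
    show "wt (sp_graph F1) (cvert (sp_chains F1) v) = wt (sp_graph F2) (cvert (sp_chains F2) v)"
      if "v \<in> vertices G" for v
      using wt_cvert_stable_pair[OF wf_G F(1) that] wt_cvert_stable_pair[OF wf_G F(2) that] by simp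
  qed
  then show "f \<in> stable_pair_mor G F1 F2"
    using vmap_cvert[OF f] map_filter_chain[OF f r'] pd
    by (auto simp: stable_pair_mor_def over_base_def)
qed

end

section \<open>Face morphisms of polysimplices\<close>

lemma pairing_single [simp]: "pairing {#c#} x = x c"
  by (simp add: pairing_def)

lemma is_pdata_factor:
  assumes "is_pdata P" "(I, a) \<in> P"
  shows "finite I" "I \<noteq> {}" "0 < a" "I \<subseteq> coords P"
  using assms by (auto simp: is_pdata_def coords_def)

lemma is_pdata_disjoint:
  assumes "is_pdata P" "(I, a) \<in> P" "(J, b) \<in> P" "c \<in> I" "c \<in> J"
  shows "I = J \<and> a = b"
proof (rule ccontr)
  assume "\<not> (I = J \<and> a = b)"
  then have "fst (I, a) \<inter> fst (J, b) = {}"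
    using assms(1-3) unfolding is_pdata_def disjoint_family_on_def by (metis prod.inject)
  then show False using assms(4,5) by auto
qed

lemma coordsE:
  assumes "c \<in> coords P"
  obtains I a where "(I, a) \<in> P" "c \<in> I"
  using assms by (force simp: coords_def)

lemma finite_coords: "is_pdata P \<Longrightarrow> finite (coords P)"
  by (auto simp: is_pdata_def coords_def)

lemma polysimplexD:
  assumes "x \<in> polysimplex P"
  shows "0 \<le> x c" "c \<notin> coords P \<Longrightarrow> x c = 0" "(I, a) \<in> P \<Longrightarrow> (\<Sum>c\<in>I. x c) = a"
  using assms by (auto simp: polysimplex_def)

text \<open>The whole mass of each factor is put at the coordinate chosen by \<open>s\<close>. These
  vertices reveal which coordinates can be maximal simultaneously.\<close>

lemma polysimplex_vertex:
  assumes P: "is_pdata P" and s: "\<And>I a. (I, a) \<in> P \<Longrightarrow> s (I, a) \<in> I"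
  shows "\<exists>x\<in>polysimplex P. \<forall>(I, a)\<in>P. x (s (I, a)) = a"
proof -
  define x where "x c = (\<Sum>p\<in>P. if s p = c then snd p else 0)" for c
  have finP: "finite P" using P by (simp add: is_pdata_def)
  have sum: "(\<Sum>p\<in>P. if s p \<in> I then snd p else 0) = a" if I: "(I, a) \<in> P" for I a
  proof -
    have "(\<Sum>p\<in>P. if s p \<in> I then snd p else 0) = (\<Sum>p\<in>P. if p = (I, a) then snd p else 0)"
    proof (rule sum.cong)
      fix p assume p: "p \<in> P"
      obtain J b where Jb: "p = (J, b)" by (cases p)
      have "s p \<in> I \<longleftrightarrow> p = (I, a)"
        using is_pdata_disjoint[OF P I, of J b "s p"] s[of J b] s[OF I] p Jb by auto
      then show "(if s p \<in> I then snd p else 0) = (if p = (I, a) then snd p else 0)" by simp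
    qed simp
    also have "\<dots> = a" using finP I by simp
    finally show ?thesis .
  qed
  have "(\<Sum>c\<in>I. x c) = a" if I: "(I, a) \<in> P" for I a
  proof -
    have "(\<Sum>c\<in>I. x c) = (\<Sum>p\<in>P. \<Sum>c\<in>I. if s p = c then snd p else 0)"
      unfolding x_def by (rule sum.swap)
    also have "\<dots> = (\<Sum>p\<in>P. if s p \<in> I then snd p else 0)"
      using is_pdata_factor(1)[OF P I] by simp
    finally show ?thesis using sum[OF I] by simp
  qed
  moreover have "0 \<le> x c" for c
    unfolding x_def using P by (intro sum_nonneg) (force simp: is_pdata_def)
  moreover have "x c = 0" if "c \<notin> coords P" for c
    unfolding x_def using s is_pdata_factor(4)[OF P] that by (intro sum.neutral) force
  ultimately have "x \<in> polysimplex P" by (auto simp: polysimplex_def)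
  moreover have "x (s (I, a)) = a" if I: "(I, a) \<in> P" for I a
  proof -
    have "x (s (I, a)) = (\<Sum>p\<in>P. if s p \<in> I then snd p else 0)"
      unfolding x_def
    proof (rule sum.cong)
      fix p assume p: "p \<in> P"
      obtain J b where Jb: "p = (J, b)" by (cases p)
      have "p = (I, a)" if "s p \<in> I"
        using is_pdata_disjoint[OF P I, of J b "s p"] s[of J b] p Jb that by auto
      then have "s p \<in> I \<longleftrightarrow> s p = s (I, a)" using s[OF I] by metis
      then show "(if s p = s (I, a) then snd p else 0) = (if s p \<in> I then snd p else 0)" by simp
    qed simp
    then show ?thesis using sum[OF I] by simp
  qed
  ultimately show ?thesis by blast
qed

lemma polysimplex_vertex2:
  assumes P: "is_pdata P" and I: "(I, a) \<in> P" "c \<in> I" and J: "(J, b) \<in> P" "c' \<in> J"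
    and neq: "(I, a) \<noteq> (J, b)"
  obtains x where "x \<in> polysimplex P" "x c = a" "x c' = b"
proof -
  define s where "s p = (if p = (I, a) then c else if p = (J, b) then c' else SOME d. d \<in> fst p)" for p
  have "s (I', a') \<in> I'" if "(I', a') \<in> P" for I' a'
    using is_pdata_factor(2)[OF P that] I J some_in_eq[of I'] by (auto simp: s_def)
  from polysimplex_vertex[OF P this] obtain x where x: "x \<in> polysimplex P" "\<forall>(I, a)\<in>P. x (s (I, a)) = a"
    by blast
  have "s (I, a) = c" "s (J, b) = c'" using neq by (auto simp: s_def)
  then have "x c = a" "x c' = b" using bspec[OF x(2) I(1)] bspec[OF x(2) J(1)] by simp_all
  with x(1) show thesis by (rule that)
qed

lemma polysimplex_vertex1:
  assumes P: "is_pdata P" and I: "(I, a) \<in> P" "c \<in> I"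
  obtains x where "x \<in> polysimplex P" "x c = a"
proof -
  define s where "s p = (if p = (I, a) then c else SOME d. d \<in> fst p)" for p
  have "s (I', a') \<in> I'" if "(I', a') \<in> P" for I' a'
    using is_pdata_factor(2)[OF P that] I some_in_eq[of I'] by (auto simp: s_def)
  from polysimplex_vertex[OF P this] obtain x where x: "x \<in> polysimplex P" "\<forall>(I, a)\<in>P. x (s (I, a)) = a"
    by blast
  have "x c = a" using bspec[OF x(2) I(1)] by (simp add: s_def)
  with x(1) show thesis by (rule that)
qed

lemma polysimplex_coord_le:
  assumes "is_pdata P" "x \<in> polysimplex P" "(I, a) \<in> P" "c \<in> I"
  shows "x c \<le> a"
proof -
  have "x c \<le> (\<Sum>c\<in>I. x c)"
    using assms polysimplexD(1)[OF assms(2)] is_pdata_factor(1) by (intro member_le_sum) auto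
  then show ?thesis using polysimplexD(3)[OF assms(2,3)] by simp
qed

text \<open>Two coordinates lie in different factors iff both can attain their maximum at the same point. Hence
  the set of points determines the factors.\<close>

lemma polysimplex_subset_factor:
  assumes P: "is_pdata P" and Q: "is_pdata Q" and eq: "polysimplex P = polysimplex Q" and I: "(I, a) \<in> P"
  obtains J where "(J, a) \<in> Q" "I \<subseteq> J"
proof -
  have fac: "\<exists>J. (J, b) \<in> Q \<and> c \<in> J" if P: "is_pdata P" and Q: "is_pdata Q"
    and eq: "polysimplex P = polysimplex Q" and I: "(I, b) \<in> P" "c \<in> I" for P Q :: "'a pdata" and I b c
  proof -
    have ex: "\<exists>J b'. (J, b') \<in> Q' \<and> c \<in> J \<and> b \<le> b'" if P: "is_pdata P'" and Q: "is_pdata Q'"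
      and eq: "polysimplex P' = polysimplex Q'" and I: "(I, b) \<in> P'" "c \<in> I"
      for P' Q' :: "'a pdata" and I b
    proof -
      obtain x where x: "x \<in> polysimplex P'" "x c = b" using polysimplex_vertex1[OF P I] .
      then have xQ: "x \<in> polysimplex Q'" "x c \<noteq> 0" using eq is_pdata_factor(3)[OF P I(1)] by auto
      then have "c \<in> coords Q'" using polysimplexD(2)[OF xQ(1)] by blast
      then obtain J b' where J: "(J, b') \<in> Q'" "c \<in> J" by (rule coordsE)
      then show ?thesis using polysimplex_coord_le[OF Q xQ(1) J] x by blast
    qed
    obtain J b' where J: "(J, b') \<in> Q" "c \<in> J" "b \<le> b'" using ex[OF P Q eq I] by blast
    \<comment> \<open>The color of a factor is the maximum of any of its coordinates. Passing to
      \<open>Q\<close> and back to \<open>P\<close> gives \<open>b \<le> b'\<close> and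
      \<open>b' \<le> b''\<close>, and \<open>b'' = b\<close> because \<open>c\<close> lies in only
      one factor of \<open>P\<close>.\<close>
    obtain I' b'' where I': "(I', b'') \<in> P" "c \<in> I'" "b' \<le> b''" using ex[OF Q P eq[symmetric] J(1,2)] by blast
    have "b'' = b" using is_pdata_disjoint[OF P I(1) I'(1) I(2) I'(2)] by simp
    then show ?thesis using J I' by auto
  qed
  obtain c where c: "c \<in> I" using is_pdata_factor(2)[OF P I] by auto
  obtain J where J: "(J, a) \<in> Q" "c \<in> J" using fac[OF P Q eq I c] by blast
  have "I \<subseteq> J"
  proof
    fix c' assume c': "c' \<in> I"
    obtain J' where J': "(J', a) \<in> Q" "c' \<in> J'" using fac[OF P Q eq I c'] by blast
    show "c' \<in> J"
    proof (rule ccontr)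
      assume "c' \<notin> J"
      then have neq: "(J, a) \<noteq> (J', a)" "c \<noteq> c'" using J J' by auto
      obtain y where y: "y \<in> polysimplex Q" "y c = a" "y c' = a"
        using polysimplex_vertex2[OF Q J J' neq(1)] .
      have "(\<Sum>d\<in>{c, c'}. y d) \<le> (\<Sum>d\<in>I. y d)"
        using is_pdata_factor(1)[OF P I] c c' polysimplexD(1)[OF y(1)] by (intro sum_mono2) auto
      also have "\<dots> = a" using polysimplexD(3)[of y P I a] y(1) eq I by simp
      finally show False using y neq(2) is_pdata_factor(3)[OF P I] by simp
    qed
  qed
  with J(1) show thesis by (rule that)
qed

lemma polysimplex_eq_subset:
  assumes P: "is_pdata P" and Q: "is_pdata Q" and eq: "polysimplex P = polysimplex Q"
  shows "P \<subseteq> Q"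
proof
  fix p assume "p \<in> P"
  then obtain I a where I: "p = (I, a)" "(I, a) \<in> P" by (cases p) auto
  obtain J where J: "(J, a) \<in> Q" "I \<subseteq> J" using polysimplex_subset_factor[OF P Q eq I(2)] .
  obtain I' where I': "(I', a) \<in> P" "J \<subseteq> I'" using polysimplex_subset_factor[OF Q P eq[symmetric] J(1)] .
  obtain c where "c \<in> I" using is_pdata_factor(2)[OF P I(2)] by auto
  \<comment> \<open>\<open>I \<subseteq> J\<close> and \<open>J \<subseteq> I'\<close>, where
    \<open>I\<close> and \<open>I'\<close> are both factors of \<open>P\<close>; disjointness of the
    factors collapses these inclusions.\<close>
  then have "I' = I" using is_pdata_disjoint[OF P I'(1) I(2), of c] I'(2) J(2) by auto
  then show "p \<in> Q" using I J I' by auto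
qed

lemma polysimplex_inj: "is_pdata P \<Longrightarrow> is_pdata Q \<Longrightarrow> polysimplex P = polysimplex Q \<Longrightarrow> P = Q"
  using polysimplex_eq_subset by blast

section \<open>Face morphisms given by surviving coordinates and a relabelling\<close>

definition subface :: "'c pdata \<Rightarrow> 'c set \<Rightarrow> ('c \<Rightarrow> 'c) \<Rightarrow> 'c pdata" where
  "subface Q S \<sigma> = (\<lambda>(I, a). (\<sigma> ` (I \<inter> S), a)) ` Q"

definition incl_mor :: "'c pdata \<Rightarrow> 'c pdata \<Rightarrow> 'c set \<Rightarrow> ('c \<Rightarrow> 'c) \<Rightarrow> 'c pmor" where
  "incl_mor P Q S \<sigma> = (\<lambda>x\<in>polysimplex P. \<lambda>c. if c \<in> S then x (\<sigma> c) else 0,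
     \<lambda>N\<in>mon Q. image_mset \<sigma> (filter_mset (\<lambda>c. c \<in> S) N))"

text \<open>\<open>S\<close> consists of the coordinates of \<open>Q\<close> that do not vanish on
  the face, and \<open>\<sigma>\<close> gives their names in \<open>P\<close>; it points from
  \<open>Q\<close> to \<open>P\<close> like the pullback of functions. The last condition says that
  the face is nonempty.\<close>

definition face_data :: "'c pdata \<Rightarrow> 'c pdata \<Rightarrow> 'c set \<Rightarrow> ('c \<Rightarrow> 'c) \<Rightarrow> bool" where
  "face_data P Q S \<sigma> \<longleftrightarrow> is_pdata Q \<and> S \<subseteq> coords Q \<and> inj_on \<sigma> S \<and> P = subface Q S \<sigma> \<and>
     (\<forall>(I, a)\<in>Q. I \<inter> S \<noteq> {})"

lemma face_data_coords: "face_data P Q S \<sigma> \<Longrightarrow> coords P = \<sigma> ` S"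
proof -
  assume *: "face_data P Q S \<sigma>"
  have "coords P = (\<Union>p\<in>Q. \<sigma> ` (fst p \<inter> S))"
    using * by (simp add: face_data_def subface_def coords_def image_image split_beta)
  also have "\<dots> = \<sigma> ` (coords Q \<inter> S)"
    unfolding coords_def by blast
  finally have "coords P = \<sigma> ` (coords Q \<inter> S)" .
  then show ?thesis using * by (auto simp: face_data_def)
qed

lemma face_data_is_pdata:
  assumes "face_data P Q S \<sigma>"
  shows "is_pdata P"
proof -
  have Q: "is_pdata Q" and inj: "inj_on \<sigma> S" and P: "P = subface Q S \<sigma>"
    and ne: "\<And>I a. (I, a) \<in> Q \<Longrightarrow> I \<inter> S \<noteq> {}"
    using assms by (auto simp: face_data_def)
  have "fst p \<inter> fst q = {}" if p: "p \<in> P" and q: "q \<in> P" and pq: "p \<noteq> q" for p q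
  proof -
    obtain I a where I: "(I, a) \<in> Q" "p = (\<sigma> ` (I \<inter> S), a)" using p P by (auto simp: subface_def)
    obtain J b where J: "(J, b) \<in> Q" "q = (\<sigma> ` (J \<inter> S), b)" using q P by (auto simp: subface_def)
    have "I \<inter> J = {}" using is_pdata_disjoint[OF Q I(1) J(1)] pq I J by auto
    then show ?thesis using I J inj by (auto dest: inj_onD)
  qed
  moreover have "finite P" using Q by (simp add: P subface_def is_pdata_def)
  moreover have "finite K \<and> K \<noteq> {} \<and> 0 < a" if K: "(K, a) \<in> P" for K a
  proof -
    obtain I where I: "(I, a) \<in> Q" "K = \<sigma> ` (I \<inter> S)" using K by (auto simp: P subface_def)
    then show ?thesis using is_pdata_factor[OF Q I(1)] ne[OF I(1)] by simp
  qed
  ultimately show ?thesis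
    unfolding is_pdata_def disjoint_family_on_def by fast
qed

lemma incl_mor_point:
  assumes fd: "face_data P Q S \<sigma>" and x: "x \<in> polysimplex P"
  shows "(\<lambda>c. if c \<in> S then x (\<sigma> c) else 0) \<in> polysimplex Q"
proof -
  have Q: "is_pdata Q" and inj: "inj_on \<sigma> S" and P: "P = subface Q S \<sigma>" and S: "S \<subseteq> coords Q"
    using fd by (auto simp: face_data_def)
  have "(\<Sum>c\<in>I. if c \<in> S then x (\<sigma> c) else 0) = a" if I: "(I, a) \<in> Q" for I a
  proof -
    have "(\<Sum>c\<in>I. if c \<in> S then x (\<sigma> c) else 0) = (\<Sum>c\<in>I \<inter> S. x (\<sigma> c))"
      using is_pdata_factor(1)[OF Q I] by (simp add: sum.inter_restrict)
    also have "\<dots> = (\<Sum>c\<in>\<sigma> ` (I \<inter> S). x c)"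
      using inj by (subst sum.reindex) (auto intro: inj_on_subset)
    also have "\<dots> = a"
      using I P by (intro polysimplexD(3)[OF x]) (auto simp: subface_def)
    finally show ?thesis .
  qed
  then show ?thesis using polysimplexD(1)[OF x] S by (auto simp: polysimplex_def)
qed

lemma incl_mor_mon:
  assumes "face_data P Q S \<sigma>"
  shows "image_mset \<sigma> (filter_mset (\<lambda>c. c \<in> S) N) \<in> mon P"
  using face_data_coords[OF assms] by (auto simp: mon_def)

lemma pairing_incl:
  "pairing N (\<lambda>c. if c \<in> S then x (\<sigma> c) else 0) = pairing (image_mset \<sigma> (filter_mset (\<lambda>c. c \<in> S) N)) x"
  by (induction N) (auto simp: pairing_def)

lemma incl_mor_poly_mor:
  assumes fd: "face_data P Q S \<sigma>"
  shows "incl_mor P Q S \<sigma> \<in> poly_mor P Q"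
proof -
  have "continuous_on (polysimplex P) (\<lambda>x c. if c \<in> S then x (\<sigma> c) else (0::real))"
  proof (rule continuous_on_coordinatewise_then_product)
    fix c
    show "continuous_on (polysimplex P) (\<lambda>x. if c \<in> S then x (\<sigma> c) else 0)"
      by (cases "c \<in> S") (auto intro: continuous_on_product_coordinates continuous_on_subset[of UNIV])
  qed
  then have "continuous_on (polysimplex P) (fst (incl_mor P Q S \<sigma>))"
    unfolding incl_mor_def by (simp cong: continuous_on_cong)
  moreover have "M + N \<in> mon Q" if "M \<in> mon Q" "N \<in> mon Q" for M N
    using that by (auto simp: mon_def)
  moreover have "{#} \<in> mon Q" by (simp add: mon_def)
  ultimately show ?thesis
    using incl_mor_point[OF fd] incl_mor_mon[OF fd]
    by (auto simp: poly_mor_def incl_mor_def pairing_incl)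
qed

lemma incl_mor_cong:
  assumes "S = T" "\<And>c. c \<in> S \<Longrightarrow> \<sigma> c = \<tau> c"
  shows "incl_mor P Q S \<sigma> = incl_mor P Q T \<tau>"
proof -
  have "image_mset \<sigma> (filter_mset (\<lambda>c. c \<in> S) N) = image_mset \<tau> (filter_mset (\<lambda>c. c \<in> S) N)" for N
    by (rule image_mset_cong) (use assms in auto)
  moreover have "(\<lambda>c. if c \<in> S then x (\<sigma> c) else 0) = (\<lambda>c. if c \<in> T then x (\<tau> c) else 0)" for x :: "'a \<Rightarrow> real"
    using assms by auto
  ultimately show ?thesis using assms(1) by (simp add: incl_mor_def)
qed

lemma incl_mor_id: "incl_mor P P (coords P) (\<lambda>c. c) = Id all_poly P"
proof -
  have "(\<lambda>c. if c \<in> coords P then x c else 0) = x" if "x \<in> polysimplex P" for x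
    using polysimplexD(2)[OF that] by auto
  moreover have "filter_mset (\<lambda>c. c \<in> coords P) N = N" if "N \<in> mon P" for N
    using that by (subst filter_mset_eq_conv) (auto simp: mon_def)
  ultimately show ?thesis by (auto simp: incl_mor_def all_poly_def fun_eq_iff restrict_def)
qed

lemma face_data_id: "is_pdata P \<Longrightarrow> face_data P P (coords P) (\<lambda>c. c)"
proof -
  assume P: "is_pdata P"
  have "subface P (coords P) (\<lambda>c. c) = P"
  proof -
    have "(\<lambda>(I, a). ((\<lambda>c. c) ` (I \<inter> coords P), a)) ` P = (\<lambda>p. p) ` P"
      using is_pdata_factor(4)[OF P] by (intro image_cong) (auto simp: Int_absorb2)
    then show ?thesis by (simp add: subface_def)
  qed
  moreover have "I \<inter> coords P \<noteq> {}" if "(I, a) \<in> P" for I a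
    using is_pdata_factor(2,4)[OF P that] by (simp add: Int_absorb2)
  ultimately show ?thesis using P by (auto simp: face_data_def)
qed

lemma face_data_comp:
  assumes 1: "face_data P Q S \<sigma>" and 2: "face_data Q R T \<tau>"
  shows "face_data P R {c \<in> T. \<tau> c \<in> S} (\<lambda>c. \<sigma> (\<tau> c))"
proof -
  have img: "\<tau> ` (I \<inter> T) \<inter> S = \<tau> ` (I \<inter> {c \<in> T. \<tau> c \<in> S})" for I by auto
  have Q: "Q = subface R T \<tau>" using 2 by (simp add: face_data_def)
  have "subface (subface R T \<tau>) S \<sigma> = subface R {c \<in> T. \<tau> c \<in> S} (\<lambda>c. \<sigma> (\<tau> c))"
    unfolding subface_def image_image by (intro image_cong) (auto simp: img image_image)
  moreover have "I \<inter> {c \<in> T. \<tau> c \<in> S} \<noteq> {}" if "(I, a) \<in> R" for I a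
  proof -
    have "(\<tau> ` (I \<inter> T), a) \<in> Q" using that by (force simp: Q subface_def)
    then have "\<tau> ` (I \<inter> T) \<inter> S \<noteq> {}" using 1 by (auto simp: face_data_def)
    then show ?thesis unfolding img by auto
  qed
  ultimately show ?thesis using 1 2
    by (auto simp: face_data_def inj_on_def)
qed

lemma incl_mor_comp:
  assumes 1: "face_data P Q S \<sigma>" and 2: "face_data Q R T \<tau>"
  shows "Comp all_poly P Q R (incl_mor Q R T \<tau>) (incl_mor P Q S \<sigma>) =
    incl_mor P R {c \<in> T. \<tau> c \<in> S} (\<lambda>c. \<sigma> (\<tau> c))"
proof -
  have "image_mset \<sigma> (filter_mset (\<lambda>c. c \<in> S) (image_mset \<tau> (filter_mset (\<lambda>c. c \<in> T) N))) =
      image_mset (\<lambda>c. \<sigma> (\<tau> c)) (filter_mset (\<lambda>c. c \<in> T \<and> \<tau> c \<in> S) N)" for N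
    by (induction N) auto
  then show ?thesis
    using incl_mor_point[OF 1] incl_mor_mon[OF 2]
    by (auto simp: all_poly_def incl_mor_def compose_def restrict_def fun_eq_iff)
qed

text \<open>\<open>\<tau>\<close> maps \<open>T\<close> onto all coordinates of \<open>Q\<close>. So
  every coordinate of an image point can be read off at some element of \<open>T\<close>, and every
  multiset over \<open>Q\<close> is the pullback of one over \<open>R\<close>.\<close>

lemma incl_mor_mono:
  assumes fd: "face_data Q R T \<tau>" and c1: "c1 \<in> poly_mor P Q" and c2: "c2 \<in> poly_mor P Q"
    and eq: "Comp all_poly P Q R (incl_mor Q R T \<tau>) c1 = Comp all_poly P Q R (incl_mor Q R T \<tau>) c2"
  shows "c1 = c2"
proof (rule prod_eqI)
  have co: "coords Q = \<tau> ` T" using face_data_coords[OF fd] .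
  have T: "T \<subseteq> coords R" using fd by (simp add: face_data_def)
  have p1: "fst c \<in> polysimplex P \<rightarrow>\<^sub>E polysimplex Q" "snd c \<in> mon Q \<rightarrow>\<^sub>E mon P"
    if "c \<in> poly_mor P Q" for c using that by (auto simp: poly_mor_def)
  have comp: "Comp all_poly P Q R (incl_mor Q R T \<tau>) c =
      (compose (polysimplex P) (fst (incl_mor Q R T \<tau>)) (fst c), compose (mon R) (snd c) (snd (incl_mor Q R T \<tau>)))" for c
    by (simp add: all_poly_def split_beta)
  show "fst c1 = fst c2"
  proof (rule extensionalityI[of _ "polysimplex P"])
    fix x assume x: "x \<in> polysimplex P"
    then have y: "fst c1 x \<in> polysimplex Q" "fst c2 x \<in> polysimplex Q"
      using PiE_mem[OF p1(1)[OF c1]] PiE_mem[OF p1(1)[OF c2]] by auto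
    have "compose (polysimplex P) (fst (incl_mor Q R T \<tau>)) (fst c1) x =
        compose (polysimplex P) (fst (incl_mor Q R T \<tau>)) (fst c2) x"
      using eq unfolding comp by simp
    then have e: "(\<lambda>c. if c \<in> T then fst c1 x (\<tau> c) else 0) = (\<lambda>c. if c \<in> T then fst c2 x (\<tau> c) else 0)"
      using x y by (simp add: compose_def incl_mor_def)
    show "fst c1 x = fst c2 x"
    proof
      fix c show "fst c1 x c = fst c2 x c"
      proof (cases "c \<in> coords Q")
        case True
        then obtain c' where "c' \<in> T" "c = \<tau> c'" using co by auto
        then show ?thesis using fun_cong[OF e, of c'] by simp
      next
        case False
        then show ?thesis using polysimplexD(2)[OF y(1)] polysimplexD(2)[OF y(2)] by simp
      qed
    qed
  qed (use p1(1)[OF c1] p1(1)[OF c2] in \<open>simp_all add: PiE_def\<close>)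
  show "snd c1 = snd c2"
  proof (rule extensionalityI[of _ "mon Q"])
    fix N assume N: "N \<in> mon Q"
    let ?N = "image_mset (inv_into T \<tau>) N"
    have sub: "set_mset N \<subseteq> \<tau> ` T" using N co by (auto simp: mon_def)
    have NT: "set_mset ?N \<subseteq> T" using sub by (auto intro: inv_into_into)
    then have "?N \<in> mon R" using T by (auto simp: mon_def)
    moreover have "image_mset \<tau> (filter_mset (\<lambda>c. c \<in> T) ?N) = N"
    proof -
      have "filter_mset (\<lambda>c. c \<in> T) ?N = ?N" using NT by (subst filter_mset_eq_conv) auto
      moreover have "image_mset \<tau> ?N = image_mset (\<lambda>c. c) N"
        unfolding multiset.map_comp using sub by (intro image_mset_cong) (auto intro: f_inv_into_f)
      ultimately show ?thesis by simp
    qed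
    moreover have "compose (mon R) (snd c1) (snd (incl_mor Q R T \<tau>)) ?N =
        compose (mon R) (snd c2) (snd (incl_mor Q R T \<tau>)) ?N"
      using eq unfolding comp by simp
    ultimately show "snd c1 N = snd c2 N" by (simp add: compose_def incl_mor_def)
  qed (use p1(2)[OF c1] p1(2)[OF c2] in \<open>simp_all add: PiE_def\<close>)
qed

text \<open>Generators are the nonempty multisets that are not sums of two nonempty ones, and
  isomorphisms preserve this property.\<close>

lemma free_monoid_iso_generator:
  assumes f: "\<And>N. N \<in> mon Q \<Longrightarrow> f N \<in> mon Q'"
    and g: "\<And>N. N \<in> mon Q' \<Longrightarrow> g N \<in> mon Q" "g {#} = {#}"
      "\<And>M N. M \<in> mon Q' \<Longrightarrow> N \<in> mon Q' \<Longrightarrow> g (M + N) = g M + g N"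
    and fg: "\<And>N. N \<in> mon Q \<Longrightarrow> g (f N) = N" "\<And>N. N \<in> mon Q' \<Longrightarrow> f (g N) = N" "f {#} = {#}"
    and c: "c \<in> coords Q"
  shows "\<exists>b. b \<in> coords Q' \<and> f {#c#} = {#b#}"
proof -
  have cm: "{#c#} \<in> mon Q" using c by (simp add: mon_def)
  have "f {#c#} \<noteq> {#}" using fg(1)[OF cm] g(2) by auto
  then obtain b B where bB: "f {#c#} = {#b#} + B" by (metis add_mset_add_single multiset_cases union_commute)
  have "f {#c#} \<in> mon Q'" using f cm .
  then have m: "{#b#} \<in> mon Q'" "B \<in> mon Q'" by (auto simp: bB mon_def)
  have "{#c#} = g {#b#} + g B" using fg(1)[OF cm] g(3)[OF m] bB by simp
  then have "g {#b#} = {#} \<or> g B = {#}"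
    by (metis union_is_single)
  moreover have "g {#b#} \<noteq> {#}" using fg(2)[OF m(1)] fg(3) by auto
  ultimately have "B = {#}" using fg(2)[OF m(2)] fg(3) by simp
  then show ?thesis using bB m(1) by (auto simp: mon_def)
qed

lemma free_monoid_iso:
  assumes th: "\<And>N. N \<in> mon R \<Longrightarrow> \<theta> N \<in> mon P" "\<theta> {#} = {#}"
      "\<And>M N. M \<in> mon R \<Longrightarrow> N \<in> mon R \<Longrightarrow> \<theta> (M + N) = \<theta> M + \<theta> N"
    and th': "\<And>N. N \<in> mon P \<Longrightarrow> \<theta>' N \<in> mon R" "\<theta>' {#} = {#}"
      "\<And>M N. M \<in> mon P \<Longrightarrow> N \<in> mon P \<Longrightarrow> \<theta>' (M + N) = \<theta>' M + \<theta>' N"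
    and inv: "\<And>N. N \<in> mon R \<Longrightarrow> \<theta>' (\<theta> N) = N" "\<And>N. N \<in> mon P \<Longrightarrow> \<theta> (\<theta>' N) = N"
  obtains \<sigma> where "bij_betw \<sigma> (coords R) (coords P)" "\<And>N. N \<in> mon R \<Longrightarrow> \<theta> N = image_mset \<sigma> N"
proof -
  have "\<forall>c\<in>coords R. \<exists>b. b \<in> coords P \<and> \<theta> {#c#} = {#b#}"
    by (rule ballI, rule free_monoid_iso_generator[of R \<theta> P \<theta>']) (use th th' inv in auto)
  then obtain \<sigma> where s: "\<And>c. c \<in> coords R \<Longrightarrow> \<sigma> c \<in> coords P \<and> \<theta> {#c#} = {#\<sigma> c#}" by metis
  have "\<forall>c\<in>coords P. \<exists>b. b \<in> coords R \<and> \<theta>' {#c#} = {#b#}"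
    by (rule ballI, rule free_monoid_iso_generator[of P \<theta>' R \<theta>]) (use th th' inv in auto)
  then obtain \<rho> where rho: "\<And>c. c \<in> coords P \<Longrightarrow> \<rho> c \<in> coords R \<and> \<theta>' {#c#} = {#\<rho> c#}" by metis
  have "bij_betw \<sigma> (coords R) (coords P)"
  proof (rule bij_betw_byWitness[of _ \<rho>])
    show "\<forall>c\<in>coords R. \<rho> (\<sigma> c) = c"
    proof
      fix c assume c: "c \<in> coords R"
      have "{#\<rho> (\<sigma> c)#} = \<theta>' (\<theta> {#c#})" using s[OF c] rho[of "\<sigma> c"] by simp
      also have "\<dots> = {#c#}" using c by (intro inv) (simp add: mon_def)
      finally show "\<rho> (\<sigma> c) = c" by simp
    qed
    show "\<forall>c\<in>coords P. \<sigma> (\<rho> c) = c"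
    proof
      fix c assume c: "c \<in> coords P"
      have "{#\<sigma> (\<rho> c)#} = \<theta> (\<theta>' {#c#})" using rho[OF c] s[of "\<rho> c"] by simp
      also have "\<dots> = {#c#}" using c by (intro inv) (simp add: mon_def)
      finally show "\<sigma> (\<rho> c) = c" by simp
    qed
  qed (use s rho in auto)
  moreover have "\<theta> N = image_mset \<sigma> N" if "N \<in> mon R" for N
    using that
  proof (induction N)
    case empty
    then show ?case using th by simp
  next
    case (add c N)
    then have c: "c \<in> coords R" and N: "N \<in> mon R" by (auto simp: mon_def)
    have "\<theta> ({#c#} + N) = \<theta> {#c#} + \<theta> N" using c N by (intro th) (auto simp: mon_def)
    then show ?case using add.IH[OF N] s[OF c] by simp
  qed
  ultimately show thesis by (rule that)
qed

lemma coords_face: "coords (face Q M) = coords Q - set_mset M"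
  by (auto simp: coords_def face_def)

text \<open>The morphism factors through \<open>R\<close>, the face with its inherited labels, cut
  out by the sum \<open>M\<close> of the discarded coordinates. What remains is the relabelling
  \<open>\<sigma>\<close>, an isomorphism with inverse given by
  \<open>inv_into S \<sigma>\<close>.\<close>

lemma face_mor_of_face_data:
  assumes fd: "face_data P Q S \<sigma>"
  shows "incl_mor P Q S \<sigma> \<in> face_mor P Q"
proof -
  have Q: "is_pdata Q" and S: "S \<subseteq> coords Q" and inj: "inj_on \<sigma> S" and P: "P = subface Q S \<sigma>"
    and ne: "\<And>I a. (I, a) \<in> Q \<Longrightarrow> I \<inter> S \<noteq> {}"
    using fd by (auto simp: face_data_def)
  have co: "coords P = \<sigma> ` S" using face_data_coords[OF fd] .
  define M where "M = mset_set (coords Q - S)"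
  have M: "set_mset M = coords Q - S" using finite_coords[OF Q] by (simp add: M_def)
  define R where "R = subface Q S (\<lambda>c. c)"
  have fR: "face Q M = R"
    unfolding face_def R_def subface_def
  proof (rule image_cong)
    fix p assume p: "p \<in> Q"
    obtain I a where Ia: "p = (I, a)" by (cases p)
    have "I - set_mset M = I \<inter> S" using is_pdata_factor(4)[OF Q, of I a] p Ia by (auto simp: M)
    then show "(case p of (I, a) \<Rightarrow> (I - set_mset M, a)) = (case p of (I, a) \<Rightarrow> ((\<lambda>c. c) ` (I \<inter> S), a))"
      by (simp add: Ia)
  qed simp
  have fdR: "face_data R Q S (\<lambda>c. c)" using fd by (auto simp: face_data_def R_def)
  have coR: "coords R = S" using face_data_coords[OF fdR] by simp
  have RP: "is_pdata R" using face_data_is_pdata[OF fdR] .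
  have "P = subface R S \<sigma>"
    unfolding P R_def subface_def image_image by (intro image_cong) (auto simp: Int_assoc)
  moreover have "I \<inter> S \<noteq> {}" if "(I, a) \<in> R" for I a
    using that ne by (auto simp: R_def subface_def Int_assoc)
  ultimately have fd1: "face_data P R S \<sigma>"
    using RP coR inj by (auto simp: face_data_def)
  let ?\<rho> = "inv_into S \<sigma>"
  have fd2: "face_data R P (\<sigma> ` S) ?\<rho>"
  proof -
    have inv: "?\<rho> ` (\<sigma> ` (I \<inter> S) \<inter> \<sigma> ` S) = I \<inter> S" for I
    proof -
      have "\<sigma> ` (I \<inter> S) \<inter> \<sigma> ` S = \<sigma> ` (I \<inter> S)" by auto
      moreover have "?\<rho> ` \<sigma> ` (I \<inter> S) = (\<lambda>c. c) ` (I \<inter> S)"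
        unfolding image_image using inj by (intro image_cong) auto
      ultimately show ?thesis by simp
    qed
    have "subface P (\<sigma> ` S) ?\<rho> = (\<lambda>(I, a). (?\<rho> ` (\<sigma> ` (I \<inter> S) \<inter> \<sigma> ` S), a)) ` Q"
      by (simp add: P subface_def image_image split_beta)
    then have "R = subface P (\<sigma> ` S) ?\<rho>"
      unfolding inv by (simp add: R_def subface_def)
    moreover have "I \<inter> \<sigma> ` S \<noteq> {}" if Ia: "(I, a) \<in> P" for I a
    proof -
      obtain J where "(J, a) \<in> Q" "I = \<sigma> ` (J \<inter> S)" using Ia by (auto simp: P subface_def)
      then show ?thesis using ne[of J a] by auto
    qed
    ultimately show ?thesis
      using face_data_is_pdata[OF fd] co by (auto simp: face_data_def inj_on_inv_into)
  qed
  have "Comp all_poly P R P (incl_mor R P (\<sigma> ` S) ?\<rho>) (incl_mor P R S \<sigma>) = Id all_poly P"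
    unfolding incl_mor_comp[OF fd1 fd2] incl_mor_id[symmetric]
    by (rule incl_mor_cong) (auto simp: co inv_into_into f_inv_into_f inj)
  moreover have "Comp all_poly R P R (incl_mor P R S \<sigma>) (incl_mor R P (\<sigma> ` S) ?\<rho>) = Id all_poly R"
    unfolding incl_mor_comp[OF fd2 fd1] incl_mor_id[symmetric]
    by (rule incl_mor_cong) (auto simp: coR inj)
  ultimately have "iso_in all_poly P R (incl_mor P R S \<sigma>)"
    unfolding iso_in_def using incl_mor_poly_mor[OF fd1] incl_mor_poly_mor[OF fd2]
    by (auto simp: all_poly_def)
  moreover have "face_incl Q M = incl_mor R Q S (\<lambda>c. c)"
  proof -
    have "(\<lambda>c. if c \<in> S then x c else 0) = x" if "x \<in> polysimplex R" for x
      using polysimplexD(2)[OF that] coR by auto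
    moreover have "filter_mset (\<lambda>c. c \<notin># M) N = filter_mset (\<lambda>c. c \<in> S) N" if "N \<in> mon Q" for N
      using that S by (intro filter_mset_cong) (auto simp: mon_def M)
    ultimately show ?thesis
      by (auto simp: face_incl_def fR incl_mor_def restrict_def fun_eq_iff)
  qed
  then have "Comp all_poly P R Q (face_incl Q M) (incl_mor P R S \<sigma>) = incl_mor P Q S \<sigma>"
    by (simp add: incl_mor_comp[OF fd1 fdR])
  moreover have "M \<in> mon Q" by (auto simp: mon_def M)
  ultimately show ?thesis
    unfolding face_mor_def using incl_mor_poly_mor[OF fd] RP unfolding fR[symmetric]
    by (intro CollectI conjI bexI[of _ M] exI[of _ "incl_mor P (face Q M) S \<sigma>"]) simp_all
qed

text \<open>The monoid half of the isomorphism onto the face is a bijection of generators, which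
  supplies \<open>\<sigma>\<close>. It does not tell how \<open>P\<close> groups its coordinates
  into factors; that is recovered from the set of points by \<open>polysimplex_inj\<close>.\<close>

lemma face_data_of_face_mor:
  assumes P: "is_pdata P" and Q: "is_pdata Q" and k: "k \<in> face_mor P Q"
  shows "\<exists>S \<sigma>. face_data P Q S \<sigma> \<and> k = incl_mor P Q S \<sigma>"
proof -
  obtain M g where M: "M \<in> mon Q" and R: "is_pdata (face Q M)" and g: "iso_in all_poly P (face Q M) g"
    and kg: "k = Comp all_poly P (face Q M) Q (face_incl Q M) g"
    using k by (auto simp: face_mor_def)
  define R where "R = face Q M"
  have g1: "g \<in> poly_mor P R" using g by (simp add: iso_in_def all_poly_def R_def)
  obtain g' where g2: "g' \<in> poly_mor R P" and gg: "Comp all_poly P R P g' g = Id all_poly P"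
    "Comp all_poly R P R g g' = Id all_poly R"
    using g by (auto simp: iso_in_def all_poly_def R_def)
  have comp: "Comp all_poly A B C u v = (compose (polysimplex A) (fst u) (fst v), compose (mon C) (snd v) (snd u))"
    for A B C :: "'a pdata" and u v by (simp add: all_poly_def split_beta)
  have cg: "compose (polysimplex P) (fst g') (fst g) = (\<lambda>x\<in>polysimplex P. x)"
    "compose (mon P) (snd g) (snd g') = (\<lambda>N\<in>mon P. N)"
    "compose (polysimplex R) (fst g) (fst g') = (\<lambda>x\<in>polysimplex R. x)"
    "compose (mon R) (snd g') (snd g) = (\<lambda>N\<in>mon R. N)"
    using gg unfolding comp by (simp_all add: all_poly_def)
  have inv': "fst g (fst g' x) = x" if "x \<in> polysimplex R" for x
    using fun_cong[OF cg(3), of x] that by (simp add: compose_def)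
  have minv: "snd g (snd g' N) = N" if "N \<in> mon P" for N
    using fun_cong[OF cg(2), of N] that by (simp add: compose_def)
  have minv': "snd g' (snd g N) = N" if "N \<in> mon R" for N
    using fun_cong[OF cg(4), of N] that by (simp add: compose_def)
  have m: "fst g x \<in> polysimplex R" if "x \<in> polysimplex P" for x
    using g1 that by (cases g) (auto simp: poly_mor_def)
  have m': "fst g' x \<in> polysimplex P" if "x \<in> polysimplex R" for x
    using g2 that by (cases g') (auto simp: poly_mor_def)
  have th: "\<And>N. N \<in> mon R \<Longrightarrow> snd g N \<in> mon P" "snd g {#} = {#}"
    "\<And>M N. M \<in> mon R \<Longrightarrow> N \<in> mon R \<Longrightarrow> snd g (M + N) = snd g M + snd g N"
    "\<And>M x. M \<in> mon R \<Longrightarrow> x \<in> polysimplex P \<Longrightarrow> pairing M (fst g x) = pairing (snd g M) x"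
    using g1 by (cases g; auto simp: poly_mor_def)+
  have th': "\<And>N. N \<in> mon P \<Longrightarrow> snd g' N \<in> mon R" "snd g' {#} = {#}"
    "\<And>M N. M \<in> mon P \<Longrightarrow> N \<in> mon P \<Longrightarrow> snd g' (M + N) = snd g' M + snd g' N"
    using g2 by (cases g'; auto simp: poly_mor_def)+
  obtain \<sigma> where s: "bij_betw \<sigma> (coords R) (coords P)" and sn: "\<And>N. N \<in> mon R \<Longrightarrow> snd g N = image_mset \<sigma> N"
    using free_monoid_iso[of R "snd g" P "snd g'", OF th(1-3) th' minv' minv] by blast
  define S where "S = coords R"
  have S: "S = coords Q - set_mset M" by (simp add: S_def R_def coords_face)
  \<comment> \<open>On single generators the compatibility of points and monoids turns
    \<open>\<sigma>\<close> into a description of \<open>g\<close> on points.\<close>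
  have gx: "fst g x c = x (\<sigma> c)" if "x \<in> polysimplex P" "c \<in> S" for x c
  proof -
    have cm: "{#c#} \<in> mon R" using that(2) by (simp add: mon_def S_def)
    show ?thesis using th(4)[OF cm that(1)] sn[OF cm] by simp
  qed
  have ne: "I \<inter> S \<noteq> {}" if "(I, a) \<in> Q" for I a
  proof -
    have "(I - set_mset M, a) \<in> R" using that by (force simp: R_def face_def)
    then have "I - set_mset M \<noteq> {}" using is_pdata_factor(2) R by (auto simp: R_def)
    then show ?thesis using is_pdata_factor(4)[OF Q that] by (auto simp: S)
  qed
  have inj: "inj_on \<sigma> S" and im: "\<sigma> ` S = coords P" using s by (auto simp: bij_betw_def S_def)
  have fd': "face_data (subface Q S \<sigma>) Q S \<sigma>"
    using Q S inj ne by (auto simp: face_data_def)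
  define P' where "P' = subface Q S \<sigma>"
  have RI: "(I - set_mset M, a) \<in> R" if "(I, a) \<in> Q" for I a
    using that by (force simp: R_def face_def)
  have "polysimplex P = polysimplex P'"
  proof
    show "polysimplex P \<subseteq> polysimplex P'"
    proof
      fix x assume x: "x \<in> polysimplex P"
      have "(\<Sum>c\<in>J. x c) = a" if J: "(J, a) \<in> P'" for J a
      proof -
        obtain I where I: "(I, a) \<in> Q" "J = \<sigma> ` (I \<inter> S)" using J by (auto simp: P'_def subface_def)
        have "(\<Sum>c\<in>J. x c) = (\<Sum>c\<in>I \<inter> S. x (\<sigma> c))"
          unfolding I(2) using inj by (subst sum.reindex) (auto intro: inj_on_subset)
        also have "\<dots> = (\<Sum>c\<in>I \<inter> S. fst g x c)" using gx[OF x] by (intro sum.cong) auto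
        also have "I \<inter> S = I - set_mset M" using is_pdata_factor(4)[OF Q I(1)] by (auto simp: S)
        also have "(\<Sum>c\<in>I - set_mset M. fst g x c) = a" using polysimplexD(3)[OF m[OF x] RI[OF I(1)]] .
        finally show ?thesis .
      qed
      moreover have "coords P' = coords P" using face_data_coords[OF fd'] im by (simp add: P'_def)
      ultimately show "x \<in> polysimplex P'"
        using polysimplexD(1,2)[OF x] by (auto simp: polysimplex_def)
    qed
    show "polysimplex P' \<subseteq> polysimplex P"
    proof
      fix x assume x: "x \<in> polysimplex P'"
      \<comment> \<open>The point of the face with the coordinates of \<open>x\<close> under the
        relabelling. Its image under \<open>g'\<close> lies in \<open>P\<close> and has the same
        coordinates as \<open>x\<close>.\<close>
      define y where "y c = (if c \<in> S then x (\<sigma> c) else 0)" for c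
      have yQ: "y \<in> polysimplex Q" using incl_mor_point[OF fd' x[unfolded P'_def]] by (simp add: y_def[abs_def])
      have "\<forall>c\<in>#M. y c = 0" by (auto simp: y_def S)
      then have "pairing M y = 0" by (auto simp: pairing_def intro!: sum_mset.neutral)
      then have y: "y \<in> polysimplex R" unfolding R_def polysimplex_face[OF Q M] using yQ by simp
      have z: "fst g' y \<in> polysimplex P" using m'[OF y] .
      have "fst g' y = x"
      proof
        fix c show "fst g' y c = x c"
        proof (cases "c \<in> coords P")
          case True
          then obtain c' where c': "c' \<in> S" "c = \<sigma> c'" using im by auto
          then have "fst g' y c = fst g (fst g' y) c'" using gx[OF z] by simp
          also have "\<dots> = y c'" using inv'[OF y] by simp
          finally show ?thesis using c' by (simp add: y_def)
        next
          case False
          moreover have "coords P' = coords P" using face_data_coords[OF fd'] im by (simp add: P'_def)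
          ultimately show ?thesis using polysimplexD(2)[OF z] polysimplexD(2)[OF x] by simp
        qed
      qed
      then show "x \<in> polysimplex P" using z by simp
    qed
  qed
  then have PP: "P = P'"
    using polysimplex_inj[OF P] face_data_is_pdata[OF fd'] by (simp add: P'_def)
  have "k = incl_mor P Q S \<sigma>"
  proof (rule prod_eqI)
    have "fst g x = (\<lambda>c. if c \<in> S then x (\<sigma> c) else 0)" if x: "x \<in> polysimplex P" for x
      using gx[OF x] polysimplexD(2)[OF m[OF x]] by (auto simp: S_def)
    then show "fst k = fst (incl_mor P Q S \<sigma>)"
      unfolding kg comp using m by (auto simp: face_incl_def incl_mor_def compose_def restrict_def fun_eq_iff R_def)
    have "snd g (filter_mset (\<lambda>c. c \<notin># M) N) = image_mset \<sigma> (filter_mset (\<lambda>c. c \<in> S) N)" if N: "N \<in> mon Q" for N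
    proof -
      have "filter_mset (\<lambda>c. c \<notin># M) N = filter_mset (\<lambda>c. c \<in> S) N"
        using N S by (intro filter_mset_cong) (auto simp: mon_def)
      moreover have "filter_mset (\<lambda>c. c \<in> S) N \<in> mon R" by (auto simp: mon_def S_def)
      ultimately show ?thesis using sn by simp
    qed
    then show "snd k = snd (incl_mor P Q S \<sigma>)"
      unfolding kg comp by (auto simp: face_incl_def incl_mor_def compose_def restrict_def fun_eq_iff)
  qed
  then show ?thesis using fd' PP P'_def by blast
qed

lemma face_morE:
  assumes "k \<in> face_mor P Q" "P \<in> {P. is_pdata P}" "Q \<in> {P. is_pdata P}"
  obtains S \<sigma> where "face_data P Q S \<sigma>" "k = incl_mor P Q S \<sigma>"
  using face_data_of_face_mor[of P Q k] assms by auto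

lemma cPoly_simps:
  "Ob cPoly = {P. is_pdata P}" "Hom cPoly = face_mor" "Id cPoly = Id all_poly" "Comp cPoly = Comp all_poly"
  by (simp_all add: cPoly_def all_poly_def)

lemma category_cPoly: "category (cPoly :: ('c pdata, 'c pmor) cat)"
  unfolding category_def cPoly_simps mem_Collect_eq
proof (intro conjI ballI)
  fix P :: "'c pdata" assume "P \<in> {P. is_pdata P}"
  then have P: "is_pdata P" by simp
  show "Id all_poly P \<in> face_mor P P"
    using face_mor_of_face_data[OF face_data_id[OF P]] by (simp add: incl_mor_id)
next
  fix P Q R :: "'c pdata" and f g
  assume *: "P \<in> {P. is_pdata P}" "Q \<in> {P. is_pdata P}" "R \<in> {P. is_pdata P}" "f \<in> face_mor P Q" "g \<in> face_mor Q R"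
  obtain S \<sigma> where f: "face_data P Q S \<sigma>" "f = incl_mor P Q S \<sigma>" using *(4,1,2) by (rule face_morE)
  obtain T \<tau> where g: "face_data Q R T \<tau>" "g = incl_mor Q R T \<tau>" using *(5,2,3) by (rule face_morE)
  show "Comp all_poly P Q R g f \<in> face_mor P R"
    unfolding f(2) g(2) incl_mor_comp[OF f(1) g(1)] by (rule face_mor_of_face_data[OF face_data_comp[OF f(1) g(1)]])
next
  fix P Q :: "'c pdata" and f
  assume *: "P \<in> {P. is_pdata P}" "Q \<in> {P. is_pdata P}" "f \<in> face_mor P Q"
  obtain S \<sigma> where f: "face_data P Q S \<sigma>" "f = incl_mor P Q S \<sigma>" using *(3,1,2) by (rule face_morE)
  have co: "coords P = \<sigma> ` S" "S \<subseteq> coords Q" using face_data_coords[OF f(1)] f(1) by (auto simp: face_data_def)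
  have id: "face_data P P (coords P) (\<lambda>c. c)" "face_data Q Q (coords Q) (\<lambda>c. c)" using face_data_id * by auto
  show "Comp all_poly P P Q f (Id all_poly P) = f"
    unfolding f(2) incl_mor_id[symmetric] incl_mor_comp[OF id(1) f(1)]
    by (rule incl_mor_cong) (use co in auto)
  show "Comp all_poly P Q Q (Id all_poly Q) f = f"
    unfolding f(2) incl_mor_id[symmetric] incl_mor_comp[OF f(1) id(2)]
    by (rule incl_mor_cong) (use co in auto)
next
  fix O' P Q R :: "'c pdata" and f g k
  assume *: "O' \<in> {P. is_pdata P}" "P \<in> {P. is_pdata P}" "Q \<in> {P. is_pdata P}" "R \<in> {P. is_pdata P}"
    "f \<in> face_mor O' P" "g \<in> face_mor P Q" "k \<in> face_mor Q R"
  obtain S \<sigma> where f: "face_data O' P S \<sigma>" "f = incl_mor O' P S \<sigma>" using *(5,1,2) by (rule face_morE)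
  obtain T \<tau> where g: "face_data P Q T \<tau>" "g = incl_mor P Q T \<tau>" using *(6,2,3) by (rule face_morE)
  obtain U \<upsilon> where k: "face_data Q R U \<upsilon>" "k = incl_mor Q R U \<upsilon>" using *(7,3,4) by (rule face_morE)
  show "Comp all_poly O' Q R k (Comp all_poly O' P Q g f) = Comp all_poly O' P R (Comp all_poly P Q R k g) f"
    unfolding f(2) g(2) k(2) incl_mor_comp[OF f(1) g(1)] incl_mor_comp[OF g(1) k(1)]
      incl_mor_comp[OF face_data_comp[OF f(1) g(1)] k(1)] incl_mor_comp[OF f(1) face_data_comp[OF g(1) k(1)]]
    by (rule incl_mor_cong) auto
qed

section \<open>The functor\<close>

lemma category_op_cat:
  assumes "category C"
  shows "category (op_cat C)"
  using assms unfolding category_def op_cat_def by simp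

text \<open>A climb from 0 to \<open>n\<close> in \<open>n\<close> steps of height at most one has
  no room for a flat step.\<close>

lemma steps_refl_eq:
  assumes "steps r n n" "i \<le> n"
  shows "r i = i"
proof -
  have le: "r i \<le> i" if "i \<le> n" for i
    using that
  proof (induction i)
    case (Suc i)
    then have "r (Suc i) = r i \<or> r (Suc i) = Suc (r i)" using assms(1) by (simp add: steps_def)
    then show ?case using Suc by auto
  qed (use assms in \<open>simp add: steps_def\<close>)
  have "r (i + k) \<le> r i + k" if "i + k \<le> n" for k
    using that
  proof (induction k)
    case (Suc k)
    then have "r (Suc (i + k)) = r (i + k) \<or> r (Suc (i + k)) = Suc (r (i + k))"
      using assms(1) by (simp add: steps_def)
    then show ?case using Suc by auto
  qed simp
  from this[of "n - i"] have "n \<le> r i + (n - i)" using assms by (simp add: steps_def)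
  then show ?thesis using le[OF assms(2)] assms(2) by simp
qed

lemma steps_unique:
  assumes r: "steps r n m" and q: "steps q n m'" and eq: "\<And>i. i < n \<Longrightarrow> r (Suc i) = r i \<longleftrightarrow> q (Suc i) = q i"
    and "i \<le> n"
  shows "r i = q i"
  using \<open>i \<le> n\<close>
proof (induction i)
  case (Suc i)
  then have i: "i < n" by simp
  have "r (Suc i) = r i \<or> r (Suc i) = Suc (r i)" "q (Suc i) = q i \<or> q (Suc i) = Suc (q i)"
    using r q i unfolding steps_def by blast+
  then show ?case using Suc eq[OF i] by auto
qed (use r q in \<open>simp add: steps_def\<close>)

lemma contracted_gmap_comp:
  "a \<in> arcs H \<Longrightarrow> contracted (gmap_comp H g f) a \<longleftrightarrow> contracted f a \<or> contracted g (edge_image f a)"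
  by (auto simp: gmap_comp_def contracted_def edge_image_def split: sum.split)

lemma edge_image_gmap_comp:
  "a \<in> arcs H \<Longrightarrow> \<not> contracted f a \<Longrightarrow> \<not> contracted g (edge_image f a) \<Longrightarrow>
    edge_image (gmap_comp H g f) a = edge_image g (edge_image f a)"
  by (auto simp: gmap_comp_def contracted_def edge_image_def split: sum.split)

lemma realizes_gmap_id:
  assumes "chained H G K"
  shows "realizes G H K H K (\<lambda>e i. i) (gmap_id (gr H))"
proof -
  interpret chained H G K by (rule assms)
  have "pos_step G K (\<lambda>e i. i) p = p" if "p \<in> positions G K" for p
    using that by (auto simp: positions_def)
  then show ?thesis
    using pos_vertex_in_verts slot_arc_in_arcs by (simp add: realizes_def slot_image_def gmap_id_def)
qed

text \<open>Together with the uniqueness of the realized map, this turns the category laws into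
  identities between functions on natural numbers.\<close>

lemma realizes_gmap_comp:
  assumes p12: "chained_pair H1 H2 G K1 K2" and p23: "chained_pair H2 H3 G K2 K3"
    and r: "chained_pair.step_family G K1 K2 r" and q: "chained_pair.step_family G K2 K3 q"
    and f: "realizes G H1 K1 H2 K2 r f" and g: "realizes G H2 K2 H3 K3 q g"
  shows "realizes G H1 K1 H3 K3 (\<lambda>e i. q e (r e i)) (gmap_comp (gr H1) g f)"
proof -
  interpret A: chained_pair H1 H2 G K1 K2 by (rule p12)
  interpret B: chained_pair H2 H3 G K2 K3 by (rule p23)
  show ?thesis
    unfolding realizes_def
  proof (intro conjI ballI allI impI)
    show "vmap (gmap_comp (gr H1) g f) \<in> extensional (vertices H1)"
      "emap (gmap_comp (gr H1) g f) \<in> extensional (edges H1)"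
      by (simp_all add: gmap_comp_def compose_def)
  next
    fix p assume p: "p \<in> positions G K1"
    have "vmap g (vmap f (pos_vertex H1 K1 p)) = pos_vertex H3 K3 (pos_step G K3 q (pos_step G K2 r p))"
      using f g p A.pos_step_in by (simp add: realizes_def)
    also have "pos_step G K3 q (pos_step G K2 r p) = pos_step G K3 (\<lambda>e i. q e (r e i)) p"
    proof (cases p)
      case (Inr s)
      then obtain e i where s: "p = Inr (e, i)" by (cases s) auto
      then have e: "e \<in> edges G" and i: "i \<le> clen K1 e" using p by auto
      show ?thesis
        using B.pos_step_chain_pos[OF q e steps_le[OF A.step_familyD[OF r e] i]] by (simp add: s)
    qed simp
    finally show "vmap (gmap_comp (gr H1) g f) (pos_vertex H1 K1 p) = pos_vertex H3 K3 (pos_step G K3 (\<lambda>e i. q e (r e i)) p)"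
      using A.src.pos_vertex_in_verts[OF p] by (simp add: gmap_comp_def compose_def)
  next
    fix e i assume e: "e \<in> edges G" and i: "i < clen K1 e"
    have st: "steps (r e) (clen K1 e) (clen K2 e)" using A.step_familyD[OF r e] .
    have ef: "emap f (fst (cchain K1 e ! i)) = slot_image G K1 H2 K2 r e i"
      using f e i unfolding realizes_def by blast
    have a: "fst (cchain K1 e ! i) \<in> edges H1" using A.src.slot_arc_in_arcs[OF e i] .
    show "emap (gmap_comp (gr H1) g f) (fst (cchain K1 e ! i)) = slot_image G K1 H3 K3 (\<lambda>e i. q e (r e i)) e i"
    proof (cases "r e (Suc i) = r e i")
      case True
      have "vmap g (pos_vertex H2 K2 (chain_pos G K2 e (r e i))) = pos_vertex H3 K3 (chain_pos G K3 e (q e (r e i)))"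
        using B.vmap_chain_pos[OF g q e] steps_le[OF st] i by simp
      then show ?thesis using True ef a by (simp add: gmap_comp_def slot_image_def)
    next
      case False
      have lt: "r e i < clen K2 e" and S: "r e (Suc i) = Suc (r e i)"
        using steps_less[OF st i False] by auto
      have eg: "emap g (fst (cchain K2 e ! r e i)) = slot_image G K2 H3 K3 q e (r e i)"
        using g e lt unfolding realizes_def by blast
      show ?thesis using False ef eg S a by (auto simp: gmap_comp_def slot_image_def)
    qed
  qed
qed

section \<open>The category of stable pairs and its functor to polysimplices\<close>

locale metric_model = tropical_model G d for G :: "('v, 'e) wgraph" and d :: nat +
  fixes len :: "'e \<Rightarrow> real"
  assumes len_pos: "e \<in> edges G \<Longrightarrow> 0 < len e"
begin

abbreviation \<Delta> :: "('v, 'e) stable_pair \<Rightarrow> nat pdata" where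
  "\<Delta> \<equiv> sigma_ob (gr G) len"

abbreviation \<Delta>_mor :: "('v, 'e) stable_pair \<Rightarrow> ('v, 'e) stable_pair \<Rightarrow> (nat, nat, nat, nat) gmap \<Rightarrow> nat pmor" where
  "\<Delta>_mor \<equiv> sigma_mor (gr G) len"

abbreviation stable :: "('v, 'e) stable_pair set" where
  "stable \<equiv> stable_pairs G d"

lemma stable_chained: "F \<in> stable \<Longrightarrow> chained (sp_graph F) G (sp_chains F)"
  using chained_stable_pair[OF wf_G] .

lemma support_sp_div: "F \<in> stable \<Longrightarrow> support (sp_div F) \<subseteq> vertices (sp_graph F)"
  by (auto simp: stable_pairs_def effective_divisors_def)

lemma coords_sigma_ob:
  assumes "F \<in> stable"
  shows "coords (\<Delta> F) = edges (sp_graph F)"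
proof -
  interpret chained "sp_graph F" G "sp_chains F" using stable_chained[OF assms] .
  show ?thesis
  proof
    show "coords (\<Delta> F) \<subseteq> edges (sp_graph F)"
      using slot_arc_in_arcs by (auto simp: coords_def sigma_ob_def in_set_conv_nth) (metis fst_conv)
    show "edges (sp_graph F) \<subseteq> coords (\<Delta> F)"
    proof
      fix a assume "a \<in> edges (sp_graph F)"
      then obtain e i where "e \<in> edges G" "i < clen (sp_chains F) e"
        "a = fst (cchain (sp_chains F) e ! i)" by (rule obtain_slot)
      then show "a \<in> coords (\<Delta> F)"
        by (auto simp: coords_def sigma_ob_def intro!: bexI[of _ e])
    qed
  qed
qed

lemma chain_edgesE:
  assumes "a \<in> fst ` set (cchain K e)"
  obtains i where "i < clen K e" "a = fst (cchain K e ! i)"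
  using assms by (metis imageE in_set_conv_nth)

lemma is_pdata_sigma_ob:
  assumes "F \<in> stable"
  shows "is_pdata (\<Delta> F)"
proof -
  interpret chained "sp_graph F" G "sp_chains F" using stable_chained[OF assms] .
  interpret fin_digraph "gr G" by (rule fin_G)
  have disj: "e = e'" if e: "e \<in> edges G" "e' \<in> edges G"
    and a: "a \<in> fst ` set (cchain (sp_chains F) e)" "a \<in> fst ` set (cchain (sp_chains F) e')" for a e e'
  proof -
    obtain i j where "i < clen (sp_chains F) e" "a = fst (cchain (sp_chains F) e ! i)"
      "j < clen (sp_chains F) e'" "a = fst (cchain (sp_chains F) e' ! j)"
      using a by (metis chain_edgesE)
    then show ?thesis using slot_unique[OF e(1) _ e(2)] by metis
  qed
  have "fst p \<inter> fst q = {}" if pq: "p \<in> \<Delta> F" "q \<in> \<Delta> F" "p \<noteq> q" for p q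
  proof -
    obtain e e' where "e \<in> edges G" "p = (fst ` set (cchain (sp_chains F) e), len e)"
      "e' \<in> edges G" "q = (fst ` set (cchain (sp_chains F) e'), len e')"
      using pq(1,2) by (auto simp: sigma_ob_def)
    then show ?thesis using disj[of e e'] pq(3) by (cases "e = e'") auto
  qed
  moreover have "finite (\<Delta> F)" by (simp add: sigma_ob_def)
  moreover have "finite I \<and> I \<noteq> {} \<and> 0 < a" if Ia: "(I, a) \<in> \<Delta> F" for I a
    using Ia len_pos chain_nonempty by (auto simp: sigma_ob_def)
  ultimately show ?thesis unfolding is_pdata_def disjoint_family_on_def by fast
qed

definition kept :: "('v, 'e) stable_pair \<Rightarrow> (nat, nat, nat, nat) gmap \<Rightarrow> nat set" where
  "kept F f = {a \<in> edges (sp_graph F). \<not> contracted f a}"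

text \<open>Brings the functor into the form to which the calculus of \<open>face_data\<close>
  applies.\<close>

lemma sigma_mor_incl:
  assumes "F1 \<in> stable"
  shows "\<Delta>_mor F2 F1 f = incl_mor (\<Delta> F2) (\<Delta> F1) (kept F1 f) (edge_image f)"
proof -
  have "filter_mset (\<lambda>a. \<not> contracted f a) M = filter_mset (\<lambda>a. a \<in> kept F1 f) M" if "M \<in> mon (\<Delta> F1)" for M
    using that coords_sigma_ob[OF assms] by (intro filter_mset_cong) (auto simp: mon_def kept_def)
  then show ?thesis
    by (auto simp: sigma_mor_def incl_mor_def kept_def restrict_def fun_eq_iff)
qed

lemma morE:
  assumes "F1 \<in> stable" "F2 \<in> stable" "f \<in> stable_pair_mor G F1 F2"
  obtains r where "step_maps F1 F2 r" "follows F1 F2 r f"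
  using assms stable_pair_mor_iff by blast

lemma face_data_mor:
  assumes F: "F1 \<in> stable" "F2 \<in> stable" and f: "f \<in> stable_pair_mor G F1 F2"
  shows "face_data (\<Delta> F2) (\<Delta> F1) (kept F1 f) (edge_image f)"
proof -
  let ?K1 = "sp_chains F1" and ?K2 = "sp_chains F2"
  obtain r where r: "step_maps F1 F2 r" and fr: "follows F1 F2 r f" using morE[OF F f] .
  interpret chained_pair "sp_graph F1" "sp_graph F2" G ?K1 ?K2 using pair_locale[OF F] .
  have r': "step_family r" using r step_maps_iff[OF F] by simp
  have keptE: "\<exists>e i. e \<in> edges G \<and> i < clen ?K1 e \<and> a = fst (cchain ?K1 e ! i) \<and>
      r e (Suc i) \<noteq> r e i \<and> r e i < clen ?K2 e \<and> edge_image f a = fst (cchain ?K2 e ! r e i)"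
    if a: "a \<in> kept F1 f" for a
  proof -
    have "a \<in> edges (sp_graph F1)" using a by (simp add: kept_def)
    then obtain e i where e: "e \<in> edges G" and i: "i < clen ?K1 e" and ai: "a = fst (cchain ?K1 e ! i)"
      by (rule src.obtain_slot)
    have nc: "r e (Suc i) \<noteq> r e i" using a contracted_slot(1)[OF fr e i] ai by (simp add: kept_def)
    then show ?thesis
      using e i ai contracted_slot(2)[OF fr e i] steps_less(2)[OF step_familyD[OF r' e] i nc] by blast
  qed
  \<comment> \<open>Every edge of the coarse chain is the image of a jump of \<open>r e\<close>, by
    \<open>slot_preimage\<close>. Hence the factors of \<open>\<Delta> F2\<close> are the relabelled
    remainders of the factors of \<open>\<Delta> F1\<close>.\<close>
  have img: "edge_image f ` (fst ` set (cchain ?K1 e) \<inter> kept F1 f) = fst ` set (cchain ?K2 e)"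
    if e: "e \<in> edges G" for e
  proof
    show "edge_image f ` (fst ` set (cchain ?K1 e) \<inter> kept F1 f) \<subseteq> fst ` set (cchain ?K2 e)"
    proof
      fix b assume "b \<in> edge_image f ` (fst ` set (cchain ?K1 e) \<inter> kept F1 f)"
      then obtain a where a: "a \<in> fst ` set (cchain ?K1 e)" "a \<in> kept F1 f" "b = edge_image f a" by auto
      obtain e' i where ei: "e' \<in> edges G" "i < clen ?K1 e'" "a = fst (cchain ?K1 e' ! i)"
        "r e' i < clen ?K2 e'" "edge_image f a = fst (cchain ?K2 e' ! r e' i)"
        using keptE[OF a(2)] by blast
      obtain j where j: "j < clen ?K1 e" "a = fst (cchain ?K1 e ! j)"
        using a(1) by (rule chain_edgesE)
      have "fst (cchain ?K1 e ! j) = fst (cchain ?K1 e' ! i)" using j ei by simp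
      from src.slot_unique[OF e j(1) ei(1,2) this] have "e = e'" by simp
      then show "b \<in> fst ` set (cchain ?K2 e)" using ei a(3) by simp
    qed
    show "fst ` set (cchain ?K2 e) \<subseteq> edge_image f ` (fst ` set (cchain ?K1 e) \<inter> kept F1 f)"
    proof
      fix b assume "b \<in> fst ` set (cchain ?K2 e)"
      then obtain k where k: "k < clen ?K2 e" "b = fst (cchain ?K2 e ! k)" by (rule chain_edgesE)
      obtain i where i: "i < clen ?K1 e" "r e i = k" "r e (Suc i) \<noteq> r e i"
        using slot_preimage[OF r' e k(1)] by blast
      have "edge_image f (fst (cchain ?K1 e ! i)) = b" using contracted_slot(2)[OF fr e i(1,3)] i(2) k(2) by simp
      moreover have "fst (cchain ?K1 e ! i) \<in> kept F1 f"
        using contracted_slot(1)[OF fr e i(1)] i(3) src.slot_arc_in_arcs[OF e i(1)] by (simp add: kept_def)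
      moreover have "fst (cchain ?K1 e ! i) \<in> fst ` set (cchain ?K1 e)" using i(1) by simp
      ultimately show "b \<in> edge_image f ` (fst ` set (cchain ?K1 e) \<inter> kept F1 f)" by blast
    qed
  qed
  have "edge_contraction (gr (sp_graph F1)) (gr (sp_graph F2)) f" using edge_contraction_realizes[OF fr r'] .
  then have ec: "\<And>b. b \<in> edges (sp_graph F2) \<Longrightarrow>
      \<exists>!a. a \<in> edges (sp_graph F1) \<and> \<not> contracted f a \<and> edge_image f a = b"
    by (simp add: edge_contraction_def)
  have "inj_on (edge_image f) (kept F1 f)"
  proof (rule inj_onI)
    fix a b assume ab: "a \<in> kept F1 f" "b \<in> kept F1 f" "edge_image f a = edge_image f b"
    have "edge_image f a \<in> edges (sp_graph F2)"
      using keptE[OF ab(1)] dst.slot_arc_in_arcs by metis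
    from ec[OF this] show "a = b" using ab by (auto simp: kept_def)
  qed
  moreover have "\<Delta> F2 = subface (\<Delta> F1) (kept F1 f) (edge_image f)"
    unfolding sigma_ob_def subface_def image_image by (intro image_cong) (simp_all add: img)
  moreover have "I \<inter> kept F1 f \<noteq> {}" if Ia: "(I, a) \<in> \<Delta> F1" for I a
  proof -
    obtain e where e: "e \<in> edges G" "I = fst ` set (cchain ?K1 e)" using Ia by (auto simp: sigma_ob_def)
    then show ?thesis using img[OF e(1)] dst.chain_nonempty[OF e(1)] by auto
  qed
  ultimately show ?thesis
    using is_pdata_sigma_ob[OF F(1)] coords_sigma_ob[OF F(1)] by (auto simp: face_data_def kept_def)
qed

lemma sigma_mor_face_mor:
  assumes "F1 \<in> stable" "F2 \<in> stable" "f \<in> stable_pair_mor G F1 F2"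
  shows "\<Delta>_mor F2 F1 f \<in> face_mor (\<Delta> F2) (\<Delta> F1)"
  unfolding sigma_mor_incl[OF assms(1)] using face_mor_of_face_data[OF face_data_mor[OF assms]] .

lemma gmap_id_mor:
  assumes F: "F \<in> stable"
  shows "gmap_id (gr (sp_graph F)) \<in> stable_pair_mor G F F" "follows F F (\<lambda>e i. i) (gmap_id (gr (sp_graph F)))"
proof -
  show fo: "follows F F (\<lambda>e i. i) (gmap_id (gr (sp_graph F)))"
    using realizes_gmap_id[OF stable_chained[OF F]] .
  have "push_div (vmap (gmap_id (gr (sp_graph F)))) (sp_div F) = sp_div F"
    using support_sp_div[OF F] by (intro push_div_id) (auto simp: gmap_id_def)
  moreover have "step_maps F F (\<lambda>e i. i)" by (simp add: step_maps_def steps_id)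
  ultimately show "gmap_id (gr (sp_graph F)) \<in> stable_pair_mor G F F"
    using fo stable_pair_mor_iff[OF F F] by blast
qed

lemma follows_unique:
  assumes F: "F1 \<in> stable" "F2 \<in> stable" and "follows F1 F2 r f" "follows F1 F2 q g"
    and "\<And>e i. e \<in> edges G \<Longrightarrow> i \<le> clen (sp_chains F1) e \<Longrightarrow> r e i = q e i"
  shows "f = g"
  using chained_pair.realizes_unique[OF pair_locale[OF F] assms(3-5)] .

lemma follows_comp:
  assumes F: "F1 \<in> stable" "F2 \<in> stable" "F3 \<in> stable"
    and "step_maps F1 F2 r" "step_maps F2 F3 q" "follows F1 F2 r f" "follows F2 F3 q g"
  shows "follows F1 F3 (\<lambda>e i. q e (r e i)) (gmap_comp (gr (sp_graph F1)) g f)"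
  using realizes_gmap_comp[OF pair_locale[OF F(1,2)] pair_locale[OF F(2,3)]] assms step_maps_iff by simp

lemma step_maps_comp: "step_maps F1 F2 r \<Longrightarrow> step_maps F2 F3 q \<Longrightarrow> step_maps F1 F3 (\<lambda>e i. q e (r e i))"
  unfolding step_maps_def by (auto intro: steps_comp)

lemma push_div_gmap_comp:
  assumes F1: "F1 \<in> stable"
  shows "push_div (vmap (gmap_comp (gr (sp_graph F1)) g f)) (sp_div F1) = push_div (vmap g) (push_div (vmap f) (sp_div F1))"
  unfolding push_div_push_div using support_sp_div[OF F1]
  by (intro push_div_cong) (auto simp: gmap_comp_def compose_def)

lemma gmap_comp_mor:
  assumes F: "F1 \<in> stable" "F2 \<in> stable" "F3 \<in> stable"
    and f: "f \<in> stable_pair_mor G F1 F2" and g: "g \<in> stable_pair_mor G F2 F3"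
  shows "gmap_comp (gr (sp_graph F1)) g f \<in> stable_pair_mor G F1 F3"
proof -
  obtain r where r: "step_maps F1 F2 r" "follows F1 F2 r f" using morE[OF F(1,2) f] .
  obtain q where q: "step_maps F2 F3 q" "follows F2 F3 q g" using morE[OF F(2,3) g] .
  have "push_div (vmap f) (sp_div F1) = sp_div F2" "push_div (vmap g) (sp_div F2) = sp_div F3"
    using f g by (auto simp: stable_pair_mor_def)
  then have "push_div (vmap (gmap_comp (gr (sp_graph F1)) g f)) (sp_div F1) = sp_div F3"
    by (simp add: push_div_gmap_comp[OF F(1)])
  then show ?thesis
    using stable_pair_mor_iff[OF F(1,3)] follows_comp[OF F r(1) q(1) r(2) q(2)] step_maps_comp[OF r(1) q(1)] by blast
qed

text \<open>A flat step of a step function is a contracted edge, so the contracted edges determine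
  the step functions, and these the morphism.\<close>

lemma mor_eqI:
  assumes F: "F1 \<in> stable" "F2 \<in> stable"
    and f: "f \<in> stable_pair_mor G F1 F2" and g: "g \<in> stable_pair_mor G F1 F2"
    and eq: "\<And>a. a \<in> edges (sp_graph F1) \<Longrightarrow> contracted f a \<longleftrightarrow> contracted g a"
  shows "f = g"
proof -
  obtain r where r: "step_maps F1 F2 r" "follows F1 F2 r f" using morE[OF F f] .
  obtain q where q: "step_maps F1 F2 q" "follows F1 F2 q g" using morE[OF F g] .
  interpret chained "sp_graph F1" G "sp_chains F1" using stable_chained[OF F(1)] .
  show ?thesis
  proof (rule follows_unique[OF F r(2) q(2)])
    fix e i assume e: "e \<in> edges G" and i: "i \<le> clen (sp_chains F1) e"
    show "r e i = q e i"
    proof (rule steps_unique[OF _ _ _ i])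
      show "steps (r e) (clen (sp_chains F1) e) (clen (sp_chains F2) e)"
        "steps (q e) (clen (sp_chains F1) e) (clen (sp_chains F2) e)"
        using r(1) q(1) e by (auto simp: step_maps_def)
      fix j assume j: "j < clen (sp_chains F1) e"
      show "r e (Suc j) = r e j \<longleftrightarrow> q e (Suc j) = q e j"
        using contracted_slot(1)[OF r(2) e j] contracted_slot(1)[OF q(2) e j] eq slot_arc_in_arcs[OF e j] by simp
    qed
  qed
qed

text \<open>The chains of source and target have equal lengths, which forces the step functions to
  be identities. Automorphisms are a special case.\<close>

lemma endomorphism_eq_id:
  assumes F: "F \<in> stable" and f: "f \<in> stable_pair_mor G F F"
  shows "f = gmap_id (gr (sp_graph F))"
proof -
  obtain r where r: "step_maps F F r" "follows F F r f" using morE[OF F F f] .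
  show ?thesis
  proof (rule follows_unique[OF F F r(2) gmap_id_mor(2)[OF F]])
    fix e i assume "e \<in> edges G" "i \<le> clen (sp_chains F) e"
    then show "r e i = i" using r(1) steps_refl_eq by (auto simp: step_maps_def)
  qed
qed

abbreviation \<Xi> :: "(('v, 'e) stable_pair, (nat, nat, nat, nat) gmap) cat" where
  "\<Xi> \<equiv> op_cat (stable_pair_cat G d)"

lemma \<Xi>_simps:
  "Ob \<Xi> = stable" "Hom \<Xi> F1 F2 = stable_pair_mor G F2 F1" "Id \<Xi> F = gmap_id (gr (sp_graph F))"
  "Comp \<Xi> F1 F2 F3 g f = gmap_comp (gr (sp_graph F3)) f g"
  by (simp_all add: op_cat_def stable_pair_cat_def)

lemma category_stable_pair_cat: "category (stable_pair_cat G d)"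
  unfolding category_def stable_pair_cat_def cat.simps
proof (intro conjI ballI)
  fix F assume "F \<in> stable"
  then show "gmap_id (gr (sp_graph F)) \<in> stable_pair_mor G F F" by (rule gmap_id_mor)
next
  fix F1 F2 F3 f g
  assume "F1 \<in> stable" "F2 \<in> stable" "F3 \<in> stable" "f \<in> stable_pair_mor G F1 F2" "g \<in> stable_pair_mor G F2 F3"
  then show "gmap_comp (gr (sp_graph F1)) g f \<in> stable_pair_mor G F1 F3" by (rule gmap_comp_mor)
next
  fix F1 F2 f
  assume F: "F1 \<in> stable" "F2 \<in> stable" and f: "f \<in> stable_pair_mor G F1 F2"
  obtain r where r: "step_maps F1 F2 r" "follows F1 F2 r f" using morE[OF F f] .
  have id: "step_maps F F (\<lambda>e i. i)" for F by (simp add: step_maps_def steps_id)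
  show "gmap_comp (gr (sp_graph F1)) f (gmap_id (gr (sp_graph F1))) = f"
    by (rule follows_unique[OF F follows_comp[OF F(1,1,2) id r(1) gmap_id_mor(2)[OF F(1)] r(2)] r(2)]) simp
  show "gmap_comp (gr (sp_graph F1)) (gmap_id (gr (sp_graph F2))) f = f"
    by (rule follows_unique[OF F follows_comp[OF F(1,2,2) r(1) id r(2) gmap_id_mor(2)[OF F(2)]] r(2)]) simp
next
  fix F1 F2 F3 F4 f g k
  assume F: "F1 \<in> stable" "F2 \<in> stable" "F3 \<in> stable" "F4 \<in> stable"
    and f: "f \<in> stable_pair_mor G F1 F2" and g: "g \<in> stable_pair_mor G F2 F3" and k: "k \<in> stable_pair_mor G F3 F4"
  obtain r where r: "step_maps F1 F2 r" "follows F1 F2 r f" using morE[OF F(1,2) f] .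
  obtain q where q: "step_maps F2 F3 q" "follows F2 F3 q g" using morE[OF F(2,3) g] .
  obtain p where p: "step_maps F3 F4 p" "follows F3 F4 p k" using morE[OF F(3,4) k] .
  note rq = follows_comp[OF F(1-3) r(1) q(1) r(2) q(2)] and qp = follows_comp[OF F(2-4) q(1) p(1) q(2) p(2)]
  show "gmap_comp (gr (sp_graph F1)) k (gmap_comp (gr (sp_graph F1)) g f) =
      gmap_comp (gr (sp_graph F1)) (gmap_comp (gr (sp_graph F2)) k g) f"
    by (rule follows_unique[OF F(1,4) follows_comp[OF F(1,3,4) step_maps_comp[OF r(1) q(1)] p(1) rq p(2)]
        follows_comp[OF F(1,2,4) r(1) step_maps_comp[OF q(1) p(1)] r(2) qp]]) simp
qed

lemma sigma_mor_id:
  assumes F: "F \<in> stable"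
  shows "\<Delta>_mor F F (gmap_id (gr (sp_graph F))) = Id all_poly (\<Delta> F)"
  unfolding sigma_mor_incl[OF F] incl_mor_id[symmetric]
  by (rule incl_mor_cong) (auto simp: coords_sigma_ob[OF F] kept_def gmap_id_def contracted_def edge_image_def)

lemma sigma_mor_comp:
  assumes F: "F1 \<in> stable" "F2 \<in> stable" "F3 \<in> stable"
    and f: "f \<in> stable_pair_mor G F1 F2" and g: "g \<in> stable_pair_mor G F2 F3"
  shows "\<Delta>_mor F3 F1 (gmap_comp (gr (sp_graph F1)) g f) =
    Comp all_poly (\<Delta> F3) (\<Delta> F2) (\<Delta> F1) (\<Delta>_mor F2 F1 f) (\<Delta>_mor F3 F2 g)"
proof -
  have fd: "face_data (\<Delta> F2) (\<Delta> F1) (kept F1 f) (edge_image f)" using face_data_mor[OF F(1,2) f] .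
  have im: "edge_image f a \<in> edges (sp_graph F2)" if "a \<in> kept F1 f" for a
    using face_data_coords[OF fd] that coords_sigma_ob[OF F(2)] by auto
  show ?thesis
    unfolding sigma_mor_incl[OF F(1)] sigma_mor_incl[OF F(2)]
      incl_mor_comp[OF face_data_mor[OF F(2,3) g] fd]
  proof (rule incl_mor_cong)
    show "kept F1 (gmap_comp (gr (sp_graph F1)) g f) = {a \<in> kept F1 f. edge_image f a \<in> kept F2 g}"
      using im by (auto simp: kept_def contracted_gmap_comp)
    fix a assume "a \<in> kept F1 (gmap_comp (gr (sp_graph F1)) g f)"
    then show "edge_image (gmap_comp (gr (sp_graph F1)) g f) a = edge_image g (edge_image f a)"
      by (auto simp: kept_def contracted_gmap_comp edge_image_gmap_comp)
  qed
qed

lemma is_functor_sigma: "is_functor \<Xi> cPoly \<Delta> \<Delta>_mor"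
  unfolding is_functor_def \<Xi>_simps cPoly_simps
  using category_op_cat[OF category_stable_pair_cat] category_cPoly is_pdata_sigma_ob sigma_mor_face_mor
    sigma_mor_id sigma_mor_comp
  by auto

text \<open>The monoid half of \<open>\<Delta>_mor\<close> sends the generator of an edge to the
  empty multiset exactly when the edge is contracted.\<close>

lemma faithful:
  assumes F: "F1 \<in> stable" "F2 \<in> stable"
    and f: "f \<in> stable_pair_mor G F1 F2" and g: "g \<in> stable_pair_mor G F1 F2"
    and eq: "\<Delta>_mor F2 F1 f = \<Delta>_mor F2 F1 g"
  shows "f = g"
proof (rule mor_eqI[OF F f g])
  fix a assume "a \<in> edges (sp_graph F1)"
  then have "{#a#} \<in> mon (\<Delta> F1)" by (simp add: mon_def coords_sigma_ob[OF F(1)])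
  moreover have "snd (\<Delta>_mor F2 F1 f) {#a#} = snd (\<Delta>_mor F2 F1 g) {#a#}" using eq by simp
  ultimately show "contracted f a \<longleftrightarrow> contracted g a"
    by (auto simp: sigma_mor_def split: if_splits)
qed

text \<open>The step functions \<open>q\<close> of \<open>\<gamma>\<close> are forced by \<open>q \<circ> rb = ra\<close>. They exist because every edge contracted by
  \<open>\<beta>\<close> is contracted by \<open>\<alpha>\<close>, which is what the monoid part of \<open>c\<close> says.\<close>

lemma factorization:
  assumes F: "F \<in> stable" "F1 \<in> stable" "F2 \<in> stable"
    and a: "\<alpha> \<in> stable_pair_mor G F F1" and b: "\<beta> \<in> stable_pair_mor G F F2"
    and c: "c \<in> face_mor (\<Delta> F1) (\<Delta> F2)"
    and comm: "Comp all_poly (\<Delta> F1) (\<Delta> F2) (\<Delta> F) (\<Delta>_mor F2 F \<beta>) c = \<Delta>_mor F1 F \<alpha>"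
  shows "\<exists>\<gamma>. \<gamma> \<in> stable_pair_mor G F2 F1 \<and> \<Delta>_mor F1 F2 \<gamma> = c"
proof -
  let ?n = "\<lambda>e. clen (sp_chains F) e" and ?n1 = "\<lambda>e. clen (sp_chains F1) e"
    and ?n2 = "\<lambda>e. clen (sp_chains F2) e"
  obtain ra where ra: "step_maps F F1 ra" "follows F F1 ra \<alpha>" using morE[OF F(1,2) a] .
  obtain rb where rb: "step_maps F F2 rb" "follows F F2 rb \<beta>" using morE[OF F(1,3) b] .
  interpret chained "sp_graph F" G "sp_chains F" using stable_chained[OF F(1)] .
  have sa: "steps (ra e) (?n e) (?n1 e)" and sb: "steps (rb e) (?n e) (?n2 e)" if "e \<in> edges G" for e
    using ra(1) rb(1) that by (auto simp: step_maps_def)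
  have contr: "contracted \<alpha> x" if x: "x \<in> edges (sp_graph F)" "contracted \<beta> x" for x
  proof -
    have xm: "{#x#} \<in> mon (\<Delta> F)" using x by (simp add: mon_def coords_sigma_ob[OF F(1)])
    have "c \<in> poly_mor (\<Delta> F1) (\<Delta> F2)" using c by (simp add: face_mor_def)
    then have "snd c {#} = {#}" by (auto simp: poly_mor_def)
    moreover have "snd (Comp all_poly (\<Delta> F1) (\<Delta> F2) (\<Delta> F) (\<Delta>_mor F2 F \<beta>) c) {#x#} = snd c (snd (\<Delta>_mor F2 F \<beta>) {#x#})"
      using xm by (simp add: all_poly_def split_beta compose_def)
    ultimately have "snd (\<Delta>_mor F1 F \<alpha>) {#x#} = {#}"
      using xm x comm by (simp add: sigma_mor_def)
    then show ?thesis using xm by (auto simp: sigma_mor_def split: if_splits)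
  qed
  have flat: "ra e (Suc i) = ra e i" if "e \<in> edges G" "i < ?n e" "rb e (Suc i) = rb e i" for e i
    using contr[OF slot_arc_in_arcs[OF that(1,2)]] contracted_slot(1)[OF ra(2) that(1,2)]
      contracted_slot(1)[OF rb(2) that(1,2)] that(3) by simp
  have flat2: "ra e i = ra e j" if e: "e \<in> edges G" and ij: "i \<le> j" "j \<le> ?n e" and eq: "rb e i = rb e j" for e i j
    using ij eq
  proof (induction j rule: dec_induct)
    case (step j)
    have "rb e i \<le> rb e j" "rb e j \<le> rb e (Suc j)"
      using steps_mono[OF sb[OF e] step(1)] steps_mono[OF sb[OF e], of j "Suc j"] step.prems by simp_all
    then have "rb e i = rb e j" "rb e (Suc j) = rb e j" using step.prems by simp_all
    then show ?case using step.IH flat[OF e, of j] step.prems by simp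
  qed simp
  \<comment> \<open>\<open>ra\<close> is constant on the fibres of \<open>rb\<close>, so its value
    at the left end of a fibre is its value on the whole fibre.\<close>
  define q where "q e k = ra e (first (rb e) k)" for e k
  have q: "q e (rb e i) = ra e i" if e: "e \<in> edges G" and i: "i \<le> ?n e" for e i
  proof -
    have le: "rb e i \<le> ?n2 e" using steps_le[OF sb[OF e] i] .
    have fi: "first (rb e) (rb e i) \<le> i" using first(3)[OF sb[OF e] le i] by simp
    show ?thesis unfolding q_def by (rule flat2[OF e fi i first(1)[OF sb[OF e] le]])
  qed
  have sq: "step_maps F2 F1 q"
    unfolding step_maps_def steps_def
  proof (intro ballI conjI allI impI)
    fix e assume e: "e \<in> edges G"
    show "q e 0 = 0" using q[OF e, of 0] sa[OF e] sb[OF e] by (simp add: steps_def)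
    show "q e (?n2 e) = ?n1 e" using q[OF e, of "?n e"] sa[OF e] sb[OF e] by (simp add: steps_def)
    fix k assume k: "k < ?n2 e"
    interpret P: chained_pair "sp_graph F" "sp_graph F2" G "sp_chains F" "sp_chains F2" using pair_locale[OF F(1,3)] .
    obtain i where i: "i < ?n e" "rb e i = k" "rb e (Suc i) \<noteq> rb e i"
      using P.slot_preimage[OF _ e k] rb(1) step_maps_iff[OF F(1,3)] by blast
    have "rb e (Suc i) = Suc k" using steps_less(1)[OF sb[OF e] i(1,3)] i(2) by simp
    then have "q e k = ra e i" "q e (Suc k) = ra e (Suc i)" using q[OF e, of i] q[OF e, of "Suc i"] i by auto
    then show "q e (Suc k) = q e k \<or> q e (Suc k) = Suc (q e k)"
      using sa[OF e] i(1) by (simp add: steps_def)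
  qed
  obtain \<gamma> where g: "follows F2 F1 q \<gamma>"
    using chained_pair.realizes_exists[OF pair_locale[OF F(3,2)]] by blast
  have comp: "gmap_comp (gr (sp_graph F)) \<gamma> \<beta> = \<alpha>"
    by (rule follows_unique[OF F(1,2) follows_comp[OF F(1,3,2) rb(1) sq rb(2) g] ra(2)]) (use q in auto)
  have "push_div (vmap \<gamma>) (sp_div F2) = push_div (vmap \<gamma>) (push_div (vmap \<beta>) (sp_div F))"
    using b by (auto simp: stable_pair_mor_def)
  also have "\<dots> = push_div (vmap \<alpha>) (sp_div F)" using push_div_gmap_comp[OF F(1), of \<gamma> \<beta>] comp by simp
  also have "\<dots> = sp_div F1" using a by (auto simp: stable_pair_mor_def)
  finally have gm: "\<gamma> \<in> stable_pair_mor G F2 F1" using stable_pair_mor_iff[OF F(3,2)] sq g by blast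
  \<comment> \<open>The face morphism of \<open>\<beta>\<close> is a monomorphism, so it is enough
    to compare the composites with it.\<close>
  have "\<Delta>_mor F1 F2 \<gamma> = c"
  proof (rule incl_mor_mono[OF face_data_mor[OF F(1,3) b]])
    show "\<Delta>_mor F1 F2 \<gamma> \<in> poly_mor (\<Delta> F1) (\<Delta> F2)" "c \<in> poly_mor (\<Delta> F1) (\<Delta> F2)"
      using sigma_mor_face_mor[OF F(3,2) gm] c by (auto simp: face_mor_def)
    show "Comp all_poly (\<Delta> F1) (\<Delta> F2) (\<Delta> F) (incl_mor (\<Delta> F2) (\<Delta> F) (kept F \<beta>) (edge_image \<beta>)) (\<Delta>_mor F1 F2 \<gamma>) =
      Comp all_poly (\<Delta> F1) (\<Delta> F2) (\<Delta> F) (incl_mor (\<Delta> F2) (\<Delta> F) (kept F \<beta>) (edge_image \<beta>)) c"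
      using sigma_mor_comp[OF F(1,3,2) b gm] comm sigma_mor_incl[OF F(1)] comp by simp
  qed
  with gm show ?thesis by blast
qed

end

section \<open>Construction of stable pairs\<close>

text \<open>All edges are oriented along their chains, so that a chain is just a list of
  labels.\<close>

definition label_chains :: "('e \<Rightarrow> 'f list) \<Rightarrow> ('v \<Rightarrow> 'w) \<Rightarrow> ('w, 'f, 'v, 'e) chains" where
  "label_chains L c = \<lparr>cvert = c, cchain = (\<lambda>e. map (\<lambda>a. (a, True)) (L e))\<rparr>"

lemma label_chains_simps [simp]:
  "cchain (label_chains L c) e = map (\<lambda>a. (a, True)) (L e)" "cvert (label_chains L c) = c"
  by (simp_all add: label_chains_def)

lemma chain_pos_cong: "clen K e = clen K' e \<Longrightarrow> chain_pos G K e i = chain_pos G K' e i"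
  by (simp add: chain_pos_def)

lemma positions_cong:
  "(\<And>e. e \<in> edges G \<Longrightarrow> clen K e = clen K' e) \<Longrightarrow> positions G K = positions G K'"
  by (auto simp: positions_def)

text \<open>Edges must bear the given labels because they become the coordinates of a prescribed
  polysimplex. Vertices may have any names, so the finite set of positions is numbered by some
  \<open>\<nu>\<close>; the divisor is given on positions since there are no vertices
  beforehand.\<close>

lemma stable_pair_of_labels:
  fixes G :: "('v, 'e) wgraph" and L :: "'e \<Rightarrow> nat list"
  assumes fin: "fin_digraph (gr G)"
    and ne: "\<And>e. e \<in> edges G \<Longrightarrow> L e \<noteq> []"
    and dist: "\<And>e. e \<in> edges G \<Longrightarrow> distinct (L e)"
    and disj: "\<And>e e' a. e \<in> edges G \<Longrightarrow> e' \<in> edges G \<Longrightarrow> a \<in> set (L e) \<Longrightarrow> a \<in> set (L e') \<Longrightarrow> e = e'"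
    and E: "E \<in> effective_divisors (positions G (label_chains L u)) d"
      "\<And>s. Inr s \<in> positions G (label_chains L u) \<Longrightarrow> 0 < coeff E (Inr s)"
  shows "\<exists>F\<in>stable_pairs G d. cchain (sp_chains F) = (\<lambda>e. map (\<lambda>a. (a, True)) (L e)) \<and>
    sp_div F = push_div (pos_vertex (sp_graph F) (sp_chains F)) E"
proof -
  interpret fin_digraph "gr G" by (rule fin)
  have wf: "wf_digraph (gr G)" by unfold_locales
  let ?W = "positions G (label_chains L u)"
  have finW: "finite ?W" by (rule finite_positions[OF fin])
  obtain \<nu> :: "'v + 'e \<times> nat \<Rightarrow> nat" where \<nu>: "inj_on \<nu> ?W"
    using finite_imp_inj_to_nat_seg[OF finW] by blast
  define K :: "(nat, nat, 'v, 'e) chains" where "K = label_chains L (\<lambda>v. \<nu> (Inl v))"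
  have W: "positions G K = ?W" by (rule positions_cong) (simp add: K_def)
  have cK [simp]: "cchain K e = map (\<lambda>a. (a, True)) (L e)" "cvert K v = \<nu> (Inl v)" for e v
    by (simp_all add: K_def)
  have injs: "inj_on (slot_arc K) (slots G K)"
  proof (rule inj_onI)
    fix s t assume st: "s \<in> slots G K" "t \<in> slots G K" "slot_arc K s = slot_arc K t"
    obtain e i e' i' where ei: "s = (e, i)" "t = (e', i')" by (cases s; cases t)
    have m: "L e ! i = L e' ! i'" "e \<in> edges G" "e' \<in> edges G" "i < length (L e)" "i' < length (L e')"
      using st ei by auto
    then have "e = e'" using disj[of e e' "L e ! i"] by (metis nth_mem)
    then show "s = t" using m ei dist nth_eq_iff_index_eq by metis
  qed
  define A where "A = slot_arc K ` slots G K"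
  define sl where "sl = inv_into (slots G K) (slot_arc K)"
  have sl: "sl (L e ! i) = (e, i)" if "e \<in> edges G" "i < length (L e)" for e i
  proof -
    have "inv_into (slots G K) (slot_arc K) (slot_arc K (e, i)) = (e, i)"
      using that injs by (intro inv_into_f_f) auto
    then show ?thesis using that by (simp add: sl_def)
  qed
  \<comment> \<open>The ends of an edge are read off from its slot, which is unique because all
    labels are distinct.\<close>
  define H :: "(nat, nat) wgraph" where
    "H = \<lparr>gr = \<lparr>verts = \<nu> ` ?W, arcs = A,
            tail = (\<lambda>a. case sl a of (e, i) \<Rightarrow> \<nu> (chain_pos G K e i)),
            head = (\<lambda>a. case sl a of (e, i) \<Rightarrow> \<nu> (chain_pos G K e (Suc i)))\<rparr>,
          wt = (\<lambda>w. case inv_into ?W \<nu> w of Inl v \<Rightarrow> wt G v | Inr _ \<Rightarrow> 0)\<rparr>"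
  have cp: "chain_pos G K e i \<in> ?W" if "e \<in> edges G" for e i
    using chain_pos_in_positions[OF wf that] W by metis
  have AE: "\<exists>e i. e \<in> edges G \<and> i < length (L e) \<and> a = L e ! i" if aA: "a \<in> A" for a
  proof -
    obtain s where "s \<in> slots G K" "a = slot_arc K s" using aA by (auto simp: A_def)
    then show ?thesis
      by (intro exI[of _ "fst s"] exI[of _ "snd s"]) (simp add: mem_slots slot_arc_def)
  qed
  have finH: "fin_digraph (gr H)"
  proof
    show "finite (vertices H)" using finW by (simp add: H_def)
    have "finite (slots G K)" unfolding slots_def by simp
    then show "finite (edges H)" by (simp add: H_def A_def)
  next
    fix a assume "a \<in> edges H"
    then obtain e i where ei: "e \<in> edges G" "i < length (L e)" "a = L e ! i" using AE[of a] by (auto simp: H_def)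
    then show "tail (gr H) a \<in> vertices H" "head (gr H) a \<in> vertices H"
      using cp by (simp_all add: H_def sl)
  qed
  have src: "dart_source (gr H) (cchain K e ! i) = \<nu> (chain_pos G K e i)"
    and tgt: "dart_target (gr H) (cchain K e ! i) = \<nu> (chain_pos G K e (Suc i))"
    if "e \<in> edges G" "i < length (L e)" for e i
    using that by (simp_all add: dart_ends_True H_def sl)
  have pv: "pos_vertex H K p = \<nu> p" if p: "p \<in> ?W" for p
  proof (cases p)
    case (Inr s)
    then obtain e i where s: "p = Inr (e, i)" by (cases s) auto
    then have e: "e \<in> edges G" and i: "0 < i" "i < length (L e)" using p by auto
    then show ?thesis using tgt[OF e, of "i - 1"] by (simp add: s pos_vertex_Inr)
  qed simp
  have wtH: "wt H (\<nu> p) = (case p of Inl v \<Rightarrow> wt G v | Inr _ \<Rightarrow> 0)" if "p \<in> ?W" for p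
    using that \<nu> by (simp add: H_def)
  have sys: "chain_system H G K"
  proof (rule chain_systemI)
    show "bij_betw (pos_vertex H K) (positions G K) (vertices H)"
      unfolding bij_betw_def W using \<nu> pv by (simp add: H_def inj_on_def)
    show "bij_betw (slot_arc K) (slots G K) (edges H)"
      using injs by (simp add: bij_betw_def H_def A_def)
    fix e i assume e: "e \<in> edges G"
    show "cchain K e \<noteq> []" using ne[OF e] by simp
    assume i: "i < clen K e"
    show "dart_source (gr H) (cchain K e ! i) = pos_vertex H K (chain_pos G K e i)"
      using src[OF e] i pv[OF cp[OF e]] by simp
    show "dart_target (gr H) (cchain K e ! i) = pos_vertex H K (chain_pos G K e (Suc i))"
      using tgt[OF e] i pv[OF cp[OF e]] by simp
  next
    fix e i assume "Inr (e, i) \<in> positions G K"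
    then have "Inr (e, i) \<in> ?W" using W by simp
    then show "wt H (pos_vertex H K (Inr (e, i))) = 0" using pv wtH by simp
  qed
  interpret ch: chained H G K using wf finH sys by (auto intro!: chained.intro simp: fin_digraph_def)
  let ?D = "push_div (pos_vertex H K) E"
  have nn: "\<And>p. 0 \<le> coeff E p" using E(1) by (auto simp: effective_divisors_def)
  have "\<exists>\<phi>. \<lparr>sp_graph = H, sp_map = \<phi>, sp_chains = K, sp_div = ?D\<rparr> \<in> stable_pairs G d"
  proof (rule stable_pairI[OF wf finH sys])
    fix v assume "v \<in> vertices G"
    then show "wt H (cvert K v) = wt G v" using wtH[of "Inl v"] by simp
  next
    show "?D \<in> effective_divisors (vertices H) d"
      using E(1) by (rule effective_divisors_push_div) (use ch.pos_vertex_in_verts W in blast)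
  next
    fix w assume "w \<in> exceptional H G K"
    then obtain p where p: "p \<in> ?W" "\<not> isl p" "w = pos_vertex H K p"
      unfolding ch.exceptional_eq W by blast
    then obtain s where s: "Inr s \<in> ?W" "w = pos_vertex H K (Inr s)" by (cases p) auto
    have "Inr s \<in> support E" using E(2)[OF s(1)] by (simp add: in_keys_iff del: Inr_positions_iff)
    from coeff_push_div_pos[OF nn this] show "0 < coeff ?D w" unfolding s(2) .
  qed
  then obtain \<phi> where F: "\<lparr>sp_graph = H, sp_map = \<phi>, sp_chains = K, sp_div = ?D\<rparr> \<in> stable_pairs G d" by blast
  show ?thesis by (rule bexI[OF _ F]) (simp add: fun_eq_iff)
qed

lemma nth_filter:
  assumes "i < length xs" "Q (xs ! i)"
  shows "length (filter Q (take i xs)) < length (filter Q xs)"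
    "filter Q xs ! length (filter Q (take i xs)) = xs ! i"
proof -
  have "filter Q xs = filter Q (take i xs) @ xs ! i # filter Q (drop (Suc i) xs)"
    using id_take_nth_drop[OF assms(1)] assms(2) by (metis filter.simps(2) filter_append)
  then show "length (filter Q (take i xs)) < length (filter Q xs)"
    "filter Q xs ! length (filter Q (take i xs)) = xs ! i"
    by simp_all
qed

context metric_model
begin

text \<open>The chains of the wanted pair are the surviving edges in their old order, renamed by
  \<open>\<sigma>\<close>, and its divisor is the image of the old one. The step functions count the
  survivors in initial segments.\<close>

lemma face_lift:
  assumes F: "F \<in> stable" and P: "is_pdata P" and k: "k \<in> face_mor P (\<Delta> F)"
  shows "\<exists>F'\<in>stable. \<exists>f\<in>stable_pair_mor G F F'. \<Delta> F' = P \<and> \<Delta>_mor F' F f = k"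
proof -
  let ?H = "sp_graph F" and ?K = "sp_chains F"
  interpret src: chained ?H G ?K using stable_chained[OF F] .
  obtain S \<sigma> where fd: "face_data P (\<Delta> F) S \<sigma>" and ki: "k = incl_mor P (\<Delta> F) S \<sigma>"
    using face_data_of_face_mor[OF P is_pdata_sigma_ob[OF F] k] by blast
  have inj: "inj_on \<sigma> S" and Psub: "P = subface (\<Delta> F) S \<sigma>" and S: "S \<subseteq> edges ?H"
    using fd coords_sigma_ob[OF F] by (auto simp: face_data_def)
  define es where "es e = map fst (cchain ?K e)" for e
  define L where "L e = map \<sigma> (filter (\<lambda>a. a \<in> S) (es e))" for e
  define r where "r e i = length (filter (\<lambda>a. a \<in> S) (take i (es e)))" for e i
  have es: "length (es e) = clen ?K e" "i < clen ?K e \<Longrightarrow> es e ! i = fst (cchain ?K e ! i)" for e i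
    by (simp_all add: es_def)
  have disj: "e = e'" if e: "e \<in> edges G" "e' \<in> edges G" and a: "a \<in> set (es e)" "a \<in> set (es e')" for a e e'
  proof -
    obtain i j where i: "i < clen ?K e" "a = fst (cchain ?K e ! i)"
      and j: "j < clen ?K e'" "a = fst (cchain ?K e' ! j)"
      using a by (auto simp: es_def in_set_conv_nth) (metis fst_conv)
    then show ?thesis using src.slot_unique[OF e(1) i(1) e(2) j(1)] by simp
  qed
  have setL: "set (L e) = \<sigma> ` (fst ` set (cchain ?K e) \<inter> S)" for e
    by (auto simp: L_def es_def)
  have L: "L e \<noteq> []" "distinct (L e)" if e: "e \<in> edges G" for e
  proof -
    have "(fst ` set (cchain ?K e), len e) \<in> \<Delta> F" using e by (auto simp: sigma_ob_def)
    then have "fst ` set (cchain ?K e) \<inter> S \<noteq> {}" using fd by (auto simp: face_data_def)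
    then have "set (L e) \<noteq> {}" unfolding setL by (simp only: image_is_empty not_False_eq_True)
    then show "L e \<noteq> []" by simp
    have "distinct (es e)"
      unfolding distinct_conv_nth using src.slot_unique[OF e _ e] es by metis
    then show "distinct (L e)"
      unfolding L_def distinct_map using inj by (auto intro: inj_on_subset)
  qed
  have Ldisj: "e = e'" if e: "e \<in> edges G" "e' \<in> edges G" and a: "a \<in> set (L e)" "a \<in> set (L e')" for a e e'
  proof -
    obtain b where b: "b \<in> set (es e)" "b \<in> S" "a = \<sigma> b" using a(1) by (auto simp: L_def)
    obtain b' where b': "b' \<in> set (es e')" "b' \<in> S" "a = \<sigma> b'" using a(2) by (auto simp: L_def)
    have "b = b'" using inj b b' by (auto dest: inj_onD)
    then show ?thesis using disj[OF e] b b' by simp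
  qed
  have r_Suc: "r e (Suc i) = (if fst (cchain ?K e ! i) \<in> S then Suc (r e i) else r e i)"
    if "i < clen ?K e" for e i
    using that by (simp add: r_def take_Suc_conv_app_nth es)
  have st: "steps (r e) (clen ?K e) (length (L e))" for e
    unfolding steps_def
  proof (intro conjI allI impI)
    show "r e (clen ?K e) = length (L e)" using es(1)[of e] by (simp add: r_def L_def)
  qed (auto simp: r_Suc, simp add: r_def)
  \<comment> \<open>A stand-in for the chains of the pair that is yet to be built: it has the right
    chain lengths, and the positions depend only on these.\<close>
  define K0 :: "(nat, nat, 'v, 'e) chains" where "K0 = label_chains L (\<lambda>_. 0)"
  define loc where "loc w = pos_step G K0 r (inv_into (positions G ?K) (pos_vertex ?H ?K) w)" for w
  have loc: "loc (pos_vertex ?H ?K p) = pos_step G K0 r p" if "p \<in> positions G ?K" for p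
    using that bij_betw_imp_inj_on[OF src.bij_positions] by (simp add: loc_def)
  have loc_in: "pos_step G K0 r p \<in> positions G K0" if "p \<in> positions G ?K" for p
  proof (cases p)
    case (Inr s)
    then show ?thesis using that by (cases s) (auto intro: chain_pos_in_positions[OF wf_G])
  qed (use that in simp)
  define E where "E = push_div loc (sp_div F)"
  have DF: "sp_div F \<in> effective_divisors (vertices ?H) d"
    and Dpos: "\<And>w. w \<in> exceptional ?H G ?K \<Longrightarrow> 0 < coeff (sp_div F) w"
    using F by (auto simp: stable_pairs_def)
  have nn: "\<And>w. 0 \<le> coeff (sp_div F) w" using DF by (auto simp: effective_divisors_def)
  have E1: "E \<in> effective_divisors (positions G K0) d"
    unfolding E_def
  proof (rule effective_divisors_push_div[OF DF])
    show "loc ` vertices ?H \<subseteq> positions G K0"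
    proof
      fix q assume "q \<in> loc ` vertices ?H"
      then obtain w where w: "w \<in> vertices ?H" "q = loc w" by blast
      obtain p where "p \<in> positions G ?K" "w = pos_vertex ?H ?K p" using w(1) by (rule src.obtain_position)
      then show "q \<in> positions G K0" using w loc loc_in by simp
    qed
  qed
  \<comment> \<open>Stability survives the contraction. An inner vertex of a shortened chain
    receives at least the leftmost vertex of its fibre, which is exceptional, and coefficients do
    not cancel.\<close>
  have E2: "0 < coeff E (Inr s)" if s: "Inr s \<in> positions G K0" for s
  proof -
    obtain e j where ej: "s = (e, j)" by (cases s)
    then have e: "e \<in> edges G" and j: "0 < j" "j < length (L e)" using s by (auto simp: K0_def)
    have i: "r e (first (r e) j) = j" "first (r e) j \<le> clen ?K e"
      using first[OF st, of j e] j by auto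
    let ?p = "chain_pos G ?K e (first (r e) j)"
    have "first (r e) j \<noteq> 0"
    proof
      assume "first (r e) j = 0"
      then have "r e 0 = j" using i(1) by simp
      then show False using j by (simp add: r_def)
    qed
    moreover have "first (r e) j \<noteq> clen ?K e"
    proof
      assume "first (r e) j = clen ?K e"
      then have "r e (clen ?K e) = j" using i(1) by simp
      then show False using st[of e] j by (simp add: steps_def)
    qed
    ultimately have p: "?p = Inr (e, first (r e) j)" "?p \<in> positions G ?K"
      using i(2) e by simp_all
    have "pos_vertex ?H ?K ?p \<in> exceptional ?H G ?K" using p by (auto simp: src.exceptional_eq)
    from Dpos[OF this] have "pos_vertex ?H ?K ?p \<in> support (sp_div F)" by (simp add: in_keys_iff)
    from coeff_push_div_pos[OF nn this, of loc] have "0 < coeff E (loc (pos_vertex ?H ?K ?p))"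
      by (simp add: E_def)
    moreover have "loc (pos_vertex ?H ?K ?p) = Inr s"
    proof -
      have "loc (pos_vertex ?H ?K ?p) = pos_step G K0 r ?p" by (rule loc[OF p(2)])
      also have "\<dots> = Inr s" unfolding p(1) using i(1) j ej by (simp add: K0_def)
      finally show ?thesis .
    qed
    ultimately show ?thesis by simp
  qed
  have "\<exists>F'\<in>stable. cchain (sp_chains F') = (\<lambda>e. map (\<lambda>a. (a, True)) (L e)) \<and>
      sp_div F' = push_div (pos_vertex (sp_graph F') (sp_chains F')) E"
    by (rule stable_pair_of_labels[OF fin_G _ _ _ E1[unfolded K0_def] E2[unfolded K0_def]])
      (fact L Ldisj)+
  then obtain F' where F': "F' \<in> stable" and ch: "cchain (sp_chains F') = (\<lambda>e. map (\<lambda>a. (a, True)) (L e))"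
    and D': "sp_div F' = push_div (pos_vertex (sp_graph F') (sp_chains F')) E"
    by blast
  have r: "step_maps F F' r" using st by (simp add: step_maps_def ch)
  obtain f where f: "follows F F' r f" using chained_pair.realizes_exists[OF pair_locale[OF F F']] by blast
  have K0: "chain_pos G (sp_chains F') e i = chain_pos G K0 e i" for e i
    by (rule chain_pos_cong) (simp add: ch K0_def)
  have ps: "pos_step G (sp_chains F') r p = pos_step G K0 r p" for p
    by (cases p) (auto simp: K0)
  have "sp_div F' = push_div (\<lambda>w. pos_vertex (sp_graph F') (sp_chains F') (loc w)) (sp_div F)"
    unfolding D' E_def push_div_push_div ..
  also have "\<dots> = push_div (vmap f) (sp_div F)"
  proof (rule push_div_cong)
    fix w assume "w \<in> support (sp_div F)"
    then have "w \<in> vertices ?H" using support_sp_div[OF F] by blast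
    then obtain p where p: "p \<in> positions G ?K" "w = pos_vertex ?H ?K p" by (rule src.obtain_position)
    then show "pos_vertex (sp_graph F') (sp_chains F') (loc w) = vmap f w"
      using f loc ps by (simp add: realizes_def)
  qed
  finally have fm: "f \<in> stable_pair_mor G F F'" using stable_pair_mor_iff[OF F F'] r f by auto
  have "\<Delta> F' = P"
    unfolding Psub subface_def sigma_ob_def image_image
    by (intro image_cong) (simp_all add: ch setL[symmetric] image_image)
  moreover have "\<Delta>_mor F' F f = k"
    unfolding sigma_mor_incl[OF F] ki \<open>\<Delta> F' = P\<close>
  proof (rule incl_mor_cong)
    have contr: "contracted f (fst (cchain ?K e ! i)) \<longleftrightarrow> fst (cchain ?K e ! i) \<notin> S"
      if "e \<in> edges G" "i < clen ?K e" for e i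
      using contracted_slot(1)[OF f that] r_Suc[OF that(2)] by simp
    show kS: "kept F f = S"
    proof
      show "kept F f \<subseteq> S"
      proof
        fix a assume a: "a \<in> kept F f"
        then have "a \<in> edges ?H" by (simp add: kept_def)
        then obtain e i where "e \<in> edges G" "i < clen ?K e" "a = fst (cchain ?K e ! i)"
          by (rule src.obtain_slot)
        then show "a \<in> S" using a contr by (auto simp: kept_def)
      qed
      show "S \<subseteq> kept F f"
      proof
        fix a assume a: "a \<in> S"
        then have aH: "a \<in> edges ?H" using S by blast
        then obtain e i where "e \<in> edges G" "i < clen ?K e" "a = fst (cchain ?K e ! i)"
          by (rule src.obtain_slot)
        then show "a \<in> kept F f" using a aH contr by (auto simp: kept_def)
      qed
    qed
    fix a assume a: "a \<in> kept F f"
    then have aS: "a \<in> S" "a \<in> edges ?H" using kS by (auto simp: kept_def)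
    obtain e i where ei: "e \<in> edges G" "i < clen ?K e" "a = fst (cchain ?K e ! i)"
      using aS(2) by (rule src.obtain_slot)
    have "r e (Suc i) \<noteq> r e i" using r_Suc[OF ei(2)] ei(3) aS(1) by simp
    then have "edge_image f a = fst (cchain (sp_chains F') e ! r e i)"
      using contracted_slot(2)[OF f ei(1,2)] ei(3) by simp
    also have "\<dots> = \<sigma> a"
      using nth_filter[of i "es e" "\<lambda>a. a \<in> S"] ei aS(1) es by (simp add: ch L_def r_def)
    finally show "edge_image f a = \<sigma> a" .
  qed
  ultimately show ?thesis using F' fm by blast
qed

lemma complex_without_self_gluing: "polysimplicial_complex_without_self_gluing \<Xi> \<Delta> \<Delta>_mor"
  unfolding polysimplicial_complex_without_self_gluing_def polysimplicial_complex_def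
proof (intro conjI ballI allI impI)
  show "is_functor \<Xi> cPoly \<Delta> \<Delta>_mor" by (rule is_functor_sigma)
next
  fix F P k assume "F \<in> Ob \<Xi>" "P \<in> Ob cPoly" "k \<in> Hom cPoly P (\<Delta> F)"
  then show "\<exists>F'\<in>Ob \<Xi>. \<exists>\<iota>\<in>Hom \<Xi> F' F. \<Delta> F' = P \<and> \<Delta>_mor F' F \<iota> = k"
    using face_lift[of F P k] by (simp add: \<Xi>_simps cPoly_simps)
next
  fix F F1 F2 \<alpha> \<beta> c
  assume *: "F \<in> Ob \<Xi>" "F1 \<in> Ob \<Xi>" "F2 \<in> Ob \<Xi>" "\<alpha> \<in> Hom \<Xi> F1 F" "\<beta> \<in> Hom \<Xi> F2 F"
    "c \<in> Hom cPoly (\<Delta> F1) (\<Delta> F2)" "Comp cPoly (\<Delta> F1) (\<Delta> F2) (\<Delta> F) (\<Delta>_mor F2 F \<beta>) c = \<Delta>_mor F1 F \<alpha>"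
  then have F: "F \<in> stable" "F1 \<in> stable" "F2 \<in> stable" by (simp_all add: \<Xi>_simps)
  obtain \<gamma> where "\<gamma> \<in> stable_pair_mor G F2 F1" "\<Delta>_mor F1 F2 \<gamma> = c"
    using factorization[OF F, of \<alpha> \<beta> c] * by (auto simp: \<Xi>_simps cPoly_simps)
  then show "\<exists>!\<gamma>. \<gamma> \<in> Hom \<Xi> F1 F2 \<and> \<Delta>_mor F1 F2 \<gamma> = c"
    using faithful[OF F(3,2)] by (intro ex1I[of _ \<gamma>]) (auto simp: \<Xi>_simps)
next
  fix F1 F2 assume "F1 \<in> Ob \<Xi>" "F2 \<in> Ob \<Xi>"
  then show "inj_on (\<Delta>_mor F1 F2) (Hom \<Xi> F1 F2)"
    using faithful[of F2 F1] by (intro inj_onI) (simp add: \<Xi>_simps)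
next
  fix F f assume "F \<in> Ob \<Xi>" "iso_in \<Xi> F F f"
  then show "f = Id \<Xi> F" using endomorphism_eq_id[of F f] by (simp add: iso_in_def \<Xi>_simps)
qed

end

section \<open>The geometric realization\<close>

lemma pos_vertex_inv:
  assumes "chained H G K" "p \<in> positions G K"
  shows "inv_into (positions G K) (pos_vertex H K) (pos_vertex H K p) = p"
proof -
  interpret chained H G K by (rule assms)
  show ?thesis using bij_betw_imp_inj_on[OF bij_positions] assms(2) by simp
qed

section \<open>The divisor of a point and its invariance under gluing\<close>

context metric_model
begin

definition psum :: "('v, 'e) stable_pair \<Rightarrow> (nat \<Rightarrow> real) \<Rightarrow> 'e \<Rightarrow> nat \<Rightarrow> real" where
  "psum F x e i = (\<Sum>j<i. x (fst (cchain (sp_chains F) e ! j)))"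

text \<open>On the boundary of the polysimplex inner vertices of a chain may move to the ends of \<open>e\<close>.\<close>

definition edge_pt :: "'e \<Rightarrow> real \<Rightarrow> ('v, 'e) gpoint" where
  "edge_pt e t = (if t \<le> 0 then At (tail (gr G) e) else if len e \<le> t then At (head (gr G) e) else On e t)"

definition pos_pt :: "('v, 'e) stable_pair \<Rightarrow> (nat \<Rightarrow> real) \<Rightarrow> 'v + 'e \<times> nat \<Rightarrow> ('v, 'e) gpoint" where
  "pos_pt F x p = (case p of Inl v \<Rightarrow> At v | Inr (e, i) \<Rightarrow> edge_pt e (psum F x e i))"

definition vert_pt :: "('v, 'e) stable_pair \<Rightarrow> (nat \<Rightarrow> real) \<Rightarrow> nat \<Rightarrow> ('v, 'e) gpoint" where
  "vert_pt F x w = pos_pt F x (inv_into (positions G (sp_chains F)) (pos_vertex (sp_graph F) (sp_chains F)) w)"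

text \<open>Extends \<open>point_divisor\<close> from the interior to the whole polysimplex; the
  agreement in the interior is \<open>point_divisor_interior\<close>.\<close>

definition div_at :: "('v, 'e) stable_pair \<Rightarrow> (nat \<Rightarrow> real) \<Rightarrow> ('v, 'e) gpoint \<Rightarrow>\<^sub>0 int" where
  "div_at F x = push_div (vert_pt F x) (sp_div F)"

abbreviation \<Gamma> :: "('v, 'e) gpoint set" where
  "\<Gamma> \<equiv> metric_graph (gr G) len"

lemma vert_pt_pos_vertex:
  "F \<in> stable \<Longrightarrow> p \<in> positions G (sp_chains F) \<Longrightarrow>
    vert_pt F x (pos_vertex (sp_graph F) (sp_chains F) p) = pos_pt F x p"
  using pos_vertex_inv[OF stable_chained] by (simp add: vert_pt_def)

lemma sum_chain:
  assumes F: "F \<in> stable" and e: "e \<in> edges G"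
  shows "(\<Sum>a\<in>fst ` set (cchain (sp_chains F) e). x a) = psum F x e (clen (sp_chains F) e)"
proof -
  interpret chained "sp_graph F" G "sp_chains F" using stable_chained[OF F] .
  let ?c = "cchain (sp_chains F) e"
  have "fst ` set ?c = (\<lambda>j. fst (?c ! j)) ` {..<length ?c}"
    by (auto simp: set_conv_nth)
  moreover have "inj_on (\<lambda>j. fst (?c ! j)) {..<length ?c}"
    using slot_unique[OF e _ e] by (intro inj_onI) simp
  ultimately show ?thesis by (simp add: sum.reindex psum_def)
qed

lemma psum_0 [simp]: "psum F x e 0 = 0"
  by (simp add: psum_def)

lemma psum_Suc: "psum F x e (Suc i) = psum F x e i + x (fst (cchain (sp_chains F) e ! i))"
  by (simp add: psum_def)

lemma psum_length:
  assumes F: "F \<in> stable" and x: "x \<in> polysimplex (\<Delta> F)" and e: "e \<in> edges G"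
  shows "psum F x e (clen (sp_chains F) e) = len e"
  unfolding sum_chain[OF F e, symmetric] using e
  by (intro polysimplexD(3)[OF x]) (auto simp: sigma_ob_def)

lemma pos_pt_chain_pos:
  assumes F: "F \<in> stable" and x: "x \<in> polysimplex (\<Delta> F)" and e: "e \<in> edges G"
    and i: "i \<le> clen (sp_chains F) e"
  shows "pos_pt F x (chain_pos G (sp_chains F) e i) = edge_pt e (psum F x e i)"
proof -
  interpret chained "sp_graph F" G "sp_chains F" using stable_chained[OF F] .
  consider "i = 0" | "i = clen (sp_chains F) e" | "0 < i" "i < clen (sp_chains F) e"
    using i by linarith
  then show ?thesis
  proof cases
    case 2
    then show ?thesis using psum_length[OF F x e] chain_nonempty[OF e] len_pos[OF e]
      by (simp add: pos_pt_def edge_pt_def)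
  qed (simp_all add: pos_pt_def edge_pt_def)
qed

lemma edge_pt_in: "e \<in> edges G \<Longrightarrow> edge_pt e t \<in> \<Gamma>"
  using wf_G by (auto simp: edge_pt_def metric_graph_def wf_digraph_def)

lemma div_at_effective:
  assumes F: "F \<in> stable"
  shows "div_at F x \<in> effective_divisors \<Gamma> d"
  unfolding div_at_def
proof (rule effective_divisors_push_div)
  interpret chained "sp_graph F" G "sp_chains F" using stable_chained[OF F] .
  show "sp_div F \<in> effective_divisors (vertices (sp_graph F)) d"
    using F by (simp add: stable_pairs_def)
  show "vert_pt F x ` vertices (sp_graph F) \<subseteq> \<Gamma>"
  proof
    fix g assume "g \<in> vert_pt F x ` vertices (sp_graph F)"
    then obtain w where w: "w \<in> vertices (sp_graph F)" "g = vert_pt F x w" by blast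
    obtain p where p: "p \<in> positions G (sp_chains F)" "w = pos_vertex (sp_graph F) (sp_chains F) p"
      using w(1) by (rule obtain_position)
    have "pos_pt F x p \<in> \<Gamma>"
    proof (cases p)
      case (Inl v)
      then show ?thesis using p(1) by (simp add: pos_pt_def metric_graph_def)
    next
      case (Inr s)
      then show ?thesis using p(1) edge_pt_in by (cases s) (simp add: pos_pt_def)
    qed
    then show "g \<in> \<Gamma>" using w p vert_pt_pos_vertex[OF F] by simp
  qed
qed

text \<open>Contracted edges have length zero, so the partial sums along a chain of the finer
  subdivision are those along the coarser one, read through \<open>r\<close>. Hence a vertex and its
  image lie at the same point of \<open>\<Gamma>\<close>.\<close>

lemma div_at_mor:
  assumes F: "F1 \<in> stable" "F2 \<in> stable" and f: "f \<in> stable_pair_mor G F1 F2"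
    and x: "x \<in> polysimplex (\<Delta> F2)"
  shows "fst (\<Delta>_mor F2 F1 f) x \<in> polysimplex (\<Delta> F1)" "div_at F1 (fst (\<Delta>_mor F2 F1 f) x) = div_at F2 x"
proof -
  let ?y = "fst (\<Delta>_mor F2 F1 f) x"
  obtain r where r: "step_maps F1 F2 r" "follows F1 F2 r f" using morE[OF F f] .
  interpret chained_pair "sp_graph F1" "sp_graph F2" G "sp_chains F1" "sp_chains F2" using pair_locale[OF F] .
  have y: "?y = (\<lambda>a. if a \<in> kept F1 f then x (edge_image f a) else 0)"
    using x by (simp add: sigma_mor_incl[OF F(1)] incl_mor_def)
  show "?y \<in> polysimplex (\<Delta> F1)"
    unfolding y by (rule incl_mor_point[OF face_data_mor[OF F f] x])
  have ps: "psum F1 ?y e j = psum F2 x e (r e j)" if e: "e \<in> edges G" and j: "j \<le> clen (sp_chains F1) e" for e j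
    using j
  proof (induction j)
    case 0
    have "r e 0 = 0" using r(1) e by (simp add: step_maps_def steps_def)
    then show ?case by simp
  next
    case (Suc j)
    then have j: "j < clen (sp_chains F1) e" by simp
    have st: "steps (r e) (clen (sp_chains F1) e) (clen (sp_chains F2) e)"
      using r(1) e by (simp add: step_maps_def)
    show ?case
    proof (cases "r e (Suc j) = r e j")
      case True
      then have "?y (fst (cchain (sp_chains F1) e ! j)) = 0"
        using contracted_slot(1)[OF r(2) e j] by (simp add: y kept_def)
      then show ?thesis using Suc True by (simp add: psum_Suc)
    next
      case False
      then have "?y (fst (cchain (sp_chains F1) e ! j)) = x (fst (cchain (sp_chains F2) e ! r e j))"
        using contracted_slot[OF r(2) e j] src.slot_arc_in_arcs[OF e j] by (simp add: y kept_def)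
      then show ?thesis using Suc steps_less(1)[OF st j False] by (simp add: psum_Suc)
    qed
  qed
  have pp: "pos_pt F1 ?y p = pos_pt F2 x (pos_step G (sp_chains F2) r p)" if p: "p \<in> positions G (sp_chains F1)" for p
  proof (cases p)
    case (Inr s)
    then obtain e i where s: "p = Inr (e, i)" by (cases s) auto
    then have e: "e \<in> edges G" and i: "i \<le> clen (sp_chains F1) e" using p by auto
    have "r e i \<le> clen (sp_chains F2) e"
      using r(1) e i steps_le unfolding step_maps_def by blast
    then show ?thesis using ps[OF e i] pos_pt_chain_pos[OF F(2) x e] s by (simp add: pos_pt_def)
  qed (simp add: pos_pt_def)
  have "vert_pt F1 ?y w = vert_pt F2 x (vmap f w)" if w: "w \<in> vertices (sp_graph F1)" for w
  proof -
    obtain p where p: "p \<in> positions G (sp_chains F1)" "w = pos_vertex (sp_graph F1) (sp_chains F1) p"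
      using w by (rule src.obtain_position)
    have "vmap f w = pos_vertex (sp_graph F2) (sp_chains F2) (pos_step G (sp_chains F2) r p)"
      using r(2) p by (simp add: realizes_def)
    then show ?thesis using vert_pt_pos_vertex[OF F(1) p(1)] vert_pt_pos_vertex[OF F(2) pos_step_in[OF p(1)]] pp[OF p(1)] p(2)
      by simp
  qed
  then have "div_at F1 ?y = push_div (\<lambda>w. vert_pt F2 x (vmap f w)) (sp_div F1)"
    unfolding div_at_def using support_sp_div[OF F(1)] by (intro push_div_cong) blast
  also have "\<dots> = push_div (vert_pt F2 x) (push_div (vmap f) (sp_div F1))"
    by (simp add: push_div_push_div)
  also have "\<dots> = div_at F2 x" using f by (simp add: div_at_def stable_pair_mor_def)
  finally show "div_at F1 ?y = div_at F2 x" .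
qed

abbreviation step_rel :: "(('v, 'e) stable_pair \<times> (nat \<Rightarrow> real)) rel" where
  "step_rel \<equiv> glue_step \<Xi> \<Delta> \<Delta>_mor"

abbreviation glue_rel :: "(('v, 'e) stable_pair \<times> (nat \<Rightarrow> real)) rel" where
  "glue_rel \<equiv> glue \<Xi> \<Delta> \<Delta>_mor"

lemma step_relI:
  assumes "F1 \<in> stable" "F2 \<in> stable" "f \<in> stable_pair_mor G F1 F2" "x \<in> polysimplex (\<Delta> F2)"
  shows "((F2, x), (F1, fst (\<Delta>_mor F2 F1 f) x)) \<in> step_rel"
  using assms unfolding glue_step_def \<Xi>_simps by blast

lemma glue_rel_equiv: "refl glue_rel" "sym glue_rel" "trans glue_rel"
  unfolding glue_def by (auto intro: refl_rtrancl sym_rtrancl trans_rtrancl sym_Un_converse)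

lemma step_rel_glue: "p \<in> step_rel \<Longrightarrow> p \<in> glue_rel"
  unfolding glue_def by blast

lemma div_at_step: "((F1, x), (F2, y)) \<in> step_rel \<Longrightarrow> div_at F1 x = div_at F2 y"
  unfolding glue_step_def \<Xi>_simps using div_at_mor(2) by auto

lemma div_at_glue:
  assumes "(p, q) \<in> glue_rel"
  shows "case_prod div_at p = case_prod div_at q"
  using assms unfolding glue_def
proof (induction rule: rtrancl_induct)
  case (step q s)
  then have "case_prod div_at q = case_prod div_at s"
    using div_at_step[of "fst q" "snd q" "fst s" "snd s"] div_at_step[of "fst s" "snd s" "fst q" "snd q"]
    by (auto simp: split_beta)
  with step.IH show ?case by simp
qed simp

section \<open>Interior points and injectivity\<close>

definition interior_point :: "('v, 'e) stable_pair \<Rightarrow> (nat \<Rightarrow> real) \<Rightarrow> bool" where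
  "interior_point F x \<longleftrightarrow> F \<in> stable \<and> x \<in> polysimplex (\<Delta> F) \<and> (\<forall>a\<in>edges (sp_graph F). 0 < x a)"

text \<open>The edges of length zero are removed by \<open>face_lift\<close> with the identity as
  relabelling; therefore the same function \<open>x\<close> is a point of both
  polysimplices.\<close>

lemma reduce_to_interior:
  assumes F: "F \<in> stable" and x: "x \<in> polysimplex (\<Delta> F)"
  shows "\<exists>F'. interior_point F' x \<and> ((F', x), (F, x)) \<in> step_rel"
proof -
  have PF: "is_pdata (\<Delta> F)" using is_pdata_sigma_ob[OF F] .
  define S where "S = {a. 0 < x a}"
  have S: "S \<subseteq> coords (\<Delta> F)"
  proof
    fix a assume "a \<in> S"
    then have "x a \<noteq> 0" by (simp add: S_def)
    then show "a \<in> coords (\<Delta> F)" using polysimplexD(2)[OF x] by blast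
  qed
  have x0: "x a = 0" if "a \<notin> S" for a
    using polysimplexD(1)[OF x, of a] that by (auto simp: S_def)
  define P where "P = subface (\<Delta> F) S (\<lambda>c. c)"
  have sum: "(\<Sum>c\<in>I \<inter> S. x c) = a" if I: "(I, a) \<in> \<Delta> F" for I a
  proof -
    have "(\<Sum>c\<in>I \<inter> S. x c) = (\<Sum>c\<in>I. x c)"
      using is_pdata_factor(1)[OF PF I] x0 by (intro sum.mono_neutral_left) auto
    then show ?thesis using polysimplexD(3)[OF x I] by simp
  qed
  have ne: "I \<inter> S \<noteq> {}" if I: "(I, a) \<in> \<Delta> F" for I a
  proof
    assume "I \<inter> S = {}"
    then have "a = 0" using sum[OF I] by simp
    then show False using is_pdata_factor(3)[OF PF I] by simp
  qed
  have fd: "face_data P (\<Delta> F) S (\<lambda>c. c)"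
    using PF S ne by (auto simp: face_data_def P_def)
  have co: "coords P = S" using face_data_coords[OF fd] by simp
  have xP: "x \<in> polysimplex P"
    unfolding polysimplex_def co using polysimplexD(1)[OF x] x0 sum by (auto simp: P_def subface_def)
  obtain F' f where F': "F' \<in> stable" and f: "f \<in> stable_pair_mor G F F'" and P: "\<Delta> F' = P"
    and m: "\<Delta>_mor F' F f = incl_mor P (\<Delta> F) S (\<lambda>c. c)"
    using face_lift[OF F face_data_is_pdata[OF fd] face_mor_of_face_data[OF fd]] by blast
  have "fst (\<Delta>_mor F' F f) x = (\<lambda>c. if c \<in> S then x c else 0)" using xP by (simp add: m incl_mor_def)
  also have "\<dots> = x" using x0 by auto
  finally have "((F', x), (F, x)) \<in> step_rel" using step_relI[OF F F' f, of x] xP P by simp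
  moreover have "interior_point F' x"
    using F' xP P coords_sigma_ob[OF F'] co by (auto simp: interior_point_def S_def)
  ultimately show ?thesis by blast
qed

lemma psum_less:
  assumes "interior_point F x" and e: "e \<in> edges G" and ij: "i < j" "j \<le> clen (sp_chains F) e"
  shows "psum F x e i < psum F x e j"
  using ij
proof (induction j)
  case (Suc j)
  have F: "F \<in> stable" using assms by (simp add: interior_point_def)
  interpret chained "sp_graph F" G "sp_chains F" using stable_chained[OF F] .
  have "0 < x (fst (cchain (sp_chains F) e ! j))"
    using assms(1) slot_arc_in_arcs[OF e, of j] Suc.prems by (simp add: interior_point_def)
  then show ?case using Suc by (cases "i = j") (auto simp: psum_Suc)
qed simp

lemma pos_pt_interior:
  assumes int: "interior_point F x" and p: "Inr (e, i) \<in> positions G (sp_chains F)"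
  shows "pos_pt F x (Inr (e, i)) = On e (psum F x e i)" "0 < psum F x e i" "psum F x e i < len e"
proof -
  have F: "F \<in> stable" and x: "x \<in> polysimplex (\<Delta> F)" using int by (auto simp: interior_point_def)
  have e: "e \<in> edges G" and i: "0 < i" "i < clen (sp_chains F) e" using p by auto
  show 1: "0 < psum F x e i" using psum_less[OF int e i(1)] i(2) by simp
  show 2: "psum F x e i < len e" using psum_less[OF int e i(2)] psum_length[OF F x e] by simp
  show "pos_pt F x (Inr (e, i)) = On e (psum F x e i)" using 1 2 by (simp add: pos_pt_def edge_pt_def)
qed

lemma psum_inj:
  assumes "interior_point F x" "e \<in> edges G" "i \<le> clen (sp_chains F) e" "j \<le> clen (sp_chains F) e"
    "psum F x e i = psum F x e j"
  shows "i = j"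
  using psum_less[OF assms(1,2), of i j] psum_less[OF assms(1,2), of j i] assms(3-5) by (cases i j rule: linorder_cases) auto

lemma inj_pos_pt:
  assumes int: "interior_point F x"
  shows "inj_on (pos_pt F x) (positions G (sp_chains F))"
proof (rule inj_onI)
  fix p q assume p: "p \<in> positions G (sp_chains F)" and q: "q \<in> positions G (sp_chains F)"
    and eq: "pos_pt F x p = pos_pt F x q"
  show "p = q"
  proof (cases p; cases q)
    fix u v assume "p = Inl u" "q = Inl v"
    then show ?thesis using eq by (simp add: pos_pt_def)
  next
    fix u s assume pq: "p = Inl u" "q = Inr s"
    obtain e i where s: "s = (e, i)" by (cases s)
    show ?thesis using eq pos_pt_interior(1)[OF int, of e i] q unfolding pq s by (simp add: pos_pt_def)
  next
    fix u s assume pq: "p = Inr s" "q = Inl u"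
    obtain e i where s: "s = (e, i)" by (cases s)
    show ?thesis using eq pos_pt_interior(1)[OF int, of e i] p unfolding pq s by (simp add: pos_pt_def)
  next
    fix s t assume pq: "p = Inr s" "q = Inr t"
    obtain e i e' j where st: "s = (e, i)" "t = (e', j)" by (cases s; cases t)
    have "On e (psum F x e i) = (On e' (psum F x e' j) :: ('v, 'e) gpoint)"
      using eq pos_pt_interior(1)[OF int, of e i] pos_pt_interior(1)[OF int, of e' j] p q unfolding pq st by metis
    then have "e' = e" "psum F x e i = psum F x e j" by auto
    then show ?thesis using psum_inj[OF int, of e i j] p q pq st by auto
  qed
qed

text \<open>Inner points of \<open>e\<close> arise only from inner vertices of its chain. None of
  these is lost: they are exceptional, so \<open>sp_div F\<close> is positive there, and effective
  divisors do not cancel under push-forward.\<close>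

lemma support_div_at_interior:
  assumes int: "interior_point F x" and e: "e \<in> edges G"
  shows "{t. On e t \<in> support (div_at F x)} = psum F x e ` {1..<clen (sp_chains F) e}"
proof -
  let ?H = "sp_graph F" and ?K = "sp_chains F"
  have F: "F \<in> stable" using int by (simp add: interior_point_def)
  interpret chained ?H G ?K using stable_chained[OF F] .
  have nn: "\<And>w. 0 \<le> coeff (sp_div F) w" and pos: "\<And>w. w \<in> exceptional ?H G ?K \<Longrightarrow> 0 < coeff (sp_div F) w"
    using F by (auto simp: stable_pairs_def effective_divisors_def)
  have sup: "support (div_at F x) = vert_pt F x ` support (sp_div F)"
    unfolding div_at_def by (rule support_push_div[OF nn])
  show ?thesis
  proof
    show "{t. On e t \<in> support (div_at F x)} \<subseteq> psum F x e ` {1..<clen ?K e}"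
    proof
      fix t assume "t \<in> {t. On e t \<in> support (div_at F x)}"
      then obtain w where w: "w \<in> support (sp_div F)" "On e t = vert_pt F x w" unfolding sup by auto
      then have "w \<in> vertices ?H" using support_sp_div[OF F] by blast
      then obtain p where p: "p \<in> positions G ?K" "w = pos_vertex ?H ?K p" by (rule obtain_position)
      have pt: "On e t = pos_pt F x p" using w(2) p vert_pt_pos_vertex[OF F] by simp
      show "t \<in> psum F x e ` {1..<clen ?K e}"
      proof (cases p)
        case (Inl v)
        then show ?thesis using pt by (simp add: pos_pt_def)
      next
        case (Inr s)
        then obtain e' i where s: "p = Inr (e', i)" by (cases s) auto
        have "On e t = (On e' (psum F x e' i) :: ('v, 'e) gpoint)"
          using pt pos_pt_interior(1)[OF int] p(1) s by metis
        then show ?thesis using p(1) s by auto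
      qed
    qed
    show "psum F x e ` {1..<clen ?K e} \<subseteq> {t. On e t \<in> support (div_at F x)}"
    proof
      fix t assume "t \<in> psum F x e ` {1..<clen ?K e}"
      then obtain i where i: "0 < i" "i < clen ?K e" "t = psum F x e i" by (auto simp: Suc_le_eq)
      then have p: "Inr (e, i) \<in> positions G ?K" using e by simp
      let ?w = "pos_vertex ?H ?K (Inr (e, i))"
      have "?w \<in> exceptional ?H G ?K" unfolding exceptional_eq using p by (intro image_eqI[OF refl]) simp
      from pos[OF this] have "?w \<in> support (sp_div F)" by (simp add: in_keys_iff)
      then have "vert_pt F x ?w \<in> support (div_at F x)" unfolding sup by blast
      then show "t \<in> {t. On e t \<in> support (div_at F x)}"
        using vert_pt_pos_vertex[OF F p] pos_pt_interior(1)[OF int p] i(3) by simp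
    qed
  qed
qed

text \<open>Every exceptional vertex is in the support of the divisor, so the divisor determines the positions of
  all inner vertices of the chains, and with them the lengths of the chains.\<close>

lemma interior_glued:
  assumes i1: "interior_point F1 x1" and i2: "interior_point F2 x2" and eq: "div_at F1 x1 = div_at F2 x2"
  shows "((F2, x2), (F1, x1)) \<in> step_rel"
proof -
  let ?H1 = "sp_graph F1" and ?K1 = "sp_chains F1" and ?H2 = "sp_graph F2" and ?K2 = "sp_chains F2"
  have F: "F1 \<in> stable" "F2 \<in> stable" and x1: "x1 \<in> polysimplex (\<Delta> F1)" and x2: "x2 \<in> polysimplex (\<Delta> F2)"
    using i1 i2 by (auto simp: interior_point_def)
  interpret chained_pair ?H1 ?H2 G ?K1 ?K2 using pair_locale[OF F] .
  have lists: "map (psum F1 x1 e) [1..<clen ?K1 e] = map (psum F2 x2 e) [1..<clen ?K2 e]"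
    if e: "e \<in> edges G" for e
  \<comment> \<open>Both lists enumerate the points of the support inside \<open>e\<close> in
    increasing order.\<close>
  proof (rule strict_sorted_equal)
    have sorted: "sorted_wrt (<) (map (psum F x e) [1..<clen (sp_chains F) e])" if "interior_point F x" for F x
      using psum_less[OF that e] by (simp add: sorted_wrt_map sorted_wrt_iff_nth_less)
    show "sorted_wrt (<) (map (psum F2 x2 e) [1..<clen ?K2 e])" using sorted[OF i2] .
    show "sorted_wrt (<) (map (psum F1 x1 e) [1..<clen ?K1 e])" using sorted[OF i1] .
    show "set (map (psum F1 x1 e) [1..<clen ?K1 e]) = set (map (psum F2 x2 e) [1..<clen ?K2 e])"
      using support_div_at_interior[OF i1 e] support_div_at_interior[OF i2 e] eq by simp
  qed
  have len_eq: "clen ?K1 e = clen ?K2 e" if e: "e \<in> edges G" for e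
  proof -
    have "clen ?K1 e - 1 = clen ?K2 e - 1"
      using arg_cong[OF lists[OF e], of length] by simp
    moreover have "0 < clen ?K1 e" "0 < clen ?K2 e"
      using src.chain_nonempty[OF e] dst.chain_nonempty[OF e] by simp_all
    ultimately show ?thesis by linarith
  qed
  have psum_eq: "psum F1 x1 e i = psum F2 x2 e i" if e: "e \<in> edges G" and i: "i \<le> clen ?K1 e" for e i
  proof -
    consider "i = 0" | "i = clen ?K1 e" | "0 < i" "i < clen ?K1 e" using i by linarith
    then show ?thesis
    proof cases
      case 2
      then show ?thesis using psum_length[OF F(1) x1 e] psum_length[OF F(2) x2 e] len_eq[OF e] by simp
    next
      case 3
      then show ?thesis
        using arg_cong[OF lists[OF e], of "\<lambda>xs. xs ! (i - 1)"] len_eq[OF e] by simp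
    qed simp
  qed
  \<comment> \<open>With equal chain lengths the identity is a step function: the two subdivisions
    differ only in the names of vertices and edges and in the reference orientations.\<close>
  have r: "step_maps F1 F2 (\<lambda>e i. i)" using len_eq by (simp add: step_maps_def steps_def)
  obtain f where f: "follows F1 F2 (\<lambda>e i. i) f" using realizes_exists by blast
  have pos_eq: "positions G ?K1 = positions G ?K2" by (rule positions_cong) (rule len_eq)
  have vm: "vmap f (pos_vertex ?H1 ?K1 p) = pos_vertex ?H2 ?K2 p" if p: "p \<in> positions G ?K1" for p
  proof -
    have "pos_step G ?K2 (\<lambda>e i. i) p = p" using p unfolding pos_eq by (auto simp: positions_def)
    then show ?thesis using f p by (simp add: realizes_def)
  qed
  have pt: "pos_pt F1 x1 p = pos_pt F2 x2 p" if p: "p \<in> positions G ?K1" for p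
    using p psum_eq by (auto simp: positions_def pos_pt_def)
  have vp: "vert_pt F1 x1 w = vert_pt F2 x2 (vmap f w)" if w: "w \<in> vertices ?H1" for w
  proof -
    obtain p where p: "p \<in> positions G ?K1" "w = pos_vertex ?H1 ?K1 p" using w by (rule src.obtain_position)
    show ?thesis
      using vert_pt_pos_vertex[OF F(1) p(1)] vert_pt_pos_vertex[OF F(2), of p] vm[OF p(1)] pt[OF p(1)] p pos_eq by simp
  qed
  have D1: "sp_div F1 \<in> effective_divisors (vertices ?H1) d" using F by (simp add: stable_pairs_def)
  have "vmap f ` vertices ?H1 \<subseteq> vertices ?H2"
  proof
    fix u assume "u \<in> vmap f ` vertices ?H1"
    then obtain w where w: "w \<in> vertices ?H1" "u = vmap f w" by blast
    obtain p where p: "p \<in> positions G ?K1" "w = pos_vertex ?H1 ?K1 p" using w(1) by (rule src.obtain_position)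
    then show "u \<in> vertices ?H2" using w(2) vm[OF p(1)] dst.pos_vertex_in_verts[of p] pos_eq by simp
  qed
  from effective_divisors_push_div[OF D1 this]
  have sup: "support (push_div (vmap f) (sp_div F1)) \<subseteq> vertices ?H2" by (simp add: effective_divisors_def)
  \<comment> \<open>Both sides are moved to the common divisor on \<open>\<Gamma>\<close> by
    \<open>vert_pt F2 x2\<close>, which is injective at an interior point.\<close>
  have "push_div (vmap f) (sp_div F1) = sp_div F2"
  proof (rule push_div_inj[OF _ sup support_sp_div[OF F(2)]])
    show "inj_on (vert_pt F2 x2) (vertices ?H2)"
    proof (rule inj_onI)
      fix u w assume u: "u \<in> vertices ?H2" and w: "w \<in> vertices ?H2" and uw: "vert_pt F2 x2 u = vert_pt F2 x2 w"
      obtain p where p: "p \<in> positions G ?K2" "u = pos_vertex ?H2 ?K2 p" using u by (rule dst.obtain_position)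
      obtain q where q: "q \<in> positions G ?K2" "w = pos_vertex ?H2 ?K2 q" using w by (rule dst.obtain_position)
      have "pos_pt F2 x2 p = pos_pt F2 x2 q"
        using uw p q vert_pt_pos_vertex[OF F(2)] by simp
      then show "u = w" using inj_onD[OF inj_pos_pt[OF i2] _ p(1) q(1)] p q by simp
    qed
    have "push_div (vert_pt F2 x2) (push_div (vmap f) (sp_div F1)) = div_at F1 x1"
      unfolding div_at_def push_div_push_div using vp support_sp_div[OF F(1)]
      by (intro push_div_cong) (metis subsetD)
    then show "push_div (vert_pt F2 x2) (push_div (vmap f) (sp_div F1)) = push_div (vert_pt F2 x2) (sp_div F2)"
      using eq by (simp add: div_at_def)
  qed
  then have fm: "f \<in> stable_pair_mor G F1 F2" using stable_pair_mor_iff[OF F] r f by blast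
  have "fst (\<Delta>_mor F2 F1 f) x2 = x1"
  proof
    fix a show "fst (\<Delta>_mor F2 F1 f) x2 a = x1 a"
    proof (cases "a \<in> edges ?H1")
      case True
      then obtain e i where e: "e \<in> edges G" and i: "i < clen ?K1 e" and a: "a = fst (cchain ?K1 e ! i)"
        by (rule src.obtain_slot)
      have "edge_image f a = fst (cchain ?K2 e ! i)" "\<not> contracted f a"
        using contracted_slot[OF f e i] a by auto
      then have "fst (\<Delta>_mor F2 F1 f) x2 a = x2 (fst (cchain ?K2 e ! i))"
        using x2 True by (simp add: sigma_mor_def)
      also have "\<dots> = psum F2 x2 e (Suc i) - psum F2 x2 e i" by (simp add: psum_Suc)
      also have "\<dots> = psum F1 x1 e (Suc i) - psum F1 x1 e i" using psum_eq[OF e] i by simp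
      also have "\<dots> = x1 a" by (simp add: psum_Suc a)
      finally show ?thesis .
    next
      case False
      then show ?thesis using x2 polysimplexD(2)[OF x1] coords_sigma_ob[OF F(1)] by (simp add: sigma_mor_def)
    qed
  qed
  then show ?thesis using step_relI[OF F fm x2] by simp
qed

lemma glued_if_div_at_eq:
  assumes F: "F1 \<in> stable" "F2 \<in> stable" and x: "x1 \<in> polysimplex (\<Delta> F1)" "x2 \<in> polysimplex (\<Delta> F2)"
    and eq: "div_at F1 x1 = div_at F2 x2"
  shows "((F1, x1), (F2, x2)) \<in> glue_rel"
proof -
  obtain F1' where 1: "interior_point F1' x1" "((F1', x1), (F1, x1)) \<in> step_rel" using reduce_to_interior[OF F(1) x(1)] by blast
  obtain F2' where 2: "interior_point F2' x2" "((F2', x2), (F2, x2)) \<in> step_rel" using reduce_to_interior[OF F(2) x(2)] by blast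
  have "div_at F2' x2 = div_at F1' x1" using div_at_step[OF 1(2)] div_at_step[OF 2(2)] eq by simp
  from interior_glued[OF 2(1) 1(1) this] have "((F1', x1), (F2', x2)) \<in> glue_rel" by (rule step_rel_glue)
  moreover have "((F1, x1), (F1', x1)) \<in> glue_rel" using symD[OF glue_rel_equiv(2) step_rel_glue[OF 1(2)]] .
  ultimately show ?thesis using step_rel_glue[OF 2(2)] transD[OF glue_rel_equiv(3)] by blast
qed

lemma point_divisor_interior:
  assumes int: "interior_point F x"
  shows "point_divisor G F x = div_at F x"
  unfolding point_divisor_def div_at_def
proof (rule push_div_cong)
  let ?H = "sp_graph F" and ?K = "sp_chains F"
  have F: "F \<in> stable" using int by (simp add: interior_point_def)
  interpret chained ?H G ?K using stable_chained[OF F] .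
  fix w assume "w \<in> support (sp_div F)"
  then have "w \<in> vertices ?H" using support_sp_div[OF F] by blast
  then obtain p where p: "p \<in> positions G ?K" "w = pos_vertex ?H ?K p" by (rule obtain_position)
  have vp: "vert_pt F x w = pos_pt F x p" using vert_pt_pos_vertex[OF F p(1)] p(2) by simp
  show "vertex_point G F x w = vert_pt F x w"
  proof (cases p)
    case (Inl v)
    have "w \<notin> exceptional ?H G ?K" using p Inl by (simp add: exceptional_def)
    moreover have "inv_into (vertices G) (cvert ?K) w = v"
      using p Inl chains by (auto simp: chain_system_def intro: inv_into_f_f)
    ultimately show ?thesis using vp Inl by (simp add: vertex_point_def pos_pt_def)
  next
    case (Inr s)
    then obtain e i where s: "p = Inr (e, i)" by (cases s) auto
    then have e: "e \<in> edges G" and i: "0 < i" "i < clen ?K e" using p(1) by auto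
    have exc: "w \<in> exceptional ?H G ?K"
      unfolding exceptional_eq using p s by (intro image_eqI[of _ _ p]) auto
    have "(THE q. inner_vertex_at ?H G ?K w q) = (e, i - 1)"
    proof (rule the_equality)
      show "inner_vertex_at ?H G ?K w (e, i - 1)" using p s i by (simp add: inner_vertex_at_iff)
      fix q assume "inner_vertex_at ?H G ?K w q"
      then have q: "Inr (fst q, Suc (snd q)) \<in> positions G ?K" "pos_vertex ?H ?K (Inr (fst q, Suc (snd q))) = w"
        using inner_vertex_at_iff[of ?H G ?K w "fst q" "snd q"] by simp_all
      then have "Inr (fst q, Suc (snd q)) = p" using pos_vertex_inj[OF q(1) p(1)] p(2) by simp
      then show "q = (e, i - 1)" using s by (cases q) auto
    qed
    \<comment> \<open>The sum in \<open>vertex_point\<close> runs up to the dart that ends at the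
      vertex, which has number \<open>i - 1\<close>; so it has \<open>i\<close> terms, like
      \<open>psum\<close>.\<close>
    moreover have "(\<Sum>j\<le>i - 1. x (fst (cchain ?K e ! j))) = psum F x e i"
      using i by (simp add: psum_def lessThan_Suc_atMost[symmetric])
    ultimately show ?thesis
      using exc vp pos_pt_interior(1)[OF int p(1)[unfolded s]] s by (simp add: vertex_point_def)
  qed
qed

end

section \<open>Surjectivity and the bijection with effective divisors\<close>

context metric_model
begin

text \<open>Each edge is subdivided at the points of the support of \<open>E\<close> inside it, and
  the gaps serve as lengths. The pair is stable because every new vertex lies in the
  support.\<close>

lemma div_at_surj:
  assumes E: "E \<in> effective_divisors \<Gamma> d"
  shows "\<exists>F\<in>stable. \<exists>x\<in>polysimplex (\<Delta> F). div_at F x = E"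
proof -
  interpret base: fin_digraph "gr G" by (rule fin_G)
  have nn: "\<And>p. 0 \<le> coeff E p" and sub: "support E \<subseteq> \<Gamma>" and deg: "div_degree E = int d"
    using E by (auto simp: effective_divisors_def)
  define T where "T e = {t. On e t \<in> support E}" for e
  define ts where "ts e = sorted_list_of_set (T e)" for e
  have finT: "finite (T e)" for e
  proof -
    have "On e ` T e \<subseteq> support E" by (auto simp: T_def)
    then have "finite (On e ` T e :: ('v, 'e) gpoint set)" by (rule finite_subset) simp
    then show ?thesis by (rule finite_imageD) (simp add: inj_on_def)
  qed
  have set_ts: "set (ts e) = T e" for e using finT by (simp add: ts_def)
  have sorted_ts: "sorted_wrt (<) (ts e)" for e by (simp add: ts_def)
  have ts_in: "ts e ! i \<in> T e" if "i < length (ts e)" for e i using that set_ts nth_mem by blast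
  have T_range: "0 < t" "t < len e" if "t \<in> T e" for e t
    using that sub by (auto simp: T_def metric_graph_def)
  \<comment> \<open>The subdivision points of \<open>e\<close> in order, completed by the tail as
    number 0 and the head as number \<open>length (ts e) + 1\<close>.\<close>
  define q where "q e i = (if i = 0 then 0 else if i \<le> length (ts e) then ts e ! (i - 1) else len e)" for e i
  have q_less: "q e i < q e (Suc i)" if e: "e \<in> edges G" and i: "i \<le> length (ts e)" for e i
  proof -
    consider "i = 0" "ts e = []" | "i = 0" "ts e \<noteq> []" | "0 < i" "i < length (ts e)" | "0 < i" "i = length (ts e)"
      using i by (cases "ts e = []") force+
    then show ?thesis
    proof cases
      case 1
      then show ?thesis using len_pos[OF e] by (simp add: q_def)
    next
      case 2
      then show ?thesis using T_range(1)[OF ts_in[of 0 e]] by (auto simp: q_def Suc_le_eq)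
    next
      case 3
      then show ?thesis using sorted_wrt_nth_less[OF sorted_ts[of e], of "i - 1" i] by (simp add: q_def)
    next
      case 4
      then show ?thesis using T_range(2)[OF ts_in[of "i - 1" e]] by (simp add: q_def)
    qed
  qed
  have finS: "finite (SIGMA e:edges G. {..length (ts e)})" by auto
  \<comment> \<open>\<open>\<mu>\<close> labels the gaps. The points of \<open>ts e\<close> cut
    \<open>e\<close> into one piece more than there are points, which is why the index
    \<open>length (ts e)\<close> is included.\<close>
  obtain \<mu> :: "'e \<times> nat \<Rightarrow> nat" where \<mu>: "inj_on \<mu> (SIGMA e:edges G. {..length (ts e)})"
    using finite_imp_inj_to_nat_seg[OF finS] by blast
  define L where "L e = map (\<lambda>i. \<mu> (e, i)) [0..<Suc (length (ts e))]" for e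
  define K0 :: "(nat, nat, 'v, 'e) chains" where "K0 = label_chains L (\<lambda>_. 0)"
  have lenK0 [simp]: "clen K0 e = Suc (length (ts e))" for e by (simp add: K0_def L_def)
  have pos0: "Inr (e, i) \<in> positions G K0 \<longleftrightarrow> e \<in> edges G \<and> 0 < i \<and> i \<le> length (ts e)" for e i
    by auto
  define pt where "pt p = (case p of Inl v \<Rightarrow> At v | Inr (e, i) \<Rightarrow> On e (q e i))" for p :: "'v + 'e \<times> nat"
  have q_T: "q e i \<in> T e" if "0 < i" "i \<le> length (ts e)" for e i
    using that ts_in[of "i - 1" e] by (simp add: q_def)
  have inj: "inj_on pt (positions G K0)"
  proof (rule inj_onI)
    fix p p' assume p: "p \<in> positions G K0" and p': "p' \<in> positions G K0" and eq: "pt p = pt p'"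
    show "p = p'"
    proof (cases p; cases p')
      fix s s' assume ps: "p = Inr s" "p' = Inr s'"
      obtain e i e' i' where s: "s = (e, i)" "s' = (e', i')" by (cases s; cases s')
      have e: "e' = e" "q e i = q e i'" using eq ps s by (auto simp: pt_def)
      have i: "0 < i" "i \<le> length (ts e)" "0 < i'" "i' \<le> length (ts e)"
        using p p' pos0 ps s e(1) by auto
      have "ts e ! (i - 1) = ts e ! (i' - 1)" using e(2) i by (simp add: q_def)
      moreover have "distinct (ts e)" by (simp add: ts_def)
      ultimately have "i - 1 = i' - 1" using i by (simp add: nth_eq_iff_index_eq)
      then show "p = p'" using i e ps s by simp
    qed (use eq in \<open>auto simp: pt_def split: prod.splits\<close>)
  qed
  have sup: "support E \<subseteq> pt ` positions G K0"
  proof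
    fix g assume g: "g \<in> support E"
    show "g \<in> pt ` positions G K0"
    proof (cases g)
      case (At v)
      then have "v \<in> vertices G" using g sub by (auto simp: metric_graph_def)
      then show ?thesis using At by (intro image_eqI[of _ _ "Inl v"]) (simp_all add: pt_def)
    next
      case (On e t)
      then have "t \<in> set (ts e)" using g by (simp add: set_ts T_def)
      then obtain j where j: "j < length (ts e)" "ts e ! j = t" by (auto simp: in_set_conv_nth)
      have "e \<in> edges G" using On g sub by (auto simp: metric_graph_def)
      then have "Inr (e, Suc j) \<in> positions G K0" using j by simp
      moreover have "g = pt (Inr (e, Suc j))" using j On by (simp add: pt_def q_def)
      ultimately show ?thesis by blast
    qed
  qed
  define \<pi> where "\<pi> = inv_into (positions G K0) pt"
  have pi: "\<pi> (pt p) = p" if "p \<in> positions G K0" for p using that inj by (simp add: \<pi>_def)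
  have E1: "push_div \<pi> E \<in> effective_divisors (positions G K0) d"
  proof (rule effective_divisors_push_div)
    show "E \<in> effective_divisors (pt ` positions G K0) d" using nn sup deg by (simp add: effective_divisors_def)
    show "\<pi> ` pt ` positions G K0 \<subseteq> positions G K0" using pi by auto
  qed
  have E2: "0 < coeff (push_div \<pi> E) (Inr s)" if s: "Inr s \<in> positions G K0" for s
  proof -
    obtain e i where ei: "s = (e, i)" by (cases s)
    have "q e i \<in> T e" using s pos0 q_T unfolding ei by blast
    then have "pt (Inr s) \<in> support E" by (simp add: pt_def ei T_def)
    from coeff_push_div_pos[OF nn this, of \<pi>] show ?thesis using pi[OF s] by simp
  qed
  have muE: "e = e' \<and> i = i'" if "\<mu> (e, i) = \<mu> (e', i')" "e \<in> edges G" "e' \<in> edges G"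
    "i \<le> length (ts e)" "i' \<le> length (ts e')" for e e' i i'
    using inj_onD[OF \<mu> that(1)] that(2-5) by simp
  have Ldist: "distinct (L e)" if e: "e \<in> edges G" for e
    unfolding L_def distinct_map
  proof (intro conjI inj_onI)
    fix i i' assume i: "i \<in> set [0..<Suc (length (ts e))]" "i' \<in> set [0..<Suc (length (ts e))]"
      and eq: "\<mu> (e, i) = \<mu> (e, i')"
    have "i \<le> length (ts e)" "i' \<le> length (ts e)" using i by auto
    from muE[OF eq e e this] show "i = i'" by simp
  qed simp
  have Ldisj: "e = e'" if e: "e \<in> edges G" "e' \<in> edges G" and a: "a \<in> set (L e)" "a \<in> set (L e')" for a e e'
  proof -
    obtain i where i: "i \<le> length (ts e)" "a = \<mu> (e, i)" using a(1) unfolding L_def by (auto simp: less_Suc_eq_le simp del: upt_Suc)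
    obtain i' where i': "i' \<le> length (ts e')" "a = \<mu> (e', i')" using a(2) unfolding L_def by (auto simp: less_Suc_eq_le simp del: upt_Suc)
    have "\<mu> (e, i) = \<mu> (e', i')" using i i' by simp
    from muE[OF this e i(1) i'(1)] show ?thesis by simp
  qed
  have "\<exists>F\<in>stable. cchain (sp_chains F) = (\<lambda>e. map (\<lambda>a. (a, True)) (L e)) \<and>
      sp_div F = push_div (pos_vertex (sp_graph F) (sp_chains F)) (push_div \<pi> E)"
    by (rule stable_pair_of_labels[OF fin_G _ _ _ E1[unfolded K0_def] E2[unfolded K0_def]])
      (simp add: L_def, fact Ldist, fact Ldisj)
  then obtain F where F: "F \<in> stable" and ch: "cchain (sp_chains F) = (\<lambda>e. map (\<lambda>a. (a, True)) (L e))"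
    and D: "sp_div F = push_div (pos_vertex (sp_graph F) (sp_chains F)) (push_div \<pi> E)"
    by blast
  let ?H = "sp_graph F" and ?K = "sp_chains F"
  interpret chained ?H G ?K using stable_chained[OF F] .
  have n: "clen ?K e = Suc (length (ts e))" for e by (simp add: ch L_def)
  \<comment> \<open>The length of an edge is the gap between consecutive subdivision points, so that
    partial sums telescope to \<open>q\<close>.\<close>
  define x where "x a = (if a \<in> edges ?H then
      case inv_into (slots G ?K) (slot_arc ?K) a of (e, i) \<Rightarrow> q e (Suc i) - q e i else 0)" for a
  have x_slot: "x (fst (cchain ?K e ! i)) = q e (Suc i) - q e i"
    if e: "e \<in> edges G" and i: "i < clen ?K e" for e i
  proof -
    have "inv_into (slots G ?K) (slot_arc ?K) (slot_arc ?K (e, i)) = (e, i)"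
      using e i bij_betw_imp_inj_on[OF bij_slots] by (intro inv_into_f_f) auto
    then show ?thesis using slot_arc_in_arcs[OF e i] by (simp add: x_def)
  qed
  have ps: "psum F x e i = q e i" if e: "e \<in> edges G" and i: "i \<le> clen ?K e" for e i
    using i
  proof (induction i)
    case 0
    then show ?case by (simp add: q_def)
  next
    case (Suc i)
    then show ?case using x_slot[OF e, of i] by (simp add: psum_Suc)
  qed
  have xP: "x \<in> polysimplex (\<Delta> F)"
    unfolding polysimplex_def mem_Collect_eq coords_sigma_ob[OF F]
  proof (intro conjI allI impI)
    fix a show "0 \<le> x a"
    proof (cases "a \<in> edges ?H")
      case True
      then obtain e i where e: "e \<in> edges G" and i: "i < clen ?K e" and a: "a = fst (cchain ?K e ! i)"
        by (rule obtain_slot)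
      show ?thesis using x_slot[OF e i] q_less[OF e, of i] i a n[of e] by simp
    qed (simp add: x_def)
  next
    show "\<forall>(I, a)\<in>\<Delta> F. sum x I = a"
    proof safe
      fix I a assume "(I, a) \<in> \<Delta> F"
      then obtain e where e: "e \<in> edges G" "I = fst ` set (cchain ?K e)" "a = len e"
        by (auto simp: sigma_ob_def)
      have "sum x I = q e (clen ?K e)" unfolding e(2) sum_chain[OF F e(1)] using ps[OF e(1)] by simp
      then show "sum x I = a" by (simp add: e(3) n q_def)
    qed
  qed (simp add: x_def)
  have "vert_pt F x (pos_vertex ?H ?K (\<pi> g)) = g" if g: "g \<in> support E" for g
  proof -
    obtain p where p: "p \<in> positions G K0" "g = pt p" using g sup by blast
    have pK: "p \<in> positions G ?K"
      using p(1) positions_cong[of G K0 ?K] by (simp add: K0_def ch)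
    have "vert_pt F x (pos_vertex ?H ?K (\<pi> g)) = pos_pt F x p"
      using vert_pt_pos_vertex[OF F pK] pi[OF p(1)] p(2) by simp
    also have "\<dots> = pt p"
    proof (cases p)
      case (Inl v)
      then show ?thesis by (simp add: pos_pt_def pt_def)
    next
      case (Inr s)
      then obtain e i where s: "p = Inr (e, i)" by (cases s) auto
      then have e: "e \<in> edges G" and i: "0 < i" "i \<le> length (ts e)" using p(1) pos0 by auto
      have "psum F x e i = q e i" using ps[OF e] i n[of e] by simp
      then show ?thesis using T_range[OF q_T[OF i]] s by (simp add: pos_pt_def pt_def edge_pt_def)
    qed
    finally show ?thesis using p(2) by simp
  qed
  then have "div_at F x = E"
    unfolding div_at_def D push_div_push_div by (rule push_div_id)
  then show ?thesis using F xP by blast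
qed

text \<open>The representative of the class is arbitrary; \<open>div_at_glue\<close> makes the value
  independent of it.\<close>

definition realization_div :: "(('v, 'e) stable_pair \<times> (nat \<Rightarrow> real)) set \<Rightarrow> ('v, 'e) gpoint \<Rightarrow>\<^sub>0 int" where
  "realization_div C = case_prod div_at (SOME p. p \<in> C)"

lemma realization_div_class: "realization_div (glue_rel `` {p}) = case_prod div_at p"
proof -
  have "p \<in> glue_rel `` {p}" using glue_rel_equiv(1) by (cases p) (simp add: refl_on_def)
  then have "(SOME q. q \<in> glue_rel `` {p}) \<in> glue_rel `` {p}" by (rule someI)
  then have "(p, SOME q. q \<in> glue_rel `` {p}) \<in> glue_rel" by simp
  from div_at_glue[OF this] show ?thesis unfolding realization_div_def by (rule sym)
qed

lemma bij_realization_div: "bij_betw realization_div (realization \<Xi> \<Delta> \<Delta>_mor) (effective_divisors \<Gamma> d)"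
proof -
  have pts: "points_over \<Xi> \<Delta> = {(F, x). F \<in> stable \<and> x \<in> polysimplex (\<Delta> F)}"
    unfolding points_over_def \<Xi>_simps by auto
  have eqv: "equiv UNIV glue_rel"
    using glue_rel_equiv by (simp add: equiv_def refl_on_def)
  have inj: "inj_on realization_div (realization \<Xi> \<Delta> \<Delta>_mor)"
  proof (rule inj_onI)
    fix C C' assume C: "C \<in> realization \<Xi> \<Delta> \<Delta>_mor" and C': "C' \<in> realization \<Xi> \<Delta> \<Delta>_mor"
      and eq: "realization_div C = realization_div C'"
    obtain F x where F: "F \<in> stable" "x \<in> polysimplex (\<Delta> F)" "C = glue_rel `` {(F, x)}"
      using C unfolding realization_def pts by (auto elim!: quotientE)
    obtain F' x' where F': "F' \<in> stable" "x' \<in> polysimplex (\<Delta> F')" "C' = glue_rel `` {(F', x')}"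
      using C' unfolding realization_def pts by (auto elim!: quotientE)
    have "div_at F x = div_at F' x'"
      using eq realization_div_class[of "(F, x)"] realization_div_class[of "(F', x')"] F(3) F'(3) by simp
    from glued_if_div_at_eq[OF F(1) F'(1) F(2) F'(2) this] show "C = C'"
      unfolding F(3) F'(3) by (rule equiv_class_eq[OF eqv])
  qed
  have sub: "realization_div C \<in> effective_divisors \<Gamma> d" if C: "C \<in> realization \<Xi> \<Delta> \<Delta>_mor" for C
  proof -
    obtain F x where F: "F \<in> stable" "C = glue_rel `` {(F, x)}"
      using C unfolding realization_def pts by (auto elim!: quotientE)
    then show ?thesis using div_at_effective[OF F(1)] realization_div_class[of "(F, x)"] by simp
  qed
  have sur: "E \<in> realization_div ` realization \<Xi> \<Delta> \<Delta>_mor" if E: "E \<in> effective_divisors \<Gamma> d" for E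
  proof -
    obtain F x where F: "F \<in> stable" "x \<in> polysimplex (\<Delta> F)" "div_at F x = E" using div_at_surj[OF E] by blast
    then have "glue_rel `` {(F, x)} \<in> realization \<Xi> \<Delta> \<Delta>_mor"
      unfolding realization_def pts by (intro quotientI) simp
    moreover have "realization_div (glue_rel `` {(F, x)}) = E" using realization_div_class[of "(F, x)"] F(3) by simp
    ultimately show ?thesis by blast
  qed
  show ?thesis unfolding bij_betw_def using inj sub sur by blast
qed

end

theorem proposition1p11:
  fixes G :: "('v, 'e) pre_digraph" and len :: "'e \<Rightarrow> real"
    and h :: "('v, 'e) gpoint \<Rightarrow> nat" and d :: nat
  assumes "tropical_curve_model G len h"
  defines "\<Xi> \<equiv> op_cat (stable_pair_cat (model_wgraph G h) d)"
  shows "polysimplicial_complex_without_self_gluing \<Xi> (sigma_ob G len) (sigma_mor G len) \<and>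
    (\<exists>\<Psi>. bij_betw \<Psi> (realization \<Xi> (sigma_ob G len) (sigma_mor G len))
                  (effective_divisors (metric_graph G len) d) \<and>
         (\<forall>F\<in>Ob \<Xi>. \<forall>x\<in>polysimplex (sigma_ob G len F).
            (\<forall>a\<in>arcs (gr (sp_graph F)). 0 < x a) \<longrightarrow>
            \<Psi> (glue \<Xi> (sigma_ob G len) (sigma_mor G len) `` {(F, x)}) =
              point_divisor (model_wgraph G h) F x))"
proof -
  have gr: "gr (model_wgraph G h) = G" by (simp add: model_wgraph_def)
  interpret M: metric_model "model_wgraph G h" d len
    using assms(1) by unfold_locales (auto simp: gr tropical_curve_model_def fin_digraph_def
        fin_digraph_axioms_def wf_digraph_def)
  have "M.realization_div (M.glue_rel `` {(F, x)}) = point_divisor (model_wgraph G h) F x"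
    if "F \<in> M.stable" "x \<in> polysimplex (M.\<Delta> F)" "\<forall>a\<in>arcs (gr (sp_graph F)). 0 < x a" for F x
    using M.realization_div_class[of "(F, x)"] M.point_divisor_interior[of F x] that
    by (simp add: M.interior_point_def)
  then show ?thesis
    using M.complex_without_self_gluing M.bij_realization_div
    unfolding \<Xi>_def M.\<Xi>_simps gr by blast
qed

end
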